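(* Let $\theta$ be a primitive, aperiodic, bijective, simplified substitution of length $\ell$ and suppose that its structural semigroup $\mathcal M^{fib}_0(X_\theta)$ is generated by its idempotents. Then $E^{fib}(X_\theta)$ is topologically isomorphic to $$E^{fib}(X_\theta)\;\cong\;(\mathcal M^{fib}_0(X_\theta)\cup\{\mathrm{Id}\})\times\prod_{[z]\in\mathbb Z_\ell/\mathbb Z,\ [z]\neq[0]}G_\theta .$$ Using the sets $I_\theta$, $\{\pm\}$ and the sandwich matrix $A$ from the normalised Rees matrix form $M[G_\theta;I_\theta,\{\pm\};A]$ of $\mathcal M^{fib}_0(X_\theta)$, this can also be expressed as follows: $E^{fib}(X_\theta)\setminus\{\mathrm{Id}\}$ is completely simple and topologically isomorphic to $$E^{fib}(X_\theta)\setminus\{\mathrm{Id}\}\cong M[\mathcal G_\theta^{fib};I_\theta,\{\pm\};A],\qquad \mathcal G_\theta^{fib}=G_\theta^{\mathbb Z_\ell/\mathbb Z}.$$ Here an entry $a_{\lambda g}$ of $A$ is identified with the function $\tilde f\in\mathcal G_\theta^{fib}$ having value $a_{\lambda g}$ at $[0]$ and value $\mathbf 1$ at every $[z]\ne[0]$. Furthermore, $E(X_\theta)\setminus\mathbb Z$ is algebraically isomorphic to $$E(X_\theta)\setminus\mathbb Z\cong M[\mathcal G_\theta;I_\theta,\{\pm\};A],\qquad \mathcal G_\theta=\mathcal G_\theta^{fib}\rtimes\mathbb Z_\ell$$ (a semidirect product), where $A$ is understood to take values in the subgroup $G_\theta\times\{\mathbf 1\}^{(\mathbb Z_\ell/\mathbb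 Z)\setminus\{[0]\}}\rtimes\{0\}$ of $G_\theta^{\mathbb Z_\ell/\mathbb Z}\rtimes\mathbb Z_\ell$.
   Context: Let $\mathcal A$ be a finite alphabet. A substitution of length $\ell$ is a map $\theta(a)=\theta_0(a)\cdots\theta_{\ell-1}(a)$ with maps $\theta_i:\mathcal A\to\mathcal A$, extended by concatenation to finite words and to bi-infinite sequences ($\theta(u_0)$ being placed starting at index $0$). It is bijective if all $\theta_i$ are bijections, and primitive if for some $k$ every $\theta^k(a)$ contains every letter. Write $\theta^n(a)=(\theta^n)_0(a)\cdots(\theta^n)_{\ell^n-1}(a)$. A word is allowed if it occurs in some $\theta^k(a)$; $X_\theta\subset\mathcal A^{\mathbb Z}$ is the space of sequences all of whose finite subwords are allowed, with left shift $\sigma$. $\theta$ is aperiodic if $X_\theta$ contains no $\sigma$-periodic sequence. A bijective $\theta$ is simplified if every $\theta$-periodic point of $X_\theta$ is fixed by $\theta$ (in particular $\theta_0=\theta_{\ell-1}=\mathbf 1$) and every word $\theta(a)$ contains all letters of $\mathcal A$. $\mathbb Z_\ell=\varprojlim\mathbb Z/\ell^n\mathbb Z$. For each $n$ the sets $\sigma^i(\theta^n(X_\theta))$, $0\le i<\ell^n$, partition $X_\theta$; put $\pi_n(x)=i$ if $x\in\sigma^i(\theta^n(X_\theta))$. The $\pi_n$ define the factor map $\pi:X_\theta\to\mathbb Z_\ell$, $\pi\circ\sigma=(+1)\circ\pi$. $\mathbb Z_\ell/\mathbb Z$ is the set of orbits $[z]$ of $(+1)$ on $\mathbb Z_\ell$.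 The Ellis semigroup $E(X_\theta)$ is the closure of $\{\sigma^t:t\in\mathbb Z\}$ in $X_\theta^{X_\theta}$ (topology of pointwise convergence, composition); $\mathbb Z\subset E(X_\theta)$ denotes $\{\sigma^t\}$. $E^{fib}(X_\theta)$ is the subsemigroup of elements preserving all fibres $\pi^{-1}(z)$, $E^{fib}_0(X_\theta)$ its restriction to $\pi^{-1}(0)$, and the structural semigroup $\mathcal M^{fib}_0(X_\theta)$ is the kernel (smallest two-sided ideal) of $E^{fib}_0(X_\theta)$, a finite semigroup; $E^{fib}_0(X_\theta)=\mathcal M^{fib}_0(X_\theta)\cup\{\mathrm{Id}\}$, where $\mathrm{Id}$ is the identity map. $G_\theta$ is the group of permutations of $\mathcal A$ generated by all $(\theta^n)_i$; $I_\theta=\{(\theta^n)_i(\theta^n)_{i-1}^{-1}: n\in\mathbb N, 1\le i\le\ell^n-1\}$. $M[G;I,\Lambda;A]$ denotes $I\times G\times\Lambda$ with product $(i,g,\lambda)(j,h,\mu)=(i,g\,a_{\lambda j}h,\mu)$. The normalised Rees matrix form of $\mathcal M^{fib}_0(X_\theta)$ is $M[G_\theta;I_\theta,\{\pm\};A]$ with $a_{+\,g}=\mathbf 1$, $a_{-\,g}=g_0g^{-1}$ for a fixed $g_0\in I_\theta$. Infinite products carry the product topology, finite sets the discrete topology, and matrix semigroups the product topology on $I\times G\times\Lambda$. A semigroup is completely simple if it has no proper two-sided ideal and has a minimal idempotent (minimal for $p\le q\iff p=pq=qp$).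
   Formalization: In the first isomorphism the product is replaced by its subsemigroup (M^fib_0 × ∏G_θ) ∪ {(Id,1)}; the literal product has units (Id,g) with g≠1, contradicting that E^fib∖{Id} is a completely simple semigroup. *)

theory Defs
  imports
    "HOL-Analysis.Analysis"
    "HOL-Algebra.Bij"
    "HOL-Algebra.Generated_Groups"
    "HOL-Algebra.Product_Groups"
    "HOL-Library.Sublist"
begin

section \<open>Semigroups\<close>

text \<open>Semigroups are represented by monoid records, so that \<^const>\<open>iso\<close> and direct products
  are available; only the fields \<^const>\<open>carrier\<close> and \<^const>\<open>mult\<close> matter, and the
  field \<^const>\<open>one\<close> need not lie in the carrier.\<close>

definition is_semigroup :: "('s, 'm) monoid_scheme \<Rightarrow> bool" where
  "is_semigroup S \<longleftrightarrow>
     (\<forall>x\<in>carrier S. \<forall>y\<in>carrier S. x \<otimes>\<^bsub>S\<^esub> y \<in> carrier S) \<and>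
     (\<forall>x\<in>carrier S. \<forall>y\<in>carrier S. \<forall>z\<in>carrier S.
        (x \<otimes>\<^bsub>S\<^esub> y) \<otimes>\<^bsub>S\<^esub> z = x \<otimes>\<^bsub>S\<^esub> (y \<otimes>\<^bsub>S\<^esub> z))"

definition two_sided_ideal :: "('s, 'm) monoid_scheme \<Rightarrow> 's set \<Rightarrow> bool" where
  "two_sided_ideal S J \<longleftrightarrow> J \<noteq> {} \<and> J \<subseteq> carrier S \<and>
     (\<forall>x\<in>carrier S. \<forall>y\<in>J. x \<otimes>\<^bsub>S\<^esub> y \<in> J \<and> y \<otimes>\<^bsub>S\<^esub> x \<in> J)"

text \<open>The intersection of all two-sided ideals is the smallest one whenever a smallest one
  exists, in particular for finite semigroups.\<close>

definition semigroup_kernel :: "('s, 'm) monoid_scheme \<Rightarrow> 's set" where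
  "semigroup_kernel S = \<Inter> {J. two_sided_ideal S J}"

definition idempotents :: "('s, 'm) monoid_scheme \<Rightarrow> 's set" where
  "idempotents S = {p \<in> carrier S. p \<otimes>\<^bsub>S\<^esub> p = p}"

inductive_set semigroup_generate :: "('s, 'm) monoid_scheme \<Rightarrow> 's set \<Rightarrow> 's set"
  for S (structure) and B where
    incl: "b \<in> B \<Longrightarrow> b \<in> semigroup_generate S B"
  | mult: "x \<in> semigroup_generate S B \<Longrightarrow> y \<in> semigroup_generate S B
             \<Longrightarrow> x \<otimes> y \<in> semigroup_generate S B"

definition generated_by_idempotents :: "('s, 'm) monoid_scheme \<Rightarrow> bool" where
  "generated_by_idempotents S \<longleftrightarrow> semigroup_generate S (idempotents S) = carrier S"

definition idem_le :: "('s, 'm) monoid_scheme \<Rightarrow> 's \<Rightarrow> 's \<Rightarrow> bool" where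
  "idem_le S p q \<longleftrightarrow> p = p \<otimes>\<^bsub>S\<^esub> q \<and> p = q \<otimes>\<^bsub>S\<^esub> p"

definition completely_simple :: "('s, 'm) monoid_scheme \<Rightarrow> bool" where
  "completely_simple S \<longleftrightarrow> is_semigroup S \<and>
     (\<forall>J. two_sided_ideal S J \<longrightarrow> J = carrier S) \<and>
     (\<exists>p\<in>idempotents S. \<forall>q\<in>idempotents S. idem_le S q p \<longrightarrow> q = p)"

text \<open>Membership in \<^const>\<open>iso\<close> does not force the carriers to be closed under
  multiplication, hence the explicit \<^const>\<open>is_semigroup\<close> conditions.\<close>

definition semigroup_isomorphic ::
  "('s, 'm) monoid_scheme \<Rightarrow> ('t, 'n) monoid_scheme \<Rightarrow> bool" where
  "semigroup_isomorphic S T \<longleftrightarrow> is_semigroup S \<and> is_semigroup T \<and> (\<exists>f. f \<in> iso S T)"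

definition semigroup_top_isomorphic ::
  "('s, 'm) monoid_scheme \<Rightarrow> 's topology \<Rightarrow> ('t, 'n) monoid_scheme \<Rightarrow> 't topology \<Rightarrow> bool"
  where
  "semigroup_top_isomorphic S TS T TT \<longleftrightarrow> is_semigroup S \<and> is_semigroup T \<and>
     (\<exists>f. f \<in> iso S T \<and> homeomorphic_map TS TT f)"

text \<open>Semigroups of self-maps of \<open>X\<close> consist of functions that are extensional on \<open>X\<close>.\<close>

definition map_semigroup :: "'x set \<Rightarrow> ('x \<Rightarrow> 'x) set \<Rightarrow> ('x \<Rightarrow> 'x) monoid" where
  "map_semigroup X S = \<lparr>carrier = S, mult = compose X, one = (\<lambda>x\<in>X. x)\<rparr>"

definition rees_semigroup ::
  "('g, 'm) monoid_scheme \<Rightarrow> 'i set \<Rightarrow> 'l set \<Rightarrow> ('l \<Rightarrow> 'i \<Rightarrow> 'g) \<Rightarrow> ('i \<times> 'g \<times> 'l) monoid" where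
  "rees_semigroup G I L A =
     \<lparr>carrier = I \<times> carrier G \<times> L,
      mult = (\<lambda>(i, g, l) (j, h, m). (i, g \<otimes>\<^bsub>G\<^esub> A l j \<otimes>\<^bsub>G\<^esub> h, m)),
      one = undefined\<rparr>"

definition rees_topology :: "'g topology \<Rightarrow> 'i set \<Rightarrow> 'l set \<Rightarrow> ('i \<times> 'g \<times> 'l) topology" where
  "rees_topology TG I L =
     prod_topology (discrete_topology I) (prod_topology TG (discrete_topology L))"

text \<open>To be used with an action \<open>\<phi> \<in> hom H (AutoGroup G)\<close>.\<close>

definition semidirect_product ::
  "('g, 'm) monoid_scheme \<Rightarrow> ('h, 'n) monoid_scheme \<Rightarrow> ('h \<Rightarrow> 'g \<Rightarrow> 'g) \<Rightarrow> ('g \<times> 'h) monoid"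
  where
  "semidirect_product G H \<phi> =
     \<lparr>carrier = carrier G \<times> carrier H,
      mult = (\<lambda>(g, h) (g', h'). (g \<otimes>\<^bsub>G\<^esub> \<phi> h g', h \<otimes>\<^bsub>H\<^esub> h')),
      one = (\<one>\<^bsub>G\<^esub>, \<one>\<^bsub>H\<^esub>)\<rparr>"


section \<open>Substitutions of constant length\<close>

text \<open>Length 1 is excluded: it can only be primitive over a one-letter alphabet, and then
  the substitution space is empty.\<close>

definition substitution :: "('a \<Rightarrow> 'a list) \<Rightarrow> nat \<Rightarrow> bool" where
  "substitution \<theta> l \<longleftrightarrow> 2 \<le> l \<and> (\<forall>a. length (\<theta> a) = l)"

definition subst_word :: "('a \<Rightarrow> 'a list) \<Rightarrow> 'a list \<Rightarrow> 'a list" where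
  "subst_word \<theta> w = concat (map \<theta> w)"

definition subst_pow :: "('a \<Rightarrow> 'a list) \<Rightarrow> nat \<Rightarrow> 'a \<Rightarrow> 'a list" where
  "subst_pow \<theta> n a = (subst_word \<theta> ^^ n) [a]"

text \<open>The map \<open>(\<theta>\<^sup>n)\<^sub>i\<close>.\<close>

definition subst_col :: "('a \<Rightarrow> 'a list) \<Rightarrow> nat \<Rightarrow> nat \<Rightarrow> 'a \<Rightarrow> 'a" where
  "subst_col \<theta> n i = (\<lambda>a. subst_pow \<theta> n a ! i)"

definition subst_seq :: "('a \<Rightarrow> 'a list) \<Rightarrow> nat \<Rightarrow> (int \<Rightarrow> 'a) \<Rightarrow> (int \<Rightarrow> 'a)" where
  "subst_seq \<theta> l u = (\<lambda>k. \<theta> (u (k div int l)) ! nat (k mod int l))"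

definition bijective_subst :: "('a \<Rightarrow> 'a list) \<Rightarrow> nat \<Rightarrow> bool" where
  "bijective_subst \<theta> l \<longleftrightarrow> (\<forall>i<l. bij (\<lambda>a. \<theta> a ! i))"

definition primitive_subst :: "('a \<Rightarrow> 'a list) \<Rightarrow> bool" where
  "primitive_subst \<theta> \<longleftrightarrow> (\<exists>k\<ge>1. \<forall>a. set (subst_pow \<theta> k a) = UNIV)"

definition allowed_word :: "('a \<Rightarrow> 'a list) \<Rightarrow> 'a list \<Rightarrow> bool" where
  "allowed_word \<theta> w \<longleftrightarrow> (\<exists>k a. sublist w (subst_pow \<theta> k a))"

definition subst_space :: "('a \<Rightarrow> 'a list) \<Rightarrow> (int \<Rightarrow> 'a) set" where
  "subst_space \<theta> = {x. \<forall>i n. allowed_word \<theta> (map (\<lambda>j. x (i + int j)) [0..<n])}"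

text \<open>The power \<open>\<sigma>\<^sup>t\<close> of the left shift.\<close>

definition shift :: "int \<Rightarrow> (int \<Rightarrow> 'a) \<Rightarrow> (int \<Rightarrow> 'a)" where
  "shift t x = (\<lambda>k. x (k + t))"

definition aperiodic_subst :: "('a \<Rightarrow> 'a list) \<Rightarrow> bool" where
  "aperiodic_subst \<theta> \<longleftrightarrow> \<not> (\<exists>x\<in>subst_space \<theta>. \<exists>p\<ge>1. shift p x = x)"

definition simplified_subst :: "('a \<Rightarrow> 'a list) \<Rightarrow> nat \<Rightarrow> bool" where
  "simplified_subst \<theta> l \<longleftrightarrow>
     (\<forall>x\<in>subst_space \<theta>. (\<exists>k\<ge>1. (subst_seq \<theta> l ^^ k) x = x) \<longrightarrow> subst_seq \<theta> l x = x) \<and>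
     (\<forall>a. set (\<theta> a) = UNIV)"

definition space_topology :: "('a \<Rightarrow> 'a list) \<Rightarrow> (int \<Rightarrow> 'a) topology" where
  "space_topology \<theta> =
     subtopology (product_topology (\<lambda>_. discrete_topology UNIV) UNIV) (subst_space \<theta>)"

text \<open>The group \<open>G\<^sub>\<theta>\<close> and the set \<open>I\<^sub>\<theta>\<close>.\<close>

definition struct_group :: "('a \<Rightarrow> 'a list) \<Rightarrow> nat \<Rightarrow> ('a \<Rightarrow> 'a) monoid" where
  "struct_group \<theta> l =
     subgroup_generated (BijGroup UNIV) {subst_col \<theta> n i | n i. i < l ^ n}"

definition struct_I :: "('a \<Rightarrow> 'a list) \<Rightarrow> nat \<Rightarrow> ('a \<Rightarrow> 'a) set" where
  "struct_I \<theta> l =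
     {subst_col \<theta> n i \<otimes>\<^bsub>struct_group \<theta> l\<^esub> inv\<^bsub>struct_group \<theta> l\<^esub> subst_col \<theta> n (i - 1) | n i.
        1 \<le> i \<and> i \<le> l ^ n - 1}"

datatype pm = Plus | Minus

fun sandwich :: "('a \<Rightarrow> 'a list) \<Rightarrow> nat \<Rightarrow> ('a \<Rightarrow> 'a) \<Rightarrow> pm \<Rightarrow> ('a \<Rightarrow> 'a) \<Rightarrow> ('a \<Rightarrow> 'a)" where
  "sandwich \<theta> l g0 Plus g = \<one>\<^bsub>struct_group \<theta> l\<^esub>"
| "sandwich \<theta> l g0 Minus g = g0 \<otimes>\<^bsub>struct_group \<theta> l\<^esub> inv\<^bsub>struct_group \<theta> l\<^esub> g"


section \<open>The odometer and the factor map\<close>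

text \<open>An element of the inverse limit \<open>\<int>\<^sub>l\<close> is the sequence of its residues,
  the residue modulo \<open>l\<^sup>n\<close> being represented in \<open>{0..<l\<^sup>n}\<close>.\<close>

definition adic_group :: "nat \<Rightarrow> (nat \<Rightarrow> int) monoid" where
  "adic_group l =
     \<lparr>carrier = {z. \<forall>n. 0 \<le> z n \<and> z n < int l ^ n \<and> z (Suc n) mod int l ^ n = z n},
      mult = (\<lambda>z w n. (z n + w n) mod int l ^ n),
      one = (\<lambda>n. 0)\<rparr>"

definition adic_of_int :: "nat \<Rightarrow> int \<Rightarrow> (nat \<Rightarrow> int)" where
  "adic_of_int l k = (\<lambda>n. k mod int l ^ n)"

definition adic_orbit :: "nat \<Rightarrow> (nat \<Rightarrow> int) \<Rightarrow> (nat \<Rightarrow> int) set" where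
  "adic_orbit l z = {z \<otimes>\<^bsub>adic_group l\<^esub> adic_of_int l k | k. True}"

definition adic_orbits :: "nat \<Rightarrow> (nat \<Rightarrow> int) set set" where
  "adic_orbits l = adic_orbit l ` carrier (adic_group l)"

definition zero_orbit :: "nat \<Rightarrow> (nat \<Rightarrow> int) set" where
  "zero_orbit l = adic_orbit l \<one>\<^bsub>adic_group l\<^esub>"

definition factor_map :: "('a \<Rightarrow> 'a list) \<Rightarrow> nat \<Rightarrow> (int \<Rightarrow> 'a) \<Rightarrow> (nat \<Rightarrow> int)" where
  "factor_map \<theta> l x = (\<lambda>n. THE i. 0 \<le> i \<and> i < int l ^ n \<and>
     x \<in> shift i ` ((subst_seq \<theta> l ^^ n) ` subst_space \<theta>))"

definition fibre :: "('a \<Rightarrow> 'a list) \<Rightarrow> nat \<Rightarrow> (nat \<Rightarrow> int) \<Rightarrow> (int \<Rightarrow> 'a) set" where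
  "fibre \<theta> l z = {x \<in> subst_space \<theta>. factor_map \<theta> l x = z}"

abbreviation zero_fibre :: "('a \<Rightarrow> 'a list) \<Rightarrow> nat \<Rightarrow> (int \<Rightarrow> 'a) set" where
  "zero_fibre \<theta> l \<equiv> fibre \<theta> l \<one>\<^bsub>adic_group l\<^esub>"


section \<open>The Ellis semigroup\<close>

definition self_map_topology ::
  "('a \<Rightarrow> 'a list) \<Rightarrow> ((int \<Rightarrow> 'a) \<Rightarrow> (int \<Rightarrow> 'a)) topology" where
  "self_map_topology \<theta> = product_topology (\<lambda>_. space_topology \<theta>) (subst_space \<theta>)"

definition shift_maps :: "('a \<Rightarrow> 'a list) \<Rightarrow> ((int \<Rightarrow> 'a) \<Rightarrow> (int \<Rightarrow> 'a)) set" where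
  "shift_maps \<theta> = {restrict (shift t) (subst_space \<theta>) | t. True}"

definition ellis :: "('a \<Rightarrow> 'a list) \<Rightarrow> ((int \<Rightarrow> 'a) \<Rightarrow> (int \<Rightarrow> 'a)) set" where
  "ellis \<theta> = self_map_topology \<theta> closure_of shift_maps \<theta>"

definition ellis_fib :: "('a \<Rightarrow> 'a list) \<Rightarrow> nat \<Rightarrow> ((int \<Rightarrow> 'a) \<Rightarrow> (int \<Rightarrow> 'a)) set" where
  "ellis_fib \<theta> l =
     {f \<in> ellis \<theta>. \<forall>z\<in>carrier (adic_group l). f ` fibre \<theta> l z \<subseteq> fibre \<theta> l z}"

definition ellis_fib0 :: "('a \<Rightarrow> 'a list) \<Rightarrow> nat \<Rightarrow> ((int \<Rightarrow> 'a) \<Rightarrow> (int \<Rightarrow> 'a)) set" where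
  "ellis_fib0 \<theta> l = (\<lambda>f. restrict f (zero_fibre \<theta> l)) ` ellis_fib \<theta> l"

definition struct_semigroup ::
  "('a \<Rightarrow> 'a list) \<Rightarrow> nat \<Rightarrow> ((int \<Rightarrow> 'a) \<Rightarrow> (int \<Rightarrow> 'a)) monoid" where
  "struct_semigroup \<theta> l = map_semigroup (zero_fibre \<theta> l)
     (semigroup_kernel (map_semigroup (zero_fibre \<theta> l) (ellis_fib0 \<theta> l)))"


section \<open>The algebraic models\<close>

definition power_group :: "('a \<Rightarrow> 'a list) \<Rightarrow> nat \<Rightarrow> (nat \<Rightarrow> int) set set
    \<Rightarrow> ((nat \<Rightarrow> int) set \<Rightarrow> 'a \<Rightarrow> 'a) monoid" where
  "power_group \<theta> l K = product_group K (\<lambda>_. struct_group \<theta> l)"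

definition power_topology :: "('a \<Rightarrow> 'a list) \<Rightarrow> nat \<Rightarrow> (nat \<Rightarrow> int) set set
    \<Rightarrow> ((nat \<Rightarrow> int) set \<Rightarrow> 'a \<Rightarrow> 'a) topology" where
  "power_topology \<theta> l K =
     product_topology (\<lambda>_. discrete_topology (carrier (struct_group \<theta> l))) K"

text \<open>The identity is adjoined to the product of the structural semigroup \<open>M\<close> with the
  power \<open>P\<close> of \<open>G\<^sub>\<theta>\<close> over the orbits different from \<open>[0]\<close>: the model is the subsemigroup
  \<open>M \<times> P \<union> {(Id, 1)}\<close> of the direct product \<open>(M \<union> {Id}) \<times> P\<close>. The full direct product has the
  invertible elements \<open>(Id, g)\<close> for all \<open>g \<in> P\<close>, so that its non-identity elements are not even
  closed under multiplication if \<open>P\<close> is nontrivial; hence it cannot be isomorphic to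
  \<^const>\<open>ellis_fib\<close>, whose non-identity elements form a completely simple semigroup.\<close>

definition fib_model :: "('a \<Rightarrow> 'a list) \<Rightarrow> nat
    \<Rightarrow> (((int \<Rightarrow> 'a) \<Rightarrow> (int \<Rightarrow> 'a)) \<times> ((nat \<Rightarrow> int) set \<Rightarrow> 'a \<Rightarrow> 'a)) monoid" where
  "fib_model \<theta> l =
     (let M = struct_semigroup \<theta> l;
          P = power_group \<theta> l (adic_orbits l - {zero_orbit l})
      in (M \<times>\<times> P)\<lparr>carrier := carrier M \<times> carrier P \<union> {(\<lambda>x\<in>zero_fibre \<theta> l. x, \<one>\<^bsub>P\<^esub>)}\<rparr>)"

definition fib_model_topology :: "('a \<Rightarrow> 'a list) \<Rightarrow> nat
    \<Rightarrow> (((int \<Rightarrow> 'a) \<Rightarrow> (int \<Rightarrow> 'a)) \<times> ((nat \<Rightarrow> int) set \<Rightarrow> 'a \<Rightarrow> 'a)) topology" where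
  "fib_model_topology \<theta> l =
     subtopology
       (prod_topology
          (discrete_topology (carrier (struct_semigroup \<theta> l) \<union> {\<lambda>x\<in>zero_fibre \<theta> l. x}))
          (power_topology \<theta> l (adic_orbits l - {zero_orbit l})))
       (carrier (fib_model \<theta> l))"

definition at_zero_orbit :: "('a \<Rightarrow> 'a list) \<Rightarrow> nat \<Rightarrow> ('a \<Rightarrow> 'a)
    \<Rightarrow> ((nat \<Rightarrow> int) set \<Rightarrow> 'a \<Rightarrow> 'a)" where
  "at_zero_orbit \<theta> l a =
     (\<lambda>c\<in>adic_orbits l. if c = zero_orbit l then a else \<one>\<^bsub>struct_group \<theta> l\<^esub>)"

end

theory Submission
  imports Defs "HOL-Algebra.Multiplicative_Group"
begin

text \<open>
  All columns of \<open>\<theta>^n\<close> are permutations. A point of the space is therefore known as soon as one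
  letter of each of its blocks \<open>\<theta>^n(a)\<close> is known. If two decompositions of a point into such blocks
  were displaced against each other, each letter would determine its successor by a fixed
  permutation, and a point of the space would be periodic (\<open>unaligned_T_images\<close>,
  \<open>successor_not_permutation\<close>); hence the factor map is well defined. Over an adic integer outside
  \<open>\<int>\<close> the blocks around the origin exhaust the sequence, and the fibre is a copy of the alphabet.
  Over \<open>0\<close> they exhaust the two half-lines separately, and the fibre consists of the fixed points of
  the substitution, which are given by the pairs \<open>(i^{-1} a, a)\<close> of letters around the origin,
  where \<open>i\<close> runs through \<open>I\<close> (\<open>zero_fibre_point\<close>, \<open>pair_in_I\<close>).

  An element of the Ellis semigroup commutes with the shift and displaces all fibres by one adic
  integer \<open>w\<close>. Choosing a representative in each orbit of \<open>\<int>\<close> on the odometer gives the points over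
  that orbit shift-invariant coordinates, namely one letter, or two adjacent ones over the orbit of
  \<open>0\<close>. A limit of shifts that is not itself a
  shift reads at each point a single letter, and over the orbit of \<open>0\<close> it reads it always to the
  left or always to the right of the origin; it applies a permutation from \<open>G\<close>, which depends on
  the orbit, and it writes the result, over the orbit of \<open>0\<close> together with a left neighbour given by
  an element of \<open>I\<close>. So it has the form \<open>Psi i \<psi> w s\<close> (\<open>ellis_is_Psi\<close>). When two such maps are
  composed, what one has written is read by the other, possibly on the other side; this inserts the
  entry of the sandwich matrix, at the orbit of \<open>0\<close> only (\<open>Psi_mult\<close>). The product of the \<open>\<psi>\<close> is
  twisted by the translation of orbits, so the group of the Rees matrix semigroup is the semidirect
  product. The extension of \<open>\<int>_l\<close> splits because \<open>\<int>\<close> acts freely on the odometer, which is what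
  made the choice of coordinates possible.

  It remains to see that every parameter occurs. Let \<open>H\<close> be the set of all \<open>\<psi>\<close> that occur with
  \<open>w = 0\<close>. Powers with the order of \<open>G\<close> as exponent have trivial \<open>\<psi>\<close>; multiplying by them shows that
  \<open>H\<close> is a group that is the same for all \<open>i\<close> and \<open>s\<close>. It contains the sandwich entries placed at
  the orbit of \<open>0\<close> (\<open>sand_in_H\<close>). Accumulation points of shifts by \<open>l^m j\<close> show that \<open>H\<close> maps onto
  \<open>G\<close> at the orbit of \<open>0\<close> (\<open>H_onto_G\<close>), which yields the Rees matrix form of the structural
  semigroup (\<open>kernel_eq\<close>). The group part of an idempotent is the inverse of a sandwich entry.
  If the idempotents generate the structural semigroup, all elements of \<open>G\<close> placed at the orbit of
  \<open>0\<close> thus belong to \<open>H\<close> (\<open>At_in_H_if_generated\<close>); conjugation by elements that displace fibres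
  moves them to every other orbit (\<open>rot_At_in_H\<close>), and finite products and pointwise limits fill the
  whole product of copies of \<open>G\<close> (\<open>H_full\<close>). The isomorphisms that concern the elements preserving
  the fibres are homeomorphisms, because their inverses are continuous maps from compact models to a
  Hausdorff space
  (\<open>top_isomorphic_by_maps\<close>).
\<close>

section \<open>Columns of the powers of a substitution\<close>

lemma nth_concat_map_const:
  assumes "\<And>a. length (f a) = m" "0 < m" "i < m * length w"
  shows "concat (map f w) ! i = f (w ! (i div m)) ! (i mod m)"
  using assms(3)
proof (induction w arbitrary: i)
  case (Cons a w)
  show ?case
  proof (cases "i < m")
    case True
    then show ?thesis using assms(1) by (simp add: nth_append)
  next
    case False
    then have "i - m < m * length w" using Cons.prems by (simp add: algebra_simps)
    moreover have "i div m = Suc ((i - m) div m)" "i mod m = (i - m) mod m"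
      using False assms(2) by (simp_all add: le_div_geq le_mod_geq)
    ultimately show ?thesis using False assms(1) Cons.IH[of "i - m"] by (simp add: nth_append)
  qed
qed simp

lemma int_div_less:
  fixes b :: int
  assumes "0 < b" "i < b * c"
  shows "i div b < c"
proof (rule ccontr)
  assume "\<not> i div b < c"
  then have "b * c \<le> b * (i div b)" using assms(1) by simp
  also have "\<dots> \<le> i"
    using assms(1) by (metis div_mult_mod_eq mult.commute le_add_same_cancel1 pos_mod_sign)
  finally show False using assms(2) by simp
qed

lemma bij_has_power_id:
  fixes \<rho> :: "'a::finite \<Rightarrow> 'a"
  assumes "bij \<rho>"
  shows "\<exists>p\<ge>1. \<rho> ^^ p = id"
proof -
  have "\<not> inj (\<lambda>n::nat. \<rho> ^^ n)"
    by (metis finite UNIV_I finite_imageD infinite_UNIV_nat finite_subset subset_UNIV)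
  then obtain i j where ij: "i < j" "\<rho> ^^ i = \<rho> ^^ j"
    unfolding inj_def by (metis linorder_neqE_nat)
  have "(\<rho> ^^ i) ((\<rho> ^^ (j - i)) a) = (\<rho> ^^ i) a" for a
    using ij by (metis add_diff_inverse_nat comp_apply funpow_add less_imp_not_less)
  moreover have "inj (\<rho> ^^ i)"
    using assms by (simp add: bij_is_inj inj_fn)
  ultimately have "(\<rho> ^^ (j - i)) a = a" for a by (metis injD)
  then have "\<rho> ^^ (j - i) = id" by auto
  then show ?thesis using ij(1) by (intro exI[of _ "j - i"]) auto
qed

locale simplified_bijective =
  fixes \<theta> :: "'a::finite \<Rightarrow> 'a list" and l :: nat
  assumes subst: "substitution \<theta> l"
    and aperiodic: "aperiodic_subst \<theta>"
    and bijective: "bijective_subst \<theta> l"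
    and simplified: "simplified_subst \<theta> l"
begin

abbreviation X where "X \<equiv> subst_space \<theta>"
abbreviation T where "T n \<equiv> subst_seq \<theta> l ^^ n"
abbreviation L :: "nat \<Rightarrow> int" where "L n \<equiv> int l ^ n"

definition col :: "nat \<Rightarrow> int \<Rightarrow> 'a \<Rightarrow> 'a" where
  "col n i = subst_col \<theta> n (nat i)"

lemma l_ge2: "2 \<le> l" and length_subst: "length (\<theta> a) = l"
  using subst by (auto simp: substitution_def)

lemma L_pos: "0 < L n"
  using l_ge2 by simp

lemma L_nonzero [simp]: "l \<noteq> 0" "0 < l"
  using l_ge2 by auto

lemma L_ge_1: "1 \<le> L n"
  using L_pos[of n] by linarith

lemma L_gt: "int n < L n"
proof -
  have "n < 2 ^ n" by simp
  also have "(2::nat) ^ n \<le> l ^ n" using l_ge2 by (simp add: power_mono)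
  finally show ?thesis by (metis of_nat_less_iff of_nat_power)
qed

lemma L_mono: "m \<le> n \<Longrightarrow> L m \<le> L n"
  using l_ge2 by (simp add: power_increasing)

lemma length_subst_word: "length (subst_word \<theta> w) = l * length w"
  by (induction w) (auto simp: subst_word_def length_subst)

lemma length_subst_pow: "length (subst_pow \<theta> n a) = l ^ n"
  by (induction n) (auto simp: subst_pow_def length_subst_word)

lemma col_0: "col 0 0 = id"
  by (auto simp: col_def subst_col_def subst_pow_def)

lemma col_1: "0 \<le> i \<Longrightarrow> i < int l \<Longrightarrow> col 1 i a = \<theta> a ! nat i"
  by (simp add: col_def subst_col_def subst_pow_def subst_word_def)

lemma col_Suc:
  assumes "0 \<le> i" "i < L (Suc n)"
  shows "col (Suc n) i = col 1 (i mod int l) \<circ> col n (i div int l)"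
proof
  fix a
  have "nat i < l * l ^ n" using assms by (simp add: nat_less_iff)
  then have "nat i < l * length (subst_pow \<theta> n a)" by (simp add: length_subst_pow)
  then have "subst_word \<theta> (subst_pow \<theta> n a) ! nat i
      = \<theta> (subst_pow \<theta> n a ! (nat i div l)) ! (nat i mod l)"
    unfolding subst_word_def using length_subst L_nonzero(2) nth_concat_map_const by blast
  moreover have "nat i div l = nat (i div int l)" "nat i mod l = nat (i mod int l)"
    using assms(1) by (auto simp: nat_div_distrib nat_mod_distrib)
  ultimately show "col (Suc n) i a = (col 1 (i mod int l) \<circ> col n (i div int l)) a"
    by (simp add: col_1 del: One_nat_def) (simp add: col_def subst_col_def subst_pow_def)
qed

text \<open>The letter of \<^term>\<open>(subst_word \<theta> ^^ (m + n)) [a]\<close> at a position is found by first looking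
  up the \<open>l ^ m\<close>-block that contains it.\<close>

lemma col_add:
  assumes "0 \<le> r" "r < L m" "0 \<le> d" "d < L n"
  shows "col (m + n) (r + L m * d) = col m r \<circ> col n d"
  using assms
proof (induction m arbitrary: r)
  case 0
  then have "r = 0" by simp
  then show ?case by (simp add: col_0)
next
  case (Suc m)
  have eq: "(r + L (Suc m) * d) mod int l = r mod int l"
    "(r + L (Suc m) * d) div int l = r div int l + L m * d"
    by (simp_all add: mult.assoc)
  have "r + L (Suc m) * d < L (Suc m) * (d + 1)"
    using Suc.prems by (simp add: algebra_simps)
  also have "\<dots> \<le> L (Suc m) * L n"
    using Suc.prems L_pos[of "Suc m"] by (intro mult_left_mono) auto
  finally have "r + L (Suc m) * d < L (Suc (m + n))" by (simp add: power_add mult.assoc)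
  moreover have "0 \<le> r + L (Suc m) * d"
    using Suc.prems by simp
  ultimately have "col (Suc m + n) (r + L (Suc m) * d)
      = col 1 (r mod int l) \<circ> col (m + n) (r div int l + L m * d)"
    using col_Suc[of "r + L (Suc m) * d" "m + n"] by (simp add: eq mult.assoc add.commute)
  also have "r div int l < L m"
    using Suc.prems by (simp add: int_div_less)
  then have "col (m + n) (r div int l + L m * d) = col m (r div int l) \<circ> col n d"
    using Suc by (simp add: pos_imp_zdiv_nonneg_iff comp_def)
  also have "col 1 (r mod int l) \<circ> (col m (r div int l) \<circ> col n d) = col (Suc m) r \<circ> col n d"
    using Suc.prems col_Suc[of r m] by (simp add: comp_assoc)
  finally show ?case .
qed

lemma col_bij: "0 \<le> i \<Longrightarrow> i < L n \<Longrightarrow> bij (col n i)"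
proof (induction n arbitrary: i)
  case 0
  then have "i = 0" by simp
  then show ?case using bij_id by (metis col_0)
next
  case (Suc n)
  have "col 1 (i mod int l) = (\<lambda>a. \<theta> a ! nat (i mod int l))"
    by (auto simp: col_1 simp del: One_nat_def)
  moreover have "nat (i mod int l) < l" by (simp add: nat_less_iff)
  ultimately have "bij (col 1 (i mod int l))"
    using bijective by (simp add: bijective_subst_def)
  moreover have "i div int l < L n"
    using Suc.prems by (simp add: int_div_less)
  then have "bij (col n (i div int l))"
    using Suc by (simp add: pos_imp_zdiv_nonneg_iff)
  ultimately show ?case using Suc.prems col_Suc[of i n] by (metis bij_comp)
qed

lemma T_nth: "T n u k = col n (k mod L n) (u (k div L n))"
proof (induction n arbitrary: k)
  case 0
  then show ?case by (simp add: col_0)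
next
  case (Suc n)
  let ?r = "k mod L (Suc n)"
  have "T (Suc n) u k = col 1 (k mod int l) (T n u (k div int l))"
    by (simp add: subst_seq_def col_1 del: One_nat_def)
  also have "\<dots> = col 1 (k mod int l) (col n (k div int l mod L n) (u (k div int l div L n)))"
    using Suc by simp
  also have "k div int l div L n = k div L (Suc n)"
    by (simp add: zdiv_zmult2_eq)
  also have "k mod int l = ?r mod int l" by (simp add: mod_mult2_eq' zmod_zmult2_eq)
  also have "k div int l mod L n = ?r div int l"
    by (simp add: zmod_zmult2_eq)
  finally show ?case using L_pos[of "Suc n"] col_Suc[of ?r n] by (simp del: power_Suc)
qed

lemma T_nth_block: "0 \<le> r \<Longrightarrow> r < L n \<Longrightarrow> T n u (r + L n * q) = col n r (u q)"
  by (simp add: T_nth)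

lemma T_shift: "T n (shift d u) = shift (L n * d) (T n u)"
  by (rule ext) (simp add: T_nth shift_def add.commute)

lemma T_add: "T (m + n) u = T m (T n u)"
  by (simp add: funpow_add)

section \<open>The substitution space\<close>

text \<open>Allowedness of centred windows, in terms of columns. The centred windows suffice to test
  membership in the space, and the radius makes the notion monotone, which pigeonhole arguments
  need.\<close>

definition occurs_around :: "(int \<Rightarrow> 'a) \<Rightarrow> nat \<Rightarrow> bool" where
  "occurs_around x N \<longleftrightarrow> (\<exists>k a j. int N \<le> j \<and> j + int N < L k \<and>
     (\<forall>m. \<bar>m\<bar> \<le> int N \<longrightarrow> x m = col k (j + m) a))"

lemma subst_space_iff: "x \<in> X \<longleftrightarrow> (\<forall>N. occurs_around x N)"
proof
  assume x: "x \<in> X"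
  show "\<forall>N. occurs_around x N"
  proof
    fix N :: nat
    let ?w = "map (\<lambda>j. x (- int N + int j)) [0..<2 * N + 1]"
    have "allowed_word \<theta> ?w" using x unfolding subst_space_def by blast
    then obtain k a ps ss where p: "subst_pow \<theta> k a = ps @ ?w @ ss"
      unfolding allowed_word_def sublist_def by blast
    let ?j = "int (length ps + N)"
    have "length ps + (2 * N + 1) + length ss = l ^ k"
      using length_subst_pow[of k a] p by simp
    then have "int (length ps + (2 * N + 1) + length ss) = L k" by (metis of_nat_power)
    then have "int N \<le> ?j" "?j + int N < L k" by auto
    moreover have "x m = col k (?j + m) a" if m: "\<bar>m\<bar> \<le> int N" for m
    proof -
      have "nat (?j + m) = length ps + nat (m + int N)" using m by auto
      then have "subst_pow \<theta> k a ! nat (?j + m) = (?w @ ss) ! nat (m + int N)"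
        using p by (simp add: nth_append del: upt_Suc)
      also have "nat (m + int N) < 2 * N + 1" using m by auto
      then have "(?w @ ss) ! nat (m + int N) = x m"
        using m by (auto simp: nth_append simp del: upt_Suc)
      finally show ?thesis by (simp add: col_def subst_col_def)
    qed
    ultimately show "occurs_around x N" unfolding occurs_around_def by blast
  qed
next
  assume x: "\<forall>N. occurs_around x N"
  show "x \<in> X" unfolding subst_space_def
  proof (intro CollectI allI)
    fix i :: int and n :: nat
    obtain k a j where j: "int (nat \<bar>i\<bar> + n) \<le> j" "j + int (nat \<bar>i\<bar> + n) < L k"
      and xm: "\<And>m. \<bar>m\<bar> \<le> int (nat \<bar>i\<bar> + n) \<Longrightarrow> x m = col k (j + m) a"
      using x unfolding occurs_around_def by metis
    let ?p = "subst_pow \<theta> k a"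
    have len: "nat (j + i) + n \<le> length ?p"
    proof -
      have "int (nat (j + i) + n) \<le> L k" using j by auto
      then show ?thesis unfolding length_subst_pow by (metis of_nat_le_iff of_nat_power)
    qed
    have "map (\<lambda>j. x (i + int j)) [0..<n] = take n (drop (nat (j + i)) ?p)"
    proof (rule nth_equalityI)
      show "length (map (\<lambda>j. x (i + int j)) [0..<n]) = length (take n (drop (nat (j + i)) ?p))"
        using len by simp
      fix m assume "m < length (map (\<lambda>j. x (i + int j)) [0..<n])"
      then have m: "m < n" by simp
      have "x (i + int m) = col k (j + (i + int m)) a" using m by (intro xm) auto
      moreover have "nat (j + (i + int m)) = nat (j + i) + m" using j m by auto
      ultimately show "map (\<lambda>j. x (i + int j)) [0..<n] ! m = take n (drop (nat (j + i)) ?p) ! m"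
        using m len by (simp add: col_def subst_col_def)
    qed
    moreover have "sublist (take n (drop (nat (j + i)) ?p)) ?p"
      using sublist_order.order_trans[OF sublist_take sublist_drop] .
    ultimately show "allowed_word \<theta> (map (\<lambda>j. x (i + int j)) [0..<n])"
      unfolding allowed_word_def by auto
  qed
qed

lemma occurs_around_mono: "occurs_around x N \<Longrightarrow> M \<le> N \<Longrightarrow> occurs_around x M"
proof -
  assume "occurs_around x N" and MN: "M \<le> N"
  then obtain k a j where "int N \<le> j" "j + int N < L k" "\<forall>m. \<bar>m\<bar> \<le> int N \<longrightarrow> x m = col k (j + m) a"
    unfolding occurs_around_def by blast
  then show "occurs_around x M"
    unfolding occurs_around_def using MN
    by (intro exI[of _ k] exI[of _ a] exI[of _ j]) auto
qed

lemma occurs_around_cong: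
  "occurs_around x N \<Longrightarrow> (\<And>m. \<bar>m\<bar> \<le> int N \<Longrightarrow> x m = y m) \<Longrightarrow> occurs_around y N"
proof -
  assume "occurs_around x N" and eq: "\<And>m. \<bar>m\<bar> \<le> int N \<Longrightarrow> x m = y m"
  then obtain k a j where "int N \<le> j" "j + int N < L k" "\<forall>m. \<bar>m\<bar> \<le> int N \<longrightarrow> x m = col k (j + m) a"
    unfolding occurs_around_def by blast
  then show "occurs_around y N"
    unfolding occurs_around_def using eq
    by (intro exI[of _ k] exI[of _ a] exI[of _ j]) auto
qed

lemma in_X_if_approximable:
  assumes "\<And>N::nat. \<exists>y\<in>X. \<forall>m. \<bar>m\<bar> \<le> int N \<longrightarrow> x m = y m"
  shows "x \<in> X"
  unfolding subst_space_iff
proof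
  fix N
  obtain y where "y \<in> X" "\<forall>m. \<bar>m\<bar> \<le> int N \<longrightarrow> x m = y m" using assms by blast
  then show "occurs_around x N" using occurs_around_cong[of y N x] subst_space_iff by auto
qed

lemma shift_shift: "shift s (shift t x) = shift (s + t) x"
  by (rule ext) (simp add: shift_def algebra_simps)

lemma shift_0 [simp]: "shift 0 x = x"
  by (simp add: shift_def)

lemma shift_in_X: assumes "x \<in> X" shows "shift t x \<in> X"
  unfolding subst_space_iff
proof
  fix N :: nat
  obtain k a j where j: "int (nat \<bar>t\<bar> + N) \<le> j" "j + int (nat \<bar>t\<bar> + N) < L k"
    and xm: "\<And>m. \<bar>m\<bar> \<le> int (nat \<bar>t\<bar> + N) \<Longrightarrow> x m = col k (j + m) a"
    using assms unfolding subst_space_iff occurs_around_def by metis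
  have "shift t x m = col k (j + t + m) a" if "\<bar>m\<bar> \<le> int N" for m
    using xm[of "m + t"] that by (simp add: shift_def algebra_simps)
  then show "occurs_around (shift t x) N"
    unfolding occurs_around_def using j by (intro exI[of _ k] exI[of _ a] exI[of _ "j + t"]) auto
qed

lemma T_in_X: assumes "x \<in> X" shows "T n x \<in> X"
  unfolding subst_space_iff
proof
  fix N :: nat
  obtain k a j where j: "int N \<le> j" "j + int N < L k"
    and xm: "\<And>m. \<bar>m\<bar> \<le> int N \<Longrightarrow> x m = col k (j + m) a"
    using assms unfolding subst_space_iff occurs_around_def by metis
  have "T n x m = col (n + k) (L n * j + m) a" if "\<bar>m\<bar> \<le> int N" for m
  proof -
    have N_le: "int N \<le> int N * L n"
      using mult_left_mono[OF L_ge_1[of n], of "int N"] by simp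
    then have "m \<le> int N * L n" "(- int N) * L n \<le> m"
      using that by linarith+
    then have "m div L n \<le> int N * L n div L n" "(- int N) * L n div L n \<le> m div L n"
      using zdiv_mono1[OF _ L_pos[of n]] by blast+
    moreover have "int N * L n div L n = int N" "(- int N) * L n div L n = - int N"
      using L_pos[of n] by (intro nonzero_mult_div_cancel_right; simp)+
    ultimately have q: "\<bar>m div L n\<bar> \<le> int N" by linarith
    have "T n x m = col n (m mod L n) (col k (j + m div L n) a)"
      using xm[OF q] by (simp add: T_nth)
    also have "\<dots> = col (n + k) (m mod L n + L n * (j + m div L n)) a"
      using col_add[of "m mod L n" n "j + m div L n" k] q j L_pos[of n] by simp
    also have "m mod L n + L n * (j + m div L n) = L n * j + m"
      by (simp add: distrib_left)
    finally show ?thesis .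
  qed
  moreover have "int N \<le> L n * j" using j mult_right_mono[OF L_ge_1[of n], of j] by simp
  moreover have "L n * j + int N < L (n + k)"
  proof -
    have "L n * j + int N \<le> L n * (j + int N)"
      using mult_right_mono[OF L_ge_1[of n], of "int N"] by (simp add: distrib_left)
    also have "\<dots> < L n * L k" using j L_pos[of n] by simp
    finally show ?thesis by (simp add: power_add)
  qed
  ultimately show "occurs_around (T n x) N" unfolding occurs_around_def by blast
qed

end

section \<open>Recognizability and the factor map\<close>

text \<open>A pigeonhole principle that replaces the extraction of convergent subsequences.\<close>

lemma finite_uniform_choice:
  assumes "finite A" "\<And>N::nat. \<exists>r\<in>A. P r N" "\<And>r M N. P r N \<Longrightarrow> M \<le> N \<Longrightarrow> P r M"
  shows "\<exists>r\<in>A. \<forall>N. P r N"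
proof (rule ccontr)
  assume "\<not> ?thesis"
  then have "\<forall>r\<in>A. \<exists>N. \<not> P r N" by blast
  then obtain f where f: "\<And>r. r \<in> A \<Longrightarrow> \<not> P r (f r)" by metis
  obtain r where r: "r \<in> A" "P r (Max (f ` A))" using assms(2) by blast
  have "f r \<le> Max (f ` A)" using assms(1) r(1) by simp
  then show False using assms(3)[OF r(2)] f[OF r(1)] by blast
qed

abbreviation finv :: "('a \<Rightarrow> 'b) \<Rightarrow> 'b \<Rightarrow> 'a" where "finv f \<equiv> inv_into UNIV f"

context simplified_bijective begin

lemma le_L_mult: "0 \<le> k \<Longrightarrow> k \<le> L n * k"
  using mult_right_mono[OF L_ge_1[of n], of k] by simp

text \<open>The first letter of each block determines the corresponding letter of the preimage, through the
  permutation \<^term>\<open>col n 0\<close>. So the preimages of larger and larger windows agree where they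
  overlap, and they fit together.\<close>

lemma T_preimage_if_approximable:
  assumes r: "0 \<le> r" "r < L n"
    and appr: "\<And>N::nat. \<exists>u. occurs_around u N \<and> (\<forall>m. \<bar>m\<bar> \<le> int N \<longrightarrow> x m = T n u (m + r))"
  shows "\<exists>y\<in>X. x = shift r (T n y)"
proof -
  define y where "y q = finv (col n 0) (x (L n * q - r))" for q
  have bij0: "bij (col n 0)" using col_bij[of 0 n] L_pos[of n] by simp
  have y_eq: "y q = u q"
    if u: "\<forall>m. \<bar>m\<bar> \<le> int N \<longrightarrow> x m = T n u (m + r)" and N: "L n * (\<bar>q\<bar> + 1) \<le> int N" for u N q
  proof -
    have "\<bar>L n * q\<bar> = L n * \<bar>q\<bar>" by (simp add: abs_mult)
    then have "\<bar>L n * q - r\<bar> \<le> int N" using N r unfolding distrib_left by linarith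
    then have "x (L n * q - r) = T n u (0 + L n * q)" using u by simp
    also have "\<dots> = col n 0 (u q)" using L_pos[of n] by (intro T_nth_block) auto
    finally show ?thesis unfolding y_def using bij0 by (simp add: bij_is_inj)
  qed
  have "y \<in> X" unfolding subst_space_iff
  proof
    fix M :: nat
    let ?N = "nat (L n * (int M + 1))"
    have N: "int ?N = L n * (int M + 1)" using L_pos[of n] by simp
    obtain u where u: "occurs_around u ?N" "\<forall>m. \<bar>m\<bar> \<le> int ?N \<longrightarrow> x m = T n u (m + r)"
      using appr by blast
    have "int M \<le> int ?N"
      unfolding N using le_L_mult[of "int M + 1" n] by linarith
    then have "occurs_around u M" using u(1) occurs_around_mono by simp
    moreover have "u q = y q" if "\<bar>q\<bar> \<le> int M" for q
    proof -
      have "L n * (\<bar>q\<bar> + 1) \<le> int ?N"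
        unfolding N using that L_pos[of n] by (intro mult_left_mono) auto
      then show ?thesis using y_eq[OF u(2)] by simp
    qed
    ultimately show "occurs_around y M" using occurs_around_cong by blast
  qed
  moreover have "x m = shift r (T n y) m" for m
  proof -
    let ?q = "(m + r) div L n"
    let ?N = "nat (L n * (\<bar>?q\<bar> + 1)) + nat \<bar>m\<bar>"
    obtain u where u: "\<forall>m. \<bar>m\<bar> \<le> int ?N \<longrightarrow> x m = T n u (m + r)"
      using appr by blast
    have "\<bar>m\<bar> \<le> int ?N" by simp
    then have "x m = T n u (m + r)" using u by blast
    also have "\<dots> = col n ((m + r) mod L n) (u ?q)" by (rule T_nth)
    also have "u ?q = y ?q" using y_eq[OF u] by simp
    finally show ?thesis by (simp add: shift_def T_nth)
  qed
  ultimately show ?thesis by (intro bexI[of _ y]) auto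
qed

text \<open>Each window of the point occurs in some word \<open>\<theta>^k(a)\<close>, at a position that has a residue modulo
  \<open>l^n\<close>. One residue serves windows of all sizes.\<close>

lemma desubstitute:
  assumes "x \<in> X"
  shows "\<exists>r y. 0 \<le> r \<and> r < L n \<and> y \<in> X \<and> x = shift r (T n y)"
proof -
  let ?P = "\<lambda>r N. \<exists>u. occurs_around u N \<and> (\<forall>m. \<bar>m\<bar> \<le> int N \<longrightarrow> x m = T n u (m + r))"
  have "\<exists>r\<in>{0..<L n}. ?P r N" for N :: nat
  proof -
    \<comment> \<open>The window has to hold \<open>N\<close> whole blocks on either side of the one at the origin.\<close>
    let ?K = "nat (L n * (int N + 1))"
    have K: "int ?K = L n * (int N + 1)" using L_pos[of n] by simp
    have "L n * 1 \<le> L n * (int N + 1)" using L_pos[of n] by (intro mult_left_mono) auto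
    then have K_ge: "L n \<le> int ?K" unfolding K by simp
    obtain k a j where j: "int ?K \<le> j" "j + int ?K < L k"
      and xm: "\<And>m. \<bar>m\<bar> \<le> int ?K \<Longrightarrow> x m = col k (j + m) a"
      using assms unfolding subst_space_iff occurs_around_def by metis
    have "L n < L k" using j K_ge L_pos[of n] by linarith
    then have "n \<le> k" using L_mono[of k n] by linarith
    then obtain k' where k: "k = n + k'" using le_Suc_ex by blast
    have Lk: "L k = L n * L k'" by (simp add: k power_add)
    define d where "d = j div L n"
    define r where "r = j mod L n"
    have jd: "j = L n * d + r" by (simp add: d_def r_def)
    have r: "0 \<le> r" "r < L n" using L_pos[of n] by (auto simp: r_def)
    define u where "u q = col k' (d + q) a" for q
    have N_K: "int N \<le> int ?K"
      unfolding K using le_L_mult[of "int N + 1" n] by linarith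
    have "x m = T n u (m + r)" if m: "\<bar>m\<bar> \<le> int N" for m
    proof -
      have range: "0 \<le> j + m" "j + m < L n * L k'" using m j N_K Lk by linarith+
      have jm: "j + m = (m + r) + d * L n" by (simp add: jd)
      have div: "(j + m) div L n = d + (m + r) div L n"
        unfolding jm using L_pos[of n] by (intro div_mult_self1) simp
      then have q: "0 \<le> d + (m + r) div L n" "d + (m + r) div L n < L k'"
        unfolding div[symmetric] using range(1) L_pos[of n] int_div_less[OF L_pos range(2)]
        by (simp_all only: pos_imp_zdiv_nonneg_iff)
      have "x m = col k (j + m) a" using m N_K by (intro xm) linarith
      also have "j + m = (m + r) mod L n + L n * (d + (m + r) div L n)"
        unfolding jd by (simp add: distrib_left)
      also have "col k \<dots> a = col n ((m + r) mod L n) (col k' (d + (m + r) div L n) a)"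
        unfolding k using col_add[OF _ _ q, of "(m + r) mod L n" n] L_pos[of n] by simp
      finally show ?thesis by (simp add: T_nth u_def)
    qed
    moreover have "occurs_around u N"
    proof -
      have "L n * (int N + 1) div L n \<le> d"
        unfolding d_def using j(1) K L_pos[of n] by (intro zdiv_mono1) auto
      then have "int N \<le> d" using L_pos[of n] by simp
      moreover have "L n * (d + int N) < L n * L k'"
        using j(2) r(1) L_pos[of n] K unfolding jd Lk distrib_left by linarith
      then have "d + int N < L k'" using L_pos[of n] by simp
      ultimately show ?thesis unfolding occurs_around_def u_def by blast
    qed
    ultimately show ?thesis using r by (intro bexI[of _ r]) auto
  qed
  moreover have "?P r M" if "?P r N" "M \<le> N" for r and M N :: nat
    using that occurs_around_mono by (meson of_nat_mono order_trans)
  ultimately obtain r where r: "r \<in> {0..<L n}" and P: "\<forall>N. ?P r N"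
    using finite_uniform_choice[of "{0..<L n}" ?P] by blast
  then have "\<exists>y\<in>X. x = shift r (T n y)"
    using T_preimage_if_approximable[of r n x] by simp
  then show ?thesis using r by auto
qed

text \<open>If two \<open>\<theta>\<^sup>n\<close>-images agree up to a displacement that is not a multiple of \<open>l ^ n\<close>, then every
  block of the one straddles two blocks of the other. Since all columns are bijections, each
  letter of the latter determines its successor, by a permutation.\<close>

lemma unaligned_T_images:
  assumes d: "0 < d" "d < L n" and eq: "T n y = shift d (T n y')"
  shows "\<exists>\<rho>. bij \<rho> \<and> (\<forall>q. y' (q + 1) = \<rho> (y' q))"
proof -
  have bij: "bij (col n 0)" "bij (col n d)" "bij (col n (L n - d))"
    using col_bij d by simp_all
  have "y' (q + 1) = finv (col n 0) (col n (L n - d) (finv (col n 0) (col n d (y' q))))" for q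
  proof -
    have "T n y (0 + L n * q) = T n y' (d + L n * q)"
      unfolding eq by (simp add: shift_def add.commute)
    then have 1: "col n 0 (y q) = col n d (y' q)"
      using d T_nth_block[of 0 n y q] T_nth_block[of d n y' q] by simp
    have "T n y ((L n - d) + L n * q) = T n y' (0 + L n * (q + 1))"
      unfolding eq by (simp add: shift_def algebra_simps)
    then have 2: "col n (L n - d) (y q) = col n 0 (y' (q + 1))"
      using d T_nth_block[of "L n - d" n y q] T_nth_block[of 0 n y' "q + 1"] by simp
    show ?thesis unfolding 1[symmetric]
      using 2 bij(1) by (simp add: bij_is_inj)
  qed
  moreover have "bij (finv (col n 0) \<circ> col n (L n - d) \<circ> finv (col n 0) \<circ> col n d)"
    using bij_comp[OF bij_comp[OF bij_comp[OF bij(2) bij_imp_bij_inv[OF bij(1)]] bij(3)]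
        bij_imp_bij_inv[OF bij(1)]] by (simp only: comp_assoc)
  ultimately show ?thesis
    by (intro exI[of _ "finv (col n 0) \<circ> col n (L n - d) \<circ> finv (col n 0) \<circ> col n d"]) simp
qed

text \<open>Otherwise the order of the permutation would be a period of the point.\<close>

lemma successor_not_permutation:
  assumes "x \<in> X" "bij \<rho>"
  shows "\<exists>q. x (q + 1) \<noteq> \<rho> (x q)"
proof (rule ccontr)
  assume "\<not> ?thesis"
  then have step: "x (q + 1) = \<rho> (x q)" for q by blast
  have pow: "x (q + int n) = (\<rho> ^^ n) (x q)" for q n
  proof (induction n)
    case (Suc n)
    then show ?case using step[of "q + int n"] by (simp add: algebra_simps)
  qed simp
  obtain p where "p \<ge> 1" "\<rho> ^^ p = id" using bij_has_power_id[OF assms(2)] by blast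
  then have "shift (int p) x = x" "int p \<ge> 1" using pow by (auto simp: shift_def)
  then show False using aperiodic assms(1) unfolding aperiodic_subst_def by blast
qed

lemma T_coset_unique:
  assumes "y \<in> X" "y' \<in> X" "0 \<le> r" "r < L n" "0 \<le> r'" "r' < L n"
    and eq: "shift r (T n y) = shift r' (T n y')"
  shows "r = r'"
proof -
  have no: False if "0 \<le> r" "r < r'" "r' < L n" "y' \<in> X" "shift r (T n y) = shift r' (T n y')"
    for r r' y y'
  proof -
    have "T n y = shift (- r) (shift r (T n y))" by (simp add: shift_shift)
    also have "\<dots> = shift (r' - r) (T n y')" unfolding that(5) by (simp add: shift_shift)
    finally show False
      using unaligned_T_images[of "r' - r" n y y'] that successor_not_permutation[of y'] by fastforce
  qed
  show ?thesis using no[of r r' y' y] no[of r' r y y'] assms by fastforce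
qed

abbreviation \<pi> where "\<pi> \<equiv> factor_map \<theta> l"

lemma factor_map_eqI:
  assumes "y \<in> X" "0 \<le> r" "r < L n" "x = shift r (T n y)"
  shows "\<pi> x n = r"
  unfolding factor_map_def
proof (rule the_equality)
  show "0 \<le> r \<and> r < L n \<and> x \<in> shift r ` T n ` X"
    unfolding assms(4) using assms(1-3) by (intro conjI imageI)
  fix i assume i: "0 \<le> i \<and> i < L n \<and> x \<in> shift i ` T n ` X"
  then obtain y' where "y' \<in> X" "x = shift i (T n y')" by (elim conjE imageE) simp
  then show "i = r" using T_coset_unique[of y' y i n r] assms i by simp
qed

lemma factor_map_coset:
  assumes "x \<in> X"
  shows "\<exists>y\<in>X. x = shift (\<pi> x n) (T n y)" "0 \<le> \<pi> x n" "\<pi> x n < L n"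
proof -
  obtain r y where "0 \<le> r" "r < L n" "y \<in> X" "x = shift r (T n y)"
    using desubstitute[OF assms] by blast
  moreover from this have "\<pi> x n = r" by (intro factor_map_eqI)
  ultimately show "\<exists>y\<in>X. x = shift (\<pi> x n) (T n y)" "0 \<le> \<pi> x n" "\<pi> x n < L n"
    by (auto intro!: bexI[of _ y])
qed

text \<open>If points with another residue came arbitrarily close to \<open>y\<close>, infinitely many of them would have
  the same residue, and \<open>y\<close> would belong to the corresponding coset as well.\<close>

lemma factor_map_locally_constant:
  assumes "y \<in> X"
  shows "\<exists>N::nat. \<forall>x\<in>X. (\<forall>m. \<bar>m\<bar> \<le> int N \<longrightarrow> x m = y m) \<longrightarrow> \<pi> x n = \<pi> y n"
proof (rule ccontr)
  assume contra: "\<not> ?thesis"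
  let ?P = "\<lambda>r N. r \<noteq> \<pi> y n \<and> (\<exists>x\<in>X. (\<forall>m. \<bar>m\<bar> \<le> int N \<longrightarrow> x m = y m) \<and> \<pi> x n = r)"
  have "\<exists>r\<in>{0..<L n}. ?P r N" for N :: nat
  proof -
    have "\<not> (\<forall>x\<in>X. (\<forall>m. \<bar>m\<bar> \<le> int N \<longrightarrow> x m = y m) \<longrightarrow> \<pi> x n = \<pi> y n)"
      using contra by (rule contrapos_nn) (rule exI)
    then obtain x where x: "x \<in> X" "\<forall>m. \<bar>m\<bar> \<le> int N \<longrightarrow> x m = y m" "\<pi> x n \<noteq> \<pi> y n"
      unfolding Ball_def not_all not_imp by (elim exE conjE) (rule that)
    have "\<pi> x n \<in> {0..<L n}" using factor_map_coset(2,3)[OF x(1), of n] by simp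
    then show ?thesis using x by (intro bexI[of _ "\<pi> x n"] conjI bexI[of _ x]) simp_all
  qed
  moreover have "?P r M" if "?P r N" "M \<le> N" for r and M N :: nat
    using that by (meson of_nat_mono order_trans)
  ultimately obtain r where r: "r \<in> {0..<L n}" and P: "\<forall>N. ?P r N"
    using finite_uniform_choice[of "{0..<L n}" ?P] by blast
  have "\<exists>u. occurs_around u N \<and> (\<forall>m. \<bar>m\<bar> \<le> int N \<longrightarrow> y m = T n u (m + r))" for N :: nat
  proof -
    obtain x where x: "x \<in> X" "\<forall>m. \<bar>m\<bar> \<le> int N \<longrightarrow> x m = y m" "\<pi> x n = r"
      using P[rule_format, of N] by (elim conjE bexE) simp
    obtain u where "u \<in> X" "x = shift (\<pi> x n) (T n u)" using factor_map_coset(1)[OF x(1), of n] by (elim bexE) simp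
    then have "u \<in> X" "x = shift r (T n u)" unfolding x(3) .
    then show ?thesis
      using x(2) subst_space_iff by (intro exI[of _ u]) (auto simp: shift_def)
  qed
  then obtain u where "u \<in> X" "y = shift r (T n u)"
    using T_preimage_if_approximable[of r n y] r by auto
  then have "\<pi> y n = r" using r factor_map_eqI by auto
  then show False using P[rule_format, of 0] by simp
qed

abbreviation Z where "Z \<equiv> carrier (adic_group l)"
abbreviation zadd (infixl "\<boxplus>" 65) where "z \<boxplus> w \<equiv> z \<otimes>\<^bsub>adic_group l\<^esub> w"
abbreviation emb where "emb \<equiv> adic_of_int l"
abbreviation zneg where "zneg z \<equiv> inv\<^bsub>adic_group l\<^esub> z"
abbreviation zero where "zero \<equiv> \<one>\<^bsub>adic_group l\<^esub>"

lemma adic_iff: "z \<in> Z \<longleftrightarrow> (\<forall>n. 0 \<le> z n \<and> z n < L n \<and> z (Suc n) mod L n = z n)"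
  and adic_add: "z \<boxplus> w = (\<lambda>n. (z n + w n) mod L n)"
  and adic_zero: "zero = (\<lambda>n. 0)"
  by (simp_all add: adic_group_def)

lemma mod_L_Suc: "a mod L (Suc n) mod L n = a mod L n"
  by (rule mod_mod_cancel) simp

lemma adic_comm_group: "comm_group (adic_group l)"
proof (rule comm_groupI)
  fix z w assume z: "z \<in> Z" and w: "w \<in> Z"
  have "(z (Suc n) + w (Suc n)) mod L n = (z n + w n) mod L n" for n
    using z w by (metis adic_iff mod_add_eq)
  then show "z \<boxplus> w \<in> Z" unfolding adic_iff adic_add mod_L_Suc using L_pos by simp
  show "z \<boxplus> w = w \<boxplus> z" by (simp add: adic_add add.commute)
next
  show "zero \<in> Z" unfolding adic_iff adic_zero using L_pos by simp
next
  fix z w v show "z \<boxplus> w \<boxplus> v = z \<boxplus> (w \<boxplus> v)" by (simp add: adic_add mod_simps add.assoc)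
next
  fix z assume z: "z \<in> Z"
  then show "zero \<boxplus> z = z" by (simp add: adic_add adic_zero adic_iff)
  have "(- z (Suc n)) mod L n = (- z n) mod L n" for n
    using z by (metis adic_iff mod_minus_eq)
  then have "(\<lambda>n. (- z n) mod L n) \<in> Z" unfolding adic_iff mod_L_Suc using L_pos by simp
  moreover have "(\<lambda>n. (- z n) mod L n) \<boxplus> z = zero" by (simp add: adic_add adic_zero mod_simps)
  ultimately show "\<exists>y\<in>Z. y \<boxplus> z = zero" by blast
qed

sublocale adic: comm_group "adic_group l"
  by (rule adic_comm_group)

lemma adic_inv: assumes "z \<in> Z" shows "zneg z = (\<lambda>n. (- z n) mod L n)"
proof (rule adic.inv_equality)
  have "(- z (Suc n)) mod L n = (- z n) mod L n" for n
    using assms by (metis adic_iff mod_minus_eq)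
  then show "(\<lambda>n. (- z n) mod L n) \<in> Z" unfolding adic_iff mod_L_Suc using L_pos by simp
  show "(\<lambda>n. (- z n) mod L n) \<boxplus> z = zero" by (simp add: adic_add adic_zero mod_simps)
qed (rule assms)

lemma adic_coherent: assumes "z \<in> Z" "n \<le> m" shows "z m mod L n = z n"
  using assms(2)
proof (induction m rule: dec_induct)
  case base
  then show ?case using assms(1) by (simp add: adic_iff)
next
  case (step m)
  have "z (Suc m) mod L n = z (Suc m) mod L m mod L n"
    using step by (simp add: mod_mod_cancel le_imp_power_dvd)
  then show ?case using step assms(1) by (simp add: adic_iff)
qed

lemma emb_adic: "emb k \<in> Z"
  unfolding adic_iff adic_of_int_def mod_L_Suc using L_pos by simp

lemma emb_add: "emb (s + t) = emb s \<boxplus> emb t"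
  by (simp add: adic_of_int_def adic_add mod_simps)

lemma emb_0: "emb 0 = zero"
  by (simp add: adic_of_int_def adic_zero)

lemma emb_neg: "zneg (emb k) = emb (- k)"
  by (rule adic.inv_equality) (simp_all add: emb_adic emb_0 flip: emb_add)

lemma emb_inj: assumes "emb s = emb t" shows "s = t"
proof (rule ccontr)
  assume "s \<noteq> t"
  have "s mod L (nat \<bar>s - t\<bar>) = t mod L (nat \<bar>s - t\<bar>)"
    using assms by (metis adic_of_int_def)
  then have "L (nat \<bar>s - t\<bar>) dvd s - t" by (simp add: mod_eq_dvd_iff)
  then have "L (nat \<bar>s - t\<bar>) \<le> \<bar>s - t\<bar>" 
    using \<open>s \<noteq> t\<close> dvd_imp_le_int[of "s - t" "L (nat \<bar>s - t\<bar>)"] by simp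
  then show False using L_gt[of "nat \<bar>s - t\<bar>"] by simp
qed

lemma factor_map_adic: assumes "x \<in> X" shows "\<pi> x \<in> Z"
  unfolding adic_iff
proof (intro allI conjI)
  fix n
  show "0 \<le> \<pi> x n" "\<pi> x n < L n" by (rule factor_map_coset[OF assms, of n])+
  obtain y where y: "y \<in> X" "x = shift (\<pi> x (Suc n)) (T (Suc n) y)"
    using factor_map_coset(1)[OF assms, of "Suc n"] by (elim bexE) simp
  let ?r = "\<pi> x (Suc n)"
  have eq: "x = shift (?r mod L n) (T n (shift (?r div L n) (T 1 y)))"
    unfolding T_shift shift_shift using y(2) T_add[of n 1 y] by (simp add: add.commute)
  have "shift (?r div L n) (T 1 y) \<in> X" using T_in_X[OF y(1), of 1] shift_in_X by blast
  then show "?r mod L n = \<pi> x n" using factor_map_eqI[OF _ _ _ eq] L_pos[of n] by (simp only: pos_mod_sign pos_mod_bound)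
qed

lemma factor_map_shift: assumes "x \<in> X" shows "\<pi> (shift t x) = \<pi> x \<boxplus> emb t"
proof
  fix n
  obtain y where y: "y \<in> X" "x = shift (\<pi> x n) (T n y)"
    using factor_map_coset(1)[OF assms, of n] by (elim bexE) simp
  let ?r = "\<pi> x n + t"
  have "shift t x = shift ?r (T n y)" by (subst y(2)) (simp add: shift_shift add.commute)
  also have "\<dots> = shift (?r mod L n) (T n (shift (?r div L n) y))"
    unfolding T_shift shift_shift by simp
  finally have "\<pi> (shift t x) n = ?r mod L n"
    using shift_in_X[OF y(1)] L_pos[of n] by (intro factor_map_eqI) auto
  then show "\<pi> (shift t x) n = (\<pi> x \<boxplus> emb t) n"
    by (simp add: adic_add adic_of_int_def mod_simps)
qed

text \<open>A bounded compatible sequence of residues is eventually constant, hence an integer.\<close>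

lemma adic_unbounded:
  assumes z: "z \<in> Z" "z \<notin> range emb"
  shows "\<exists>n0. \<forall>n\<ge>n0. K \<le> z n"
proof -
  have "\<exists>n. K \<le> z n"
  proof (rule ccontr)
    assume "\<not> ?thesis"
    then have less: "z n < K" for n by (simp add: not_le)
    let ?n = "nat K"
    have K: "K < L ?n" using L_gt[of ?n] by linarith
    have "z = emb (z ?n)"
    proof
      fix m
      show "z m = emb (z ?n) m"
      proof (cases "m \<le> ?n")
        case True
        then show ?thesis using adic_coherent[OF z(1)] by (simp add: adic_of_int_def)
      next
        case False
        then have "z ?n = z m mod L ?n" using adic_coherent[OF z(1), of ?n m] by simp
        also have "\<dots> = z m" using less[of m] K z(1) by (simp add: adic_iff)
        finally show ?thesis using z(1) by (simp add: adic_of_int_def adic_iff)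
      qed
    qed
    then show False using z(2) by blast
  qed
  then obtain n where n: "K \<le> z n" by blast
  have "K \<le> z m" if "n \<le> m" for m
  proof -
    have "z n = z m mod L n" using adic_coherent[OF z(1) that] by simp
    also have "\<dots> \<le> z m" using z(1) L_pos[of n] by (simp add: adic_iff zmod_le_nonneg_dividend)
    finally show ?thesis using n by simp
  qed
  then show ?thesis by blast
qed

text \<open>Over an adic integer outside \<open>\<int>\<close>, every bounded window eventually lies in one block.\<close>

lemma adic_window:
  assumes z: "z \<in> Z" "z \<notin> range emb"
  shows "\<exists>n0. \<forall>n\<ge>n0. 0 \<le> z n + k \<and> z n + k < L n"
proof -
  have neg: "zneg z \<in> Z" using z(1) by simp
  have "zneg z \<notin> range emb"
  proof
    assume "zneg z \<in> range emb"
    then obtain j where "zneg z = emb j" by blast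
    then have "z = emb (- j)" using z(1) adic.inv_inv emb_neg by metis
    then show False using z(2) by blast
  qed
  then obtain n0 where n0: "\<forall>n\<ge>n0. \<bar>k\<bar> + 1 \<le> zneg z n" using adic_unbounded[OF neg] by blast
  obtain n1 where n1: "\<forall>n\<ge>n1. \<bar>k\<bar> + 1 \<le> z n" using adic_unbounded[OF z] by blast
  have "0 \<le> z n + k \<and> z n + k < L n" if n: "max n0 n1 \<le> n" for n
  proof -
    have 1: "\<bar>k\<bar> + 1 \<le> z n" "z n < L n" using n n1 z(1) by (auto simp: adic_iff)
    have "(- z n) mod L n = (L n - z n) mod L n" by simp
    also have "\<dots> = L n - z n" using 1 by (intro mod_pos_pos_trivial) auto
    finally have "\<bar>k\<bar> + 1 \<le> L n - z n" using n n0 adic_inv[OF z(1)] by auto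
    then show ?thesis using 1 by auto
  qed
  then show ?thesis by blast
qed

end

section \<open>The structure group and the fibres of the factor map\<close>

context simplified_bijective begin

abbreviation G where "G \<equiv> struct_group \<theta> l"
abbreviation I where "I \<equiv> struct_I \<theta> l"

lemma BijGroup_UNIV:
  "carrier (BijGroup UNIV) = {f. bij f}" "one (BijGroup UNIV) = id"
  "bij f \<Longrightarrow> bij g \<Longrightarrow> f \<otimes>\<^bsub>BijGroup UNIV\<^esub> g = f \<circ> g"
  by (auto simp: BijGroup_def Bij_def compose_def fun_eq_iff)

lemma G_simps: "carrier G = generate (BijGroup UNIV) (carrier (BijGroup UNIV) \<inter> {subst_col \<theta> n i | n i. i < l ^ n})"
  "mult G = mult (BijGroup UNIV)" "one G = id"
  by (auto simp: struct_group_def subgroup_generated_def BijGroup_UNIV(2))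

lemma G_group: "group G"
  unfolding struct_group_def by (intro group.group_subgroup_generated group_BijGroup)

sublocale G: group G by (rule G_group)

lemma G_bij: "g \<in> carrier G \<Longrightarrow> bij g"
  using group.generate_in_carrier[OF group_BijGroup, of "carrier (BijGroup UNIV) \<inter> {subst_col \<theta> n i | n i. i < l ^ n}" UNIV g]
  unfolding G_simps BijGroup_UNIV(1) by blast

lemma G_mult [simp]: "f \<in> carrier G \<Longrightarrow> g \<in> carrier G \<Longrightarrow> f \<otimes>\<^bsub>G\<^esub> g = f \<circ> g"
  by (simp add: G_simps(2) BijGroup_UNIV G_bij)

lemma G_one [simp]: "\<one>\<^bsub>G\<^esub> = id" by (rule G_simps(3))

lemma G_comp: "f \<in> carrier G \<Longrightarrow> g \<in> carrier G \<Longrightarrow> f \<circ> g \<in> carrier G"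
  using G.m_closed[of f g] by (simp del: G.m_closed)

lemma G_id: "id \<in> carrier G"
  using G.one_closed by simp

lemma G_inv [simp]: assumes "g \<in> carrier G" shows "inv\<^bsub>G\<^esub> g = finv g"
proof -
  have "g \<circ> m_inv G g = id" using G.r_inv[OF assms] assms by (simp del: G.r_inv)
  then have "g (m_inv G g a) = a" for a by (metis comp_apply id_apply)
  then show ?thesis using G_bij[OF assms] by (metis bij_inv_eq_iff ext)
qed

lemma G_inv_closed: "g \<in> carrier G \<Longrightarrow> finv g \<in> carrier G"
  using G.inv_closed[of g] by (simp del: G.inv_closed)

lemma G_finite: "finite (carrier G)"
  by (rule finite_subset[of _ UNIV]) auto

lemma nat_lt_pow: "0 \<le> i \<Longrightarrow> i < L n \<Longrightarrow> nat i < l ^ n"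
  by (simp add: nat_less_iff)

lemma col_in_G: "0 \<le> i \<Longrightarrow> i < L n \<Longrightarrow> col n i \<in> carrier G"
  unfolding G_simps BijGroup_UNIV(1) using col_bij[of i n] nat_lt_pow[of i n]
  by (intro generate.incl) (auto simp: col_def)

text \<open>Inverses are powers, so that closure under composition suffices.\<close>

lemma G_induct:
  assumes "g \<in> carrier G"
    and col: "\<And>n i. 0 \<le> i \<Longrightarrow> i < L n \<Longrightarrow> P (col n i)"
    and comp: "\<And>f g. f \<in> carrier G \<Longrightarrow> g \<in> carrier G \<Longrightarrow> P f \<Longrightarrow> P g \<Longrightarrow> P (f \<circ> g)"
  shows "P g"
proof -
  have gen: "P (subst_col \<theta> n i)" if "i < l ^ n" for n i
  proof -
    have "int i < L n" using that by (metis of_nat_less_iff of_nat_power)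
    then show ?thesis using col[of "int i" n] by (simp add: col_def)
  qed
  have g: "g \<in> generate (BijGroup UNIV) (carrier (BijGroup UNIV) \<inter> {subst_col \<theta> n i | n i. i < l ^ n})"
    using assms(1) by (simp add: G_simps)
  then show ?thesis
  proof (induction rule: generate.induct)
    case one
    have "P (col 0 0)" by (rule col) auto
    then show ?case by (simp only: col_0 BijGroup_UNIV)
  next
    case (incl h)
    then show ?case using gen by blast
  next
    case (inv h)
    then obtain n i where h: "h = subst_col \<theta> n i" "i < l ^ n" by blast
    have hG: "h \<in> carrier G" using inv by (auto simp: G_simps(1) intro: generate.incl)
    have Ph: "P h" using gen h by blast
    have pow: "h ^^ Suc k \<in> carrier G \<and> P (h ^^ Suc k)" for k
    proof (induction k)
      case 0
      then show ?case using hG Ph by simp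
    next
      case (Suc k)
      have "h ^^ Suc (Suc k) = h \<circ> h ^^ Suc k" by (rule funpow.simps(2))
      then show ?case using hG Ph comp[of h "h ^^ Suc k"] G_comp[of h "h ^^ Suc k"] Suc by metis
    qed
    obtain p where p: "p \<ge> 1" "h ^^ p = id" using bij_has_power_id[OF G_bij[OF hG]] by blast
    \<comment> \<open>The exponent \<open>2 p - 1\<close>, unlike \<open>p - 1\<close>, is positive also for \<open>p = 1\<close>.\<close>
    have "Suc (Suc (2 * p - 2)) = p + p" using p(1) by simp
    then have "h \<circ> h ^^ Suc (2 * p - 2) = h ^^ (p + p)"
      by (metis funpow.simps(2))
    then have "h (( h ^^ Suc (2 * p - 2)) a) = a" for a
      using p(2) by (metis comp_apply funpow_add id_apply)
    then have "h ^^ Suc (2 * p - 2) = finv h"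
      using G_bij[OF hG] by (metis bij_inv_eq_iff ext)
    moreover have "inv\<^bsub>BijGroup UNIV\<^esub> h = finv h"
      using G_bij[OF hG] by (simp add: inv_BijGroup Bij_def restrict_def)
    ultimately show ?case using pow by metis
  next
    case (eng h1 h2)
    then have "h1 \<in> carrier G" "h2 \<in> carrier G" by (simp_all add: G_simps(1))
    then show ?case using comp[of h1 h2] eng BijGroup_UNIV(3)[of h1 h2] G_bij by metis
  qed
qed

lemma inv_comp_inv: "bij f \<Longrightarrow> bij g \<Longrightarrow> finv (f \<circ> finv g) = g \<circ> finv f"
  by (simp add: o_inv_distrib bij_imp_bij_inv inv_inv_eq)

lemma struct_I_iff:
  "i \<in> I \<longleftrightarrow> (\<exists>n j. 1 \<le> j \<and> j < L n \<and> i = col n j \<circ> finv (col n (j - 1)))"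
proof
  assume "i \<in> I"
  then obtain n k where k: "1 \<le> k" "k \<le> l ^ n - 1"
    and i: "i = subst_col \<theta> n k \<otimes>\<^bsub>G\<^esub> inv\<^bsub>G\<^esub> subst_col \<theta> n (k - 1)"
    unfolding struct_I_def by blast
  have "k < l ^ n" using k by auto
  then have lt: "int k < L n" by (metis of_nat_less_iff of_nat_power)
  have eq: "subst_col \<theta> n k = col n (int k)" "subst_col \<theta> n (k - 1) = col n (int k - 1)"
    using k by (auto simp: col_def nat_diff_distrib)
  have c: "col n (int k) \<in> carrier G" "col n (int k - 1) \<in> carrier G"
    using k(1) lt by (intro col_in_G; linarith)+
  have "i = col n (int k) \<circ> finv (col n (int k - 1))"
    unfolding i eq using c by (simp add: G_inv_closed)
  then show "\<exists>n j. 1 \<le> j \<and> j < L n \<and> i = col n j \<circ> finv (col n (j - 1))"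
    using k lt by (intro exI[of _ n] exI[of _ "int k"]) auto
next
  assume "\<exists>n j. 1 \<le> j \<and> j < L n \<and> i = col n j \<circ> finv (col n (j - 1))"
  then obtain n j where j: "1 \<le> j" "j < L n" and i: "i = col n j \<circ> finv (col n (j - 1))" by blast
  have "col n j \<in> carrier G" "col n (j - 1) \<in> carrier G" using j by (auto intro!: col_in_G)
  then have "i = col n j \<otimes>\<^bsub>G\<^esub> inv\<^bsub>G\<^esub> col n (j - 1)"
    unfolding i by (simp add: G_inv_closed)
  moreover have "nat (j - 1) = nat j - 1" using j by auto
  moreover have "1 \<le> nat j" "nat j \<le> l ^ n - 1" using j nat_lt_pow[of j n] by auto
  ultimately show "i \<in> I" unfolding struct_I_def col_def by force
qed

lemma struct_I_in_G: "i \<in> I \<Longrightarrow> i \<in> carrier G"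
  unfolding struct_I_iff by (auto intro!: G_comp G_inv_closed col_in_G)

lemma struct_I_nonempty: "I \<noteq> {}"
proof -
  have "(1::int) < L 1" using l_ge2 by simp
  then have "col 1 1 \<circ> finv (col 1 (1 - 1)) \<in> I"
    unfolding struct_I_iff by (intro exI[of _ 1] conjI) (rule order_refl, assumption, rule refl)
  then show ?thesis by blast
qed

lemma div_L_cases: "\<bar>k\<bar> < L n \<Longrightarrow> k div L n = 0 \<or> k div L n = - 1"
proof -
  assume k: "\<bar>k\<bar> < L n"
  show ?thesis
  proof (cases "0 \<le> k")
    case True
    then show ?thesis using k by simp
  next
    case False
    then have "(k + L n) div L n = 0" using k by simp
    then show ?thesis using L_pos[of n] by simp
  qed
qed

text \<open>Because the outer columns of \<open>\<theta>^p\<close> are trivial, the iterates of \<open>\<theta>^p\<close> on any sequence with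
  \<open>b\<close> and \<open>a\<close> around the origin stabilize on growing windows. If \<open>ba\<close> occurs in a word \<open>\<theta>^n(c)\<close>,
  then these windows occur in the words \<open>\<theta>^m(c)\<close>.\<close>

lemma seed_point:
  assumes p: "1 \<le> p" "col p 0 = id" "col p (L p - 1) = id"
  shows "\<exists>u. T p u = u \<and> u 0 = a \<and> u (- 1) = b \<and>
    (\<forall>n j c. 1 \<le> j \<and> j < L n \<and> a = col n j c \<and> b = col n (j - 1) c \<longrightarrow> u \<in> X)"
proof -
  \<comment> \<open>Only the values of \<open>v\<close> at \<open>0\<close> and \<open>- 1\<close> matter for the limit.\<close>
  define v where "v k = (if k \<ge> 0 then a else b)" for k :: int
  define W where "W n = T (p * n) v" for n
  have v: "v 0 = a" "v (- 1) = b" by (auto simp: v_def)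
  have Tv: "T p v 0 = a" "T p v (- 1) = b"
  proof -
    show "T p v 0 = a" by (simp add: T_nth p v)
    have "T p v (- 1) = T p v ((L p - 1) + L p * (- 1))" by simp
    also have "\<dots> = b" using L_pos[of p] by (subst T_nth_block) (auto simp: p v)
    finally show "T p v (- 1) = b" .
  qed
  have n_lt: "int n < L (p * n)" for n
  proof -
    have "n \<le> p * n" using p(1) by simp
    then show ?thesis using L_gt[of "p * n"] by linarith
  qed
  have W_Suc: "W (Suc n) k = W n k" if "\<bar>k\<bar> \<le> int n" for n k
  proof -
    have "\<bar>k\<bar> < L (p * n)" using that n_lt[of n] by linarith
    then have "T p v (k div L (p * n)) = v (k div L (p * n))"
      using div_L_cases[of k "p * n"] Tv v by auto
    moreover have "W (Suc n) = T (p * n) (T p v)"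
      using T_add[of "p * n" p v] by (simp add: W_def add.commute)
    ultimately show ?thesis by (simp add: W_def T_nth)
  qed
  have W_ge: "W m k = W n k" if "n \<le> m" "\<bar>k\<bar> \<le> int n" for m n k
    using that(1)
  proof (induction m rule: dec_induct)
    case (step m)
    then show ?case using W_Suc[of k m] that(2) by simp
  qed simp
  define u where "u k = W (nat \<bar>k\<bar>) k" for k
  have u_eq: "u k = W n k" if "\<bar>k\<bar> \<le> int n" for n k
    unfolding u_def using W_ge[of "nat \<bar>k\<bar>" n k] that by simp
  have u0: "u 0 = a" "u (- 1) = b" using u_eq[of 0 0] u_eq[of "- 1" 1] Tv by (simp_all add: W_def v)
  have "T p u k = u k" for k
  proof -
    let ?n = "nat \<bar>k\<bar> + nat \<bar>k div L p\<bar>"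
    have "u (k div L p) = W ?n (k div L p)" by (rule u_eq) simp
    then have "T p u k = T p (W ?n) k" by (simp add: T_nth)
    also have "T p (W ?n) = W (Suc ?n)" using T_add[of p "p * ?n" v] by (simp add: W_def)
    also have "W (Suc ?n) k = u k" by (rule u_eq[symmetric]) simp
    finally show ?thesis .
  qed
  moreover have "u \<in> X" if j: "1 \<le> j" "j < L n" and a: "a = col n j c" and b: "b = col n (j - 1) c" for n j c
    unfolding subst_space_iff
  proof
    fix N :: nat
    let ?K = "p * N"
    have LK: "L ?K * (j - 1) + L ?K = L ?K * j" by (simp add: algebra_simps)
    have nn: "0 \<le> L ?K * (j - 1)" using j L_pos[of ?K] by simp
    have "L ?K * (j + 1) \<le> L ?K * L n" using j L_pos[of ?K] by (intro mult_left_mono) auto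
    then have up: "L ?K * j + L ?K \<le> L (?K + n)" by (simp add: algebra_simps power_add)
    have "int N \<le> L ?K * j" "L ?K * j + int N < L (?K + n)"
      using n_lt[of N] LK nn up by linarith+
    moreover have "u m = col (?K + n) (L ?K * j + m) c" if m: "\<bar>m\<bar> \<le> int N" for m
    proof -
      let ?q = "m div L ?K"
      have q: "?q = 0 \<or> ?q = - 1" using m n_lt[of N] by (intro div_L_cases) linarith
      then have "v ?q = col n (j + ?q) c" using a b v by auto
      then have "u m = col ?K (m mod L ?K) (col n (j + ?q) c)"
        using u_eq[OF m] by (simp add: W_def T_nth)
      also have "\<dots> = col (?K + n) (m mod L ?K + L ?K * (j + ?q)) c"
        using col_add[of "m mod L ?K" ?K "j + ?q" n] q j L_pos[of ?K] by auto
      also have "m mod L ?K + L ?K * (j + ?q) = L ?K * j + m"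
        by (simp add: distrib_left)
      finally show ?thesis .
    qed
    ultimately show "occurs_around u N" unfolding occurs_around_def by blast
  qed
  ultimately show ?thesis using u0 by (intro exI[of _ u]) auto
qed

lemma col_ends_pow: "col n 0 = col 1 0 ^^ n" "col n (L n - 1) = col 1 (int l - 1) ^^ n"
proof (induction n)
  case (Suc n)
  have "col (Suc n) 0 = col 1 0 \<circ> col n 0" using col_Suc[of 0 n] L_pos[of "Suc n"] by simp
  then show "col (Suc n) 0 = col 1 0 ^^ Suc n" using Suc by simp
  have "L (Suc n) - 1 = (int l - 1) + int l * (L n - 1)" by (simp add: algebra_simps)
  then have "col (Suc n) (L (Suc n) - 1) = col (1 + n) ((int l - 1) + L 1 * (L n - 1))"
    by (simp only: power_one_right plus_1_eq_Suc)
  also have "\<dots> = col 1 (int l - 1) \<circ> col n (L n - 1)" using L_pos[of n] by (intro col_add) auto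
  finally show "col (Suc n) (L (Suc n) - 1) = col 1 (int l - 1) ^^ Suc n" using Suc by simp
qed (simp_all add: col_0)

text \<open>Some power of \<open>\<theta>\<close> has trivial outer columns, hence a fixed point in the space through each
  allowed pair of letters. These points are \<open>\<theta>\<close>-periodic, hence fixed by \<open>\<theta>\<close> itself.\<close>

lemma col_ends: "col n 0 = id" "col n (L n - 1) = id"
proof -
  have l1: "0 \<le> int l - 1" "int l - 1 < L 1" "(1::int) < L 1" using l_ge2 by auto
  obtain p where p: "p \<ge> 1" "col 1 0 ^^ p = id"
    using bij_has_power_id[OF col_bij[of 0 1]] l1 by auto
  obtain q where q: "q \<ge> 1" "col 1 (int l - 1) ^^ q = id"
    using bij_has_power_id[OF col_bij[of "int l - 1" 1]] l1 by blast
  have pow_id: "f ^^ (m * k) = id" if "f ^^ m = id" for f :: "'a \<Rightarrow> 'a" and m k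
    unfolding funpow_mult[symmetric] that by (rule id_funpow)
  have pq: "col (p * q) 0 = id" "col (p * q) (L (p * q) - 1) = id"
    using pow_id[OF p(2), of q] pow_id[OF q(2), of p]
    unfolding col_ends_pow[of "p * q"] by (simp_all only: mult.commute)
  have fixed: "\<exists>u. T 1 u = u \<and> u 0 = col 1 1 c \<and> u (- 1) = col 1 0 c" for c
  proof -
    obtain u where u: "T (p * q) u = u" "u 0 = col 1 1 c" "u (- 1) = col 1 0 c"
      "\<forall>n j c'. 1 \<le> j \<and> j < L n \<and> col 1 1 c = col n j c' \<and> col 1 0 c = col n (j - 1) c' \<longrightarrow> u \<in> X"
      using seed_point[OF _ pq, of "col 1 1 c" "col 1 0 c"] p(1) q(1) by auto
    have "u \<in> X" using u(4)[rule_format, of 1 1 c] l1 by simp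
    moreover have "p * q \<ge> 1" using p(1) q(1) by simp
    ultimately have "subst_seq \<theta> l u = u" using simplified u(1) unfolding simplified_subst_def by blast
    then show ?thesis using u(2,3) by (intro exI[of _ u]) simp
  qed
  have "col 1 0 a = a" for a
  proof -
    obtain c where c: "a = col 1 1 c" using col_bij[of 1 1] l1 by (metis bij_pointE zero_le_one)
    obtain u where u: "T 1 u = u" "u 0 = a" using fixed[of c] c by blast
    have "T 1 u 0 = col 1 0 (u 0)" by (subst T_nth) simp
    then show ?thesis using u by simp
  qed
  then have 1: "col 1 0 = id" by auto
  have "col 1 (int l - 1) b = b" for b
  proof -
    obtain u where u: "T 1 u = u" "u (- 1) = b" using fixed[of b] 1 by auto
    have "T 1 u (- 1) = T 1 u ((L 1 - 1) + L 1 * (- 1))" by simp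
    also have "\<dots> = col 1 (L 1 - 1) (u (- 1))" using l1 by (intro T_nth_block) auto
    finally show ?thesis using u by simp
  qed
  then have 2: "col 1 (int l - 1) = id" by auto
  show "col n 0 = id" "col n (L n - 1) = id" unfolding col_ends_pow[of n] 1 2 by (rule id_funpow)+
qed

lemma zero_fibre_values:
  assumes x: "x \<in> X" "\<pi> x = zero" and k: "0 \<le> k" "k < L n"
  shows "x k = col n k (x 0)" "x (k - L n) = col n k (x (- 1))"
proof -
  obtain y where "x = shift (\<pi> x n) (T n y)" using factor_map_coset(1)[OF x(1), of n] by (elim bexE) simp
  then have y: "x = T n y" using x(2) by (simp add: adic_zero)
  have "x (0 + L n * 0) = col n 0 (y 0)"
    unfolding y using L_pos[of n] by (intro T_nth_block) auto
  then have 0: "x 0 = y 0" by (simp add: col_ends)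
  have "x ((L n - 1) + L n * (- 1)) = col n (L n - 1) (y (- 1))"
    unfolding y using L_pos[of n] by (intro T_nth_block) auto
  then have 1: "x (- 1) = y (- 1)" by (simp add: col_ends)
  have "x (k + L n * 0) = col n k (y 0)" "x (k + L n * (- 1)) = col n k (y (- 1))"
    unfolding y using k by (intro T_nth_block; simp)+
  then show "x k = col n k (x 0)" "x (k - L n) = col n k (x (- 1))"
    using 0 1 by simp_all
qed

lemma zero_fibre_unique:
  assumes "x \<in> X" "\<pi> x = zero" "y \<in> X" "\<pi> y = zero" "x 0 = y 0" "x (- 1) = y (- 1)"
  shows "x = y"
proof
  fix k
  let ?n = "nat \<bar>k\<bar>"
  have k: "\<bar>k\<bar> < L ?n" using L_gt[of ?n] by simp
  show "x k = y k"
  proof (cases "0 \<le> k")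
    case True
    have "k < L ?n" using k by linarith
    then show ?thesis
      using zero_fibre_values(1)[OF assms(1,2) True] zero_fibre_values(1)[OF assms(3,4) True] assms(5) by simp
  next
    case False
    then have "0 \<le> k + L ?n" "k + L ?n < L ?n" using k by linarith+
    then have "x (k + L ?n - L ?n) = y (k + L ?n - L ?n)"
      using zero_fibre_values(2)[OF assms(1,2)] zero_fibre_values(2)[OF assms(3,4)] assms(6) by metis
    then show ?thesis by simp
  qed
qed

text \<open>An element of \<open>I\<close> comes from two adjacent columns of some \<open>\<theta>^n\<close>, and a column takes
  every value, so that all pairs \<open>(i^{-1} a, a)\<close> are allowed.\<close>

lemma zero_fibre_point:
  assumes "i \<in> I"
  shows "\<exists>x\<in>X. \<pi> x = zero \<and> x 0 = a \<and> x (- 1) = finv i a"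
proof -
  obtain n j where j: "1 \<le> j" "j < L n" and i: "i = col n j \<circ> finv (col n (j - 1))"
    using assms unfolding struct_I_iff by blast
  have bij: "bij (col n j)" "bij (col n (j - 1))" using j col_bij by auto
  define c where "c = finv (col n j) a"
  have c: "a = col n j c" "finv i a = col n (j - 1) c"
    unfolding i inv_comp_inv[OF bij] c_def using bij(1) by (simp_all add: bij_is_surj surj_f_inv_f)
  obtain u where u: "T 1 u = u" "u 0 = a" "u (- 1) = finv i a"
    "\<forall>n j c. 1 \<le> j \<and> j < L n \<and> a = col n j c \<and> finv i a = col n (j - 1) c \<longrightarrow> u \<in> X"
    using seed_point[OF order_refl col_ends, of a "finv i a"] by (elim exE conjE) (rule that)
  have "u \<in> X" using u(4) j c by blast
  moreover have "T n u = u" for n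
  proof (induction n)
    case (Suc n)
    then show ?case using u(1) by simp
  qed simp
  then have "\<pi> u n = 0" for n using \<open>u \<in> X\<close> L_pos[of n] by (intro factor_map_eqI[of u]) auto
  then have "\<pi> u = zero" by (simp add: adic_zero fun_eq_iff)
  ultimately show ?thesis using u by blast
qed

lemma pair_in_I:
  assumes "x \<in> X"
  shows "\<exists>i\<in>I. x (k - 1) = finv i (x k)"
proof -
  have "shift k x \<in> X" using assms by (rule shift_in_X)
  then obtain n a j where j: "1 \<le> j" "j + 1 < L n" and xm: "\<And>m. \<bar>m\<bar> \<le> 1 \<Longrightarrow> shift k x m = col n (j + m) a"
    unfolding subst_space_iff occurs_around_def by (metis of_nat_1)
  let ?i = "col n j \<circ> finv (col n (j - 1))"
  have bij: "bij (col n j)" "bij (col n (j - 1))" using j col_bij by auto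
  have "x k = col n j a" "x (k - 1) = col n (j - 1) a"
    using xm[of 0] xm[of "- 1"] by (simp_all add: shift_def)
  then have "x (k - 1) = finv ?i (x k)"
    unfolding inv_comp_inv[OF bij] using bij(1) by (simp add: bij_is_inj)
  moreover have "?i \<in> I" unfolding struct_I_iff using j by (intro exI[of _ n] exI[of _ j]) auto
  ultimately show ?thesis by blast
qed

text \<open>Otherwise each letter would determine its predecessor in all points of the space, since every
  pair of adjacent letters occurs around the origin of some point over \<open>0\<close>.\<close>

lemma zero_fibre_not_permutation:
  assumes "bij \<rho>"
  shows "\<exists>x\<in>X. \<pi> x = zero \<and> x (- 1) \<noteq> \<rho> (x 0)"
proof -
  obtain i where "i \<in> I" using struct_I_nonempty by blast
  then obtain x where x: "x \<in> X" using zero_fibre_point by blast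
  obtain q where q: "x (q + 1) \<noteq> finv \<rho> (x q)"
    using successor_not_permutation[OF x bij_imp_bij_inv[OF assms]] by blast
  obtain i' where i': "i' \<in> I" "x q = finv i' (x (q + 1))" using pair_in_I[OF x, of "q + 1"] by auto
  obtain y where y: "y \<in> X" "\<pi> y = zero" "y 0 = x (q + 1)" "y (- 1) = finv i' (x (q + 1))"
    using zero_fibre_point[OF i'(1)] by blast
  have "x q \<noteq> \<rho> (x (q + 1))" using q assms by (metis bij_inv_eq_iff)
  then show ?thesis using y i' by auto
qed

text \<open>The letters within one block determine each other, through the letter that the block comes
  from.\<close>

lemma block_values:
  assumes x: "x \<in> X" and k: "0 \<le> \<pi> x n + k" "\<pi> x n + k < L n" and m: "0 \<le> \<pi> x n + m" "\<pi> x n + m < L n"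
  shows "x m = col n (\<pi> x n + m) (finv (col n (\<pi> x n + k)) (x k))"
proof -
  obtain y where y: "x = shift (\<pi> x n) (T n y)" using factor_map_coset(1)[OF x, of n] by (elim bexE) simp
  have v: "x k = col n (\<pi> x n + k) (y 0)" if "0 \<le> \<pi> x n + k" "\<pi> x n + k < L n" for k
    using T_nth_block[OF that, of y 0] by (subst y) (simp add: shift_def add.commute)
  show ?thesis using v[OF k] v[OF m] col_bij[OF k] by (simp add: bij_is_inj)
qed

lemma regular_fibre_unique:
  assumes "x \<in> X" "y \<in> X" "\<pi> x = \<pi> y" "\<pi> x \<notin> range emb" "x k = y k"
  shows "x = y"
proof
  fix m
  have z: "\<pi> x \<in> Z" using assms(1) by (rule factor_map_adic)
  obtain n0 where n0: "\<forall>n\<ge>n0. 0 \<le> \<pi> x n + k \<and> \<pi> x n + k < L n" using adic_window[OF z assms(4)] by blast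
  obtain n1 where n1: "\<forall>n\<ge>n1. 0 \<le> \<pi> x n + m \<and> \<pi> x n + m < L n" using adic_window[OF z assms(4)] by blast
  let ?n = "max n0 n1"
  have 1: "0 \<le> \<pi> x ?n + k" "\<pi> x ?n + k < L ?n" "0 \<le> \<pi> x ?n + m" "\<pi> x ?n + m < L ?n"
    using n0 n1 by auto
  show "x m = y m"
    using block_values[OF assms(1) 1] block_values[of y ?n k m] 1 assms by simp
qed

end

section \<open>The Ellis semigroup as the set of finitely approximable maps\<close>

context simplified_bijective begin

abbreviation E where "E \<equiv> ellis \<theta>"

lemma topspace_space_topology: "topspace (space_topology \<theta>) = X"
  by (simp add: space_topology_def)

lemma openin_window: "openin (space_topology \<theta>) {y \<in> X. \<forall>k. \<bar>k\<bar> \<le> int N \<longrightarrow> y k = z k}"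
proof -
  let ?S = "Pi\<^sub>E UNIV (\<lambda>k. if \<bar>k\<bar> \<le> int N then {z k} else UNIV)"
  have "{k::int. \<bar>k\<bar> \<le> int N} \<subseteq> {- int N..int N}" by auto
  then have "finite {k::int. \<bar>k\<bar> \<le> int N}" by (rule finite_subset) simp
  then have fin: "finite {k. (if \<bar>k\<bar> \<le> int N then {z k} else UNIV) \<noteq> UNIV}"
    by (rule rev_finite_subset) auto
  have "openin (product_topology (\<lambda>_. discrete_topology UNIV) UNIV) ?S"
    unfolding openin_PiE_gen using fin by simp
  moreover have "{y \<in> X. \<forall>k. \<bar>k\<bar> \<le> int N \<longrightarrow> y k = z k} = ?S \<inter> X"
    by (auto simp: PiE_iff split: if_splits)
  ultimately show ?thesis unfolding space_topology_def openin_subtopology by blast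
qed

lemma window_neighbourhood:
  assumes "openin (space_topology \<theta>) U" "z \<in> U"
  shows "\<exists>N::nat. \<forall>y\<in>X. (\<forall>k. \<bar>k\<bar> \<le> int N \<longrightarrow> y k = z k) \<longrightarrow> y \<in> U"
proof -
  obtain W where W: "openin (product_topology (\<lambda>_. discrete_topology UNIV) UNIV) W" "U = W \<inter> X"
    using assms(1) unfolding space_topology_def openin_subtopology by blast
  then obtain V where V: "finite {i \<in> UNIV. V i \<noteq> topspace (discrete_topology (UNIV::'a set))}"
    "z \<in> Pi\<^sub>E UNIV V" "Pi\<^sub>E UNIV V \<subseteq> W"
    using assms(2) unfolding openin_product_topology_alt by blast
  let ?K = "{i. V i \<noteq> UNIV}"
  have fin: "finite ?K" using V(1) by simp
  define N where "N = nat (\<Sum>k\<in>?K. \<bar>k\<bar>)"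
  have "y \<in> U" if y: "y \<in> X" "\<forall>k. \<bar>k\<bar> \<le> int N \<longrightarrow> y k = z k" for y
  proof -
    have "y k \<in> V k" for k
    proof (cases "k \<in> ?K")
      case True
      then have "\<bar>k\<bar> \<le> (\<Sum>k\<in>?K. \<bar>k\<bar>)" using fin by (intro member_le_sum) auto
      then have "y k = z k" using y(2) by (simp add: N_def)
      then show ?thesis using V(2) by auto
    qed simp
    then have "y \<in> Pi\<^sub>E UNIV V" by (simp add: PiE_iff)
    then show ?thesis using V(3) W(2) y(1) by blast
  qed
  then show ?thesis by blast
qed

text \<open>A basic neighbourhood in the topology of pointwise convergence restricts the values at finitely
  many points, and each value on a finite window.\<close>

lemma ellis_iff:
  "f \<in> E \<longleftrightarrow> f \<in> X \<rightarrow>\<^sub>E X \<and>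
    (\<forall>F N. finite F \<longrightarrow> F \<subseteq> X \<longrightarrow> (\<exists>t. \<forall>x\<in>F. \<forall>k. \<bar>k\<bar> \<le> int N \<longrightarrow> f x k = x (k + t)))"
proof (intro iffI conjI allI impI)
  assume f: "f \<in> E"
  then show fX: "f \<in> X \<rightarrow>\<^sub>E X"
    unfolding ellis_def self_map_topology_def in_closure_of by (simp add: topspace_space_topology)
  fix F and N :: nat assume F: "finite F" "F \<subseteq> X"
  define W where "W x = (if x \<in> F then {y \<in> X. \<forall>k. \<bar>k\<bar> \<le> int N \<longrightarrow> y k = f x k} else X)" for x
  have "finite {x \<in> X. W x \<noteq> X}" using F(1) by (rule rev_finite_subset) (auto simp: W_def)
  moreover have "openin (space_topology \<theta>) (W x)" for x
    unfolding W_def using openin_window openin_topspace[of "space_topology \<theta>"]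
    by (auto simp: topspace_space_topology)
  ultimately have "openin (self_map_topology \<theta>) (Pi\<^sub>E X W)"
    unfolding self_map_topology_def openin_PiE_gen by (simp add: topspace_space_topology)
  moreover have "f \<in> Pi\<^sub>E X W" using fX by (auto simp: W_def PiE_iff)
  ultimately obtain g where g: "g \<in> shift_maps \<theta>" "g \<in> Pi\<^sub>E X W"
    using f unfolding ellis_def in_closure_of by blast
  then obtain t where t: "g = restrict (shift t) X" unfolding shift_maps_def by blast
  have "f x k = x (k + t)" if "x \<in> F" "\<bar>k\<bar> \<le> int N" for x k
  proof -
    have "g x \<in> W x" "g x = shift t x" using g(2) F(2) that(1) t by (auto simp: PiE_iff)
    then have "shift t x k = f x k" using that unfolding W_def by auto
    then show ?thesis by (simp add: shift_def)
  qed
  then show "\<exists>t. \<forall>x\<in>F. \<forall>k. \<bar>k\<bar> \<le> int N \<longrightarrow> f x k = x (k + t)" by blast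
next
  assume f: "f \<in> X \<rightarrow>\<^sub>E X \<and>
    (\<forall>F N. finite F \<longrightarrow> F \<subseteq> X \<longrightarrow> (\<exists>t. \<forall>x\<in>F. \<forall>k. \<bar>k\<bar> \<le> int N \<longrightarrow> f x k = x (k + t)))"
  show "f \<in> E" unfolding ellis_def in_closure_of
  proof (intro conjI allI impI)
    show "f \<in> topspace (self_map_topology \<theta>)"
      using f by (simp add: self_map_topology_def topspace_space_topology)
    fix U assume "f \<in> U \<and> openin (self_map_topology \<theta>) U"
    then obtain V where V: "finite {x \<in> X. V x \<noteq> topspace (space_topology \<theta>)}"
      "\<forall>x\<in>X. openin (space_topology \<theta>) (V x)" "f \<in> Pi\<^sub>E X V" "Pi\<^sub>E X V \<subseteq> U"
      unfolding self_map_topology_def openin_product_topology_alt by blast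
    let ?F = "{x \<in> X. V x \<noteq> X}"
    have fin: "finite ?F" using V(1) by (simp add: topspace_space_topology)
    have "\<forall>x\<in>X. \<exists>N::nat. \<forall>y\<in>X. (\<forall>k. \<bar>k\<bar> \<le> int N \<longrightarrow> y k = f x k) \<longrightarrow> y \<in> V x"
      using V(2,3) window_neighbourhood by (metis PiE_iff)
    then obtain Nf :: "_ \<Rightarrow> nat"
      where Nf: "\<And>x y. x \<in> X \<Longrightarrow> y \<in> X \<Longrightarrow> \<forall>k. \<bar>k\<bar> \<le> int (Nf x) \<longrightarrow> y k = f x k \<Longrightarrow> y \<in> V x"
      by metis
    define N where "N = (\<Sum>x\<in>?F. Nf x)"
    obtain t where t: "\<forall>x\<in>?F. \<forall>k. \<bar>k\<bar> \<le> int N \<longrightarrow> f x k = x (k + t)"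
      using f fin by (metis (no_types, lifting) mem_Collect_eq subsetI)
    have "shift t x \<in> V x" if x: "x \<in> X" for x
    proof (cases "x \<in> ?F")
      case True
      then have "Nf x \<le> N" unfolding N_def using fin by (intro member_le_sum) auto
      then have "\<forall>k. \<bar>k\<bar> \<le> int (Nf x) \<longrightarrow> shift t x k = f x k"
        using t True by (simp add: shift_def)
      then show ?thesis using Nf[OF x shift_in_X[OF x]] by blast
    next
      case False
      then show ?thesis using x shift_in_X[OF x, of t] by blast
    qed
    then have "restrict (shift t) X \<in> Pi\<^sub>E X V" by auto
    then show "\<exists>g. g \<in> shift_maps \<theta> \<and> g \<in> U" using V(4) unfolding shift_maps_def by blast
  qed
qed

lemma ellis_in_X: "f \<in> E \<Longrightarrow> x \<in> X \<Longrightarrow> f x \<in> X"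
  unfolding ellis_iff by auto

lemma ellis_extensional: "f \<in> E \<Longrightarrow> f \<in> extensional X"
  unfolding ellis_iff by (auto simp: PiE_def)

lemma ellis_approx:
  assumes "f \<in> E" "finite F" "F \<subseteq> X"
  shows "\<exists>t. \<forall>x\<in>F. \<forall>k. \<bar>k\<bar> \<le> int N \<longrightarrow> f x k = x (k + t)"
  using assms unfolding ellis_iff by blast

lemma shift_maps_subset_ellis: "shift_maps \<theta> \<subseteq> E"
proof
  fix f assume "f \<in> shift_maps \<theta>"
  then obtain t where f: "f = restrict (shift t) X" unfolding shift_maps_def by blast
  show "f \<in> E" unfolding ellis_iff
  proof (intro conjI allI impI)
    show "f \<in> X \<rightarrow>\<^sub>E X" unfolding f using shift_in_X by auto
    fix F and N :: nat assume "F \<subseteq> X"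
    then show "\<exists>t. \<forall>x\<in>F. \<forall>k. \<bar>k\<bar> \<le> int N \<longrightarrow> f x k = x (k + t)"
      unfolding f by (intro exI[of _ t]) (auto simp: shift_def)
  qed
qed

lemma ellis_compose: assumes f: "f \<in> E" and g: "g \<in> E" shows "compose X f g \<in> E"
  unfolding ellis_iff
proof (intro conjI allI impI)
  show "compose X f g \<in> X \<rightarrow>\<^sub>E X"
    using ellis_in_X[OF f] ellis_in_X[OF g] by (auto simp: compose_def)
  fix F and N :: nat assume F: "finite F" "F \<subseteq> X"
  have gF: "finite (g ` F)" "g ` F \<subseteq> X" using F ellis_in_X[OF g] by auto
  obtain t where t: "\<forall>x\<in>g ` F. \<forall>k. \<bar>k\<bar> \<le> int N \<longrightarrow> f x k = x (k + t)"
    using ellis_approx[OF f gF, of N] by blast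
  obtain s where s: "\<forall>x\<in>F. \<forall>k. \<bar>k\<bar> \<le> int (N + nat \<bar>t\<bar>) \<longrightarrow> g x k = x (k + s)"
    using ellis_approx[OF g F, of "N + nat \<bar>t\<bar>"] by blast
  have "compose X f g x k = x (k + (t + s))" if x: "x \<in> F" and k: "\<bar>k\<bar> \<le> int N" for x k
  proof -
    have "compose X f g x k = g x (k + t)" using x k t F by (auto simp: compose_def)
    also have "\<bar>k + t\<bar> \<le> int (N + nat \<bar>t\<bar>)" using k by auto
    then have "g x (k + t) = x (k + t + s)" using s x by blast
    finally show ?thesis by (simp add: add.assoc)
  qed
  then show "\<exists>t. \<forall>x\<in>F. \<forall>k. \<bar>k\<bar> \<le> int N \<longrightarrow> compose X f g x k = x (k + t)" by blast
qed

lemma ellis_closed: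
  assumes "f \<in> X \<rightarrow>\<^sub>E X" "\<And>F. finite F \<Longrightarrow> F \<subseteq> X \<Longrightarrow> \<exists>g\<in>E. \<forall>x\<in>F. g x = f x"
  shows "f \<in> E"
  unfolding ellis_iff
proof (intro conjI allI impI)
  show "f \<in> X \<rightarrow>\<^sub>E X" by fact
  fix F and N :: nat assume F: "finite F" "F \<subseteq> X"
  obtain g where g: "g \<in> E" "\<forall>x\<in>F. g x = f x" using assms(2)[OF F] by blast
  show "\<exists>t. \<forall>x\<in>F. \<forall>k. \<bar>k\<bar> \<le> int N \<longrightarrow> f x k = x (k + t)"
    using ellis_approx[OF g(1) F, of N] g(2) by auto
qed

lemma ellis_shift: assumes "f \<in> E" "x \<in> X" shows "f (shift s x) = shift s (f x)"
proof
  fix k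
  have F: "finite {x, shift s x}" "{x, shift s x} \<subseteq> X" using assms(2) shift_in_X by auto
  obtain t where t: "\<forall>y\<in>{x, shift s x}. \<forall>j. \<bar>j\<bar> \<le> int (nat \<bar>k\<bar> + nat \<bar>s\<bar>) \<longrightarrow> f y j = y (j + t)"
    using ellis_approx[OF assms(1) F, of "nat \<bar>k\<bar> + nat \<bar>s\<bar>"] by blast
  have "f (shift s x) k = shift s x (k + t)" using t by auto
  moreover have "f x (k + s) = x (k + s + t)" using t by auto
  ultimately show "f (shift s x) k = shift s (f x) k" by (simp add: shift_def algebra_simps)
qed

text \<open>An accumulation point of the given shifts exists because the product of copies of the alphabet,
  one for each point of the space and each position, is compact.\<close>

lemma ellis_cluster:
  fixes t :: "nat \<Rightarrow> int"
  shows "\<exists>f\<in>E. \<forall>F N m. finite F \<longrightarrow> F \<subseteq> X \<longrightarrow>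
    (\<exists>n\<ge>m. \<forall>x\<in>F. \<forall>k. \<bar>k\<bar> \<le> int N \<longrightarrow> f x k = x (k + t n))"
proof -
  define PT where "PT = product_topology (\<lambda>_. discrete_topology (UNIV::'a set)) (UNIV::((int \<Rightarrow> 'a) \<times> int) set)"
  define g :: "nat \<Rightarrow> (int \<Rightarrow> 'a) \<times> int \<Rightarrow> 'a" where "g n = (\<lambda>(x, k). x (k + t n))" for n
  define C where "C m = PT closure_of (g ` {m..})" for m
  have top: "topspace PT = UNIV" by (simp add: PT_def)
  have "(\<Inter>m. C m) \<noteq> {}"
  proof (rule compact_space_imp_nest)
    show "compact_space PT"
      unfolding PT_def compact_space_product_topology by (simp add: compact_space_discrete_topology)
    show "closedin PT (C m)" for m by (simp add: C_def)
    have sub: "g ` {m..} \<subseteq> C m" for m unfolding C_def by (rule closure_of_subset) (simp add: top)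
    show "C m \<noteq> {}" for m using sub[of m] by auto
    show "decseq C" unfolding decseq_def C_def by (intro allI impI closure_of_mono image_mono) auto
  qed
  then obtain h where h: "h \<in> C m" for m by blast
  have approx: "\<exists>n\<ge>m. \<forall>p\<in>K. h p = g n p" if K: "finite K" for m K
  proof -
    let ?U = "Pi\<^sub>E UNIV (\<lambda>p. if p \<in> K then {h p} else UNIV)"
    have fin: "finite {p. (if p \<in> K then {h p} else UNIV) \<noteq> UNIV}"
      using K by (rule rev_finite_subset) auto
    have "openin PT ?U" unfolding PT_def openin_PiE_gen using fin by simp
    moreover have "h \<in> ?U" by auto
    ultimately obtain n where "n \<ge> m" "g n \<in> ?U"
      using h[of m] unfolding C_def in_closure_of by blast
    then show ?thesis by (intro exI[of _ n]) (auto simp: PiE_iff split: if_splits)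
  qed
  define f where "f = (\<lambda>x\<in>X. \<lambda>k. h (x, k))"
  have cluster: "\<exists>n\<ge>m. \<forall>x\<in>F. \<forall>k. \<bar>k\<bar> \<le> int N \<longrightarrow> f x k = x (k + t n)"
    if F: "finite F" "F \<subseteq> X" for F N m
  proof -
    have "finite (F \<times> {- int N..int N})" using F by simp
    from approx[OF this, of m] obtain n where
      n: "n \<ge> m" "\<forall>p\<in>F \<times> {- int N..int N}. h p = g n p" by blast
    have "f x k = x (k + t n)" if "x \<in> F" "\<bar>k\<bar> \<le> int N" for x k
    proof -
      have "(x, k) \<in> F \<times> {- int N..int N}" using that by auto
      then have "h (x, k) = g n (x, k)" using n(2) by blast
      then show ?thesis using that(1) F(2) by (auto simp: f_def g_def)
    qed
    then show ?thesis using n(1) by blast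
  qed
  have "f x \<in> X" if x: "x \<in> X" for x
  proof (rule in_X_if_approximable)
    fix N :: nat
    obtain n where "\<forall>k. \<bar>k\<bar> \<le> int N \<longrightarrow> f x k = x (k + t n)"
      using cluster[of "{x}" 0 N] x by auto
    then show "\<exists>y\<in>X. \<forall>m. \<bar>m\<bar> \<le> int N \<longrightarrow> f x m = y m"
      using shift_in_X[OF x, of "t n"] by (intro bexI[of _ "shift (t n) x"]) (auto simp: shift_def)
  qed
  then have "f \<in> X \<rightarrow>\<^sub>E X" by (auto simp: f_def)
  then have "f \<in> E" unfolding ellis_iff using cluster by blast
  then show ?thesis using cluster by blast
qed

lemma X_nonempty: "\<exists>x. x \<in> X"
  using struct_I_nonempty zero_fibre_point by blast

text \<open>A single shift approximates the map at \<open>x\<close> and at a base point, and it displaces the residues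
  of both by the same amount.\<close>

lemma ellis_translation:
  assumes f: "f \<in> E"
  shows "\<exists>w\<in>Z. \<forall>x\<in>X. \<pi> (f x) = \<pi> x \<boxplus> w"
proof -
  obtain x0 where x0: "x0 \<in> X" using X_nonempty by blast
  have eq: "\<pi> (f x) \<boxplus> \<pi> x0 = \<pi> (f x0) \<boxplus> \<pi> x" if x: "x \<in> X" for x
  proof
    fix n
    have fx: "f x \<in> X" "f x0 \<in> X" using ellis_in_X[OF f] x x0 by auto
    obtain N :: nat where N: "\<forall>y\<in>X. (\<forall>m. \<bar>m\<bar> \<le> int N \<longrightarrow> y m = f x m) \<longrightarrow> \<pi> y n = \<pi> (f x) n"
      using factor_map_locally_constant[OF fx(1)] by blast
    obtain M :: nat where M: "\<forall>y\<in>X. (\<forall>m. \<bar>m\<bar> \<le> int M \<longrightarrow> y m = f x0 m) \<longrightarrow> \<pi> y n = \<pi> (f x0) n"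
      using factor_map_locally_constant[OF fx(2)] by blast
    have F: "finite {x, x0}" "{x, x0} \<subseteq> X" using x x0 by auto
    obtain t where t: "\<forall>y\<in>{x, x0}. \<forall>k. \<bar>k\<bar> \<le> int (N + M) \<longrightarrow> f y k = y (k + t)"
      using ellis_approx[OF f F, of "N + M"] by blast
    have "\<pi> (shift t x) n = \<pi> (f x) n"
      using N[rule_format, OF shift_in_X[OF x], of t] t by (simp add: shift_def)
    moreover have "\<pi> (shift t x0) n = \<pi> (f x0) n"
      using M[rule_format, OF shift_in_X[OF x0], of t] t by (simp add: shift_def)
    ultimately have "\<pi> (f x) n = (\<pi> x n + t mod L n) mod L n"
      "\<pi> (f x0) n = (\<pi> x0 n + t mod L n) mod L n"
      unfolding factor_map_shift[OF x] factor_map_shift[OF x0]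
      by (simp_all add: adic_add adic_of_int_def)
    then show "(\<pi> (f x) \<boxplus> \<pi> x0) n = (\<pi> (f x0) \<boxplus> \<pi> x) n"
      by (simp add: adic_add mod_simps algebra_simps)
  qed
  let ?w = "\<pi> (f x0) \<boxplus> zneg (\<pi> x0)"
  have in_Z: "\<pi> (f x0) \<in> Z" "\<pi> x0 \<in> Z" using factor_map_adic ellis_in_X[OF f] x0 by auto
  have "\<pi> (f x) = \<pi> x \<boxplus> ?w" if x: "x \<in> X" for x
  proof -
    have xZ: "\<pi> (f x) \<in> Z" "\<pi> x \<in> Z" using factor_map_adic ellis_in_X[OF f] x by auto
    have "\<pi> (f x) = \<pi> (f x) \<boxplus> \<pi> x0 \<boxplus> zneg (\<pi> x0)" using xZ in_Z by (simp add: adic.m_assoc)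
    also have "\<dots> = \<pi> x \<boxplus> ?w" unfolding eq[OF x] using xZ in_Z by (simp add: adic.m_ac)
    finally show ?thesis .
  qed
  moreover have "?w \<in> Z" using in_Z by simp
  ultimately show ?thesis by blast
qed

lemma ellis_cluster_adic:
  assumes w: "w \<in> Z" and t: "\<And>m n. m \<le> n \<Longrightarrow> t n mod L m = w m"
  shows "\<exists>f\<in>E. (\<forall>x\<in>X. \<pi> (f x) = \<pi> x \<boxplus> w) \<and>
    (\<forall>F N m. finite F \<longrightarrow> F \<subseteq> X \<longrightarrow> (\<exists>n\<ge>m. \<forall>x\<in>F. \<forall>k. \<bar>k\<bar> \<le> int N \<longrightarrow> f x k = x (k + t n)))"
proof -
  obtain f where f: "f \<in> E" and cl: "\<And>F N m. finite F \<Longrightarrow> F \<subseteq> X \<Longrightarrow>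
      (\<exists>n\<ge>m. \<forall>x\<in>F. \<forall>k. \<bar>k\<bar> \<le> int N \<longrightarrow> f x k = x (k + t n))"
    using ellis_cluster[of t] by blast
  have "\<pi> (f x) = \<pi> x \<boxplus> w" if x: "x \<in> X" for x
  proof
    fix n
    obtain N :: nat where N: "\<forall>y\<in>X. (\<forall>m. \<bar>m\<bar> \<le> int N \<longrightarrow> y m = f x m) \<longrightarrow> \<pi> y n = \<pi> (f x) n"
      using factor_map_locally_constant[OF ellis_in_X[OF f x]] by blast
    obtain p where p: "p \<ge> n" "\<forall>k. \<bar>k\<bar> \<le> int N \<longrightarrow> f x k = x (k + t p)"
      using cl[of "{x}" n N] x by auto
    have "\<pi> (shift (t p) x) n = \<pi> (f x) n"
      using N[rule_format, OF shift_in_X[OF x], of "t p"] p(2) by (simp add: shift_def)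
    then show "\<pi> (f x) n = (\<pi> x \<boxplus> w) n"
      unfolding factor_map_shift[OF x] using t[OF p(1)] by (simp add: adic_add adic_of_int_def)
  qed
  then show ?thesis using f cl by blast
qed

end

section \<open>Coordinates on the substitution space\<close>

context simplified_bijective begin

abbreviation orb where "orb \<equiv> adic_orbit l"
abbreviation orbits where "orbits \<equiv> adic_orbits l"
abbreviation orb0 where "orb0 \<equiv> zero_orbit l"

lemma orb_def': "orb z = range (\<lambda>k. z \<boxplus> emb k)"
  by (auto simp: adic_orbit_def)

lemma orb_shift: assumes "z \<in> Z" shows "orb (z \<boxplus> emb k) = orb z"
proof -
  have "z \<boxplus> emb k \<boxplus> emb j = z \<boxplus> emb (k + j)" for j
    using assms by (simp add: adic.m_assoc emb_adic emb_add)
  moreover have "z \<boxplus> emb j = z \<boxplus> emb (k + (j - k))" for j by simp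
  ultimately show ?thesis unfolding orb_def' by (metis (no_types, lifting) image_cong range_eqI subset_antisym image_subsetI)
qed

lemma orb_self: "z \<in> Z \<Longrightarrow> z \<in> orb z"
  unfolding orb_def' using emb_0 by (metis adic.r_one rangeI)

lemma orb_eqE: assumes "z \<in> Z" "w \<in> Z" "orb z = orb w" shows "\<exists>k. w = z \<boxplus> emb k"
  using orb_self[OF assms(2)] assms(3) unfolding orb_def' by auto

lemma orb_in_orbits [simp]: "z \<in> Z \<Longrightarrow> orb z \<in> orbits"
  by (simp add: adic_orbits_def)

lemma orbitsE: assumes "c \<in> orbits" shows "\<exists>z\<in>Z. orb z = c"
  using assms by (auto simp: adic_orbits_def)

lemma orb0_eq: "orb0 = orb zero"
  by (simp add: zero_orbit_def)

lemma orb0_in_orbits [simp]: "orb0 \<in> orbits"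
  by (simp add: orb0_eq)

lemma orb_emb: "orb (emb k) = orb0"
  using orb_shift[of zero k] by (simp add: orb0_eq emb_adic)

lemma orb_zero_iff: assumes "z \<in> Z" shows "orb z = orb0 \<longleftrightarrow> z \<in> range emb"
proof
  assume "orb z = orb0"
  then obtain k where "z = zero \<boxplus> emb k" using orb_eqE[of zero z] assms orb0_eq by auto
  then show "z \<in> range emb" by (simp add: emb_adic)
qed (auto simp: orb_emb)

text \<open>The representative \<^term>\<open>zero\<close> of the orbit of the integers keeps the coordinates of a point
  over that orbit readable from the letters of its fixed point.\<close>

definition rep :: "(nat \<Rightarrow> int) set \<Rightarrow> (nat \<Rightarrow> int)" where
  "rep c = (if c = orb0 then zero else SOME z. z \<in> Z \<and> orb z = c)"

text \<open>Well defined because the action of \<open>\<int>\<close> on the odometer is free.\<close>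

definition idx :: "(nat \<Rightarrow> int) \<Rightarrow> int" where
  "idx z = (THE k. z = rep (orb z) \<boxplus> emb k)"

lemma rep: assumes "c \<in> orbits" shows "rep c \<in> Z" "orb (rep c) = c"
proof -
  have "rep c \<in> Z \<and> orb (rep c) = c"
  proof (cases "c = orb0")
    case False
    have "\<exists>z. z \<in> Z \<and> orb z = c" using orbitsE[OF assms] by blast
    from someI_ex[OF this] show ?thesis using False by (simp add: rep_def)
  qed (simp add: rep_def orb0_eq)
  then show "rep c \<in> Z" "orb (rep c) = c" by blast+
qed

lemma rep_orb0: "rep orb0 = zero"
  by (simp add: rep_def)

lemma emb_cancel: assumes "z \<in> Z" "z \<boxplus> emb j = z \<boxplus> emb k" shows "j = k"
  using assms emb_adic emb_inj by simp

lemma idx: assumes "z \<in> Z" shows "z = rep (orb z) \<boxplus> emb (idx z)"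
proof -
  note r = rep[OF orb_in_orbits[OF assms]]
  obtain k where k: "z = rep (orb z) \<boxplus> emb k" using orb_eqE[OF r(1) assms r(2)] by blast
  show ?thesis unfolding idx_def
  proof (rule theI[of _ k])
    show "j = k" if "z = rep (orb z) \<boxplus> emb j" for j
      using emb_cancel[OF r(1), of j k] that k by simp
  qed (rule k)
qed

lemma idx_eqI: assumes "z \<in> Z" "z = rep (orb z) \<boxplus> emb k" shows "idx z = k"
  using emb_cancel[OF rep(1)[OF orb_in_orbits[OF assms(1)]], of "idx z" k] idx[OF assms(1)] assms(2) by simp

lemma idx_shift: assumes "z \<in> Z" shows "idx (z \<boxplus> emb k) = idx z + k"
proof (rule idx_eqI)
  show "z \<boxplus> emb k \<in> Z" using assms emb_adic by simp
  have "rep (orb z) \<in> Z" using rep(1) assms by simp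
  then have "rep (orb z) \<boxplus> emb (idx z + k) = rep (orb z) \<boxplus> emb (idx z) \<boxplus> emb k"
    by (simp add: emb_add emb_adic adic.m_assoc)
  then show "z \<boxplus> emb k = rep (orb (z \<boxplus> emb k)) \<boxplus> emb (idx z + k)"
    using idx[OF assms] by (simp add: orb_shift[OF assms])
qed

lemma idx_emb: "idx (emb k) = k"
  using emb_adic by (intro idx_eqI) (simp_all add: orb_emb rep_orb0)

lemma idx_zero: "idx zero = 0"
  using idx_emb[of 0] by (simp add: emb_0)

lemma idx_rep: "c \<in> orbits \<Longrightarrow> idx (rep c) = 0"
  using rep[of c] by (intro idx_eqI) (simp_all add: emb_0)

end

lemma (in simplified_bijective) ellis_translation_exists:
  assumes "w \<in> Z" shows "\<exists>f\<in>E. \<forall>x\<in>X. \<pi> (f x) = \<pi> x \<boxplus> w"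
proof -
  have "\<exists>f\<in>E. (\<forall>x\<in>X. \<pi> (f x) = \<pi> x \<boxplus> w) \<and> (\<forall>F N m. finite F \<longrightarrow> F \<subseteq> X \<longrightarrow>
      (\<exists>n\<ge>m. \<forall>x\<in>F. \<forall>k. \<bar>k\<bar> \<le> int N \<longrightarrow> f x k = x (k + w n)))"
    by (rule ellis_cluster_adic[OF assms]) (rule adic_coherent[OF assms])
  then show ?thesis by (elim bexE conjE) (rule bexI)
qed

locale simplified_bijective_base = simplified_bijective +
  fixes g0 :: "'a \<Rightarrow> 'a"
  assumes g0_in_I: "g0 \<in> I"
begin

lemma g0_in_G: "g0 \<in> carrier G"
  using g0_in_I by (rule struct_I_in_G)

text \<open>Over a regular orbit a point is determined by one letter, its coordinate. A point over the
  orbit of \<open>0\<close> has a letter on either side of the origin of its fixed point, hence one coordinate for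
  either direction.\<close>

definition coord :: "pm \<Rightarrow> (int \<Rightarrow> 'a) \<Rightarrow> 'a" where
  "coord s x = (if s = Minus \<and> orb (\<pi> x) = orb0 then g0 (x (- idx (\<pi> x) - 1)) else x (- idx (\<pi> x)))"

abbreviation is_point :: "('a \<Rightarrow> 'a) \<Rightarrow> (nat \<Rightarrow> int) \<Rightarrow> 'a \<Rightarrow> (int \<Rightarrow> 'a) \<Rightarrow> bool" where
  "is_point i z a x \<equiv> x \<in> X \<and> \<pi> x = z \<and> x (- idx z) = a \<and> (orb z = orb0 \<longrightarrow> x (- idx z - 1) = finv i a)"

text \<open>The point over \<open>z\<close> with a given coordinate. Over the orbit of \<open>0\<close> the coordinate is taken to be
  the letter to the right of the origin of the fixed point, and \<open>i\<close> supplies the letter to the left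
  of it.\<close>

definition point :: "('a \<Rightarrow> 'a) \<Rightarrow> (nat \<Rightarrow> int) \<Rightarrow> 'a \<Rightarrow> (int \<Rightarrow> 'a)" where
  "point i z a = (THE x. is_point i z a x)"

lemma is_point_unique:
  assumes "z \<in> Z" "is_point i z a x" "is_point i z a y"
  shows "x = y"
proof (cases "orb z = orb0")
  case True
  then obtain k where k: "z = emb k" using orb_zero_iff[OF assms(1)] by blast
  have idx: "idx z = k" by (simp add: k idx_emb)
  have pi: "\<pi> (shift (- k) u) = zero" if "u \<in> X" "\<pi> u = z" for u
    using that factor_map_shift[of u "- k"] k by (simp add: emb_0 flip: emb_add)
  have xy: "x \<in> X" "y \<in> X" "\<pi> x = z" "\<pi> y = z" "x (- k) = y (- k)" "x (- k - 1) = y (- k - 1)"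
    using assms(2,3) True unfolding idx by simp_all
  have "shift (- k) x 0 = shift (- k) y 0" "shift (- k) x (- 1) = shift (- k) y (- 1)"
  proof -
    have "- 1 + - k = - k - 1" by simp
    then show "shift (- k) x 0 = shift (- k) y 0" "shift (- k) x (- 1) = shift (- k) y (- 1)"
      using xy(5,6) by (simp_all only: shift_def add_0)
  qed
  then have "shift (- k) x = shift (- k) y"
    using xy(1-4) by (intro zero_fibre_unique shift_in_X pi)
  then have "shift k (shift (- k) x) = shift k (shift (- k) y)" by simp
  then show ?thesis by (simp add: shift_shift)
next
  case False
  then have "\<pi> x \<notin> range emb" using assms orb_zero_iff by simp
  then show ?thesis using assms regular_fibre_unique[of x y "- idx z"] by simp
qed

text \<open>Over a regular orbit such a point is the image of a point over \<open>0\<close> under an element of the Ellis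
  semigroup that displaces fibres by \<open>z\<close>. Near the origin this element agrees, on finitely many
  points, with one shift, which reads the letters to the right of the origin or those to the left of
  it; so it is applied to a family of points with all letters on both sides.\<close>

lemma is_point_exists:
  assumes i: "i \<in> I" and z: "z \<in> Z"
  shows "\<exists>x. is_point i z a x"
proof (cases "orb z = orb0")
  case True
  then obtain k where k: "z = emb k" using orb_zero_iff[OF z] by blast
  obtain y where y: "y \<in> X" "\<pi> y = zero" "y 0 = a" "y (- 1) = finv i a"
    using zero_fibre_point[OF i] by blast
  have "\<pi> (shift k y) = z" using factor_map_shift[OF y(1)] y(2) by (simp add: k emb_adic)
  moreover have "shift k y (- idx z) = a" "shift k y (- idx z - 1) = finv i a"
    using y(3,4) by (simp_all add: k idx_emb shift_def)
  ultimately show ?thesis using shift_in_X[OF y(1), of k] by blast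
next
  case False
  obtain f where f: "f \<in> E" "\<forall>x\<in>X. \<pi> (f x) = \<pi> x \<boxplus> z"
    using ellis_translation_exists[OF z] by (elim bexE) (rule that)
  have i_bij: "bij i" using i struct_I_in_G G_bij by blast
  have "\<forall>b. \<exists>x. x \<in> X \<and> \<pi> x = zero \<and> x 0 = b" using zero_fibre_point[OF i] by blast
  then obtain u where u: "\<And>b. u b \<in> X" "\<And>b. \<pi> (u b) = zero" "\<And>b. u b 0 = b" by metis
  have "\<exists>x. x \<in> X \<and> \<pi> x = zero \<and> x (- 1) = b" for b
    using zero_fibre_point[OF i, of "i b"] i_bij by (auto simp: bij_is_inj)
  then obtain v where v: "\<And>b. v b \<in> X" "\<And>b. \<pi> (v b) = zero" "\<And>b. v b (- 1) = b" by metis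
  let ?N = "nat \<bar>idx z\<bar>"
  have F: "finite (range u \<union> range v)" "range u \<union> range v \<subseteq> X" using u(1) v(1) by auto
  obtain t where t: "\<forall>x\<in>range u \<union> range v. \<forall>k. \<bar>k\<bar> \<le> int ?N \<longrightarrow> f x k = x (k + t)"
    using ellis_approx[OF f(1) F, of ?N] by blast
  let ?s = "- idx z + t"
  obtain n where n: "\<bar>?s\<bar> < L n" using L_gt[of "nat \<bar>?s\<bar>"] by fastforce
  have "\<exists>x\<in>range u \<union> range v. x ?s = a"
  proof (cases "0 \<le> ?s")
    case True
    then have bij: "bij (col n ?s)" using n by (intro col_bij) auto
    have "?s < L n" using n True by linarith
    then have "u (finv (col n ?s) a) ?s = col n ?s (finv (col n ?s) a)"
      using zero_fibre_values(1)[OF u(1,2) True] u(3) by metis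
    then show ?thesis using bij by (intro bexI[of _ "u (finv (col n ?s) a)"]) (simp_all add: bij_is_surj surj_f_inv_f)
  next
    case False
    let ?r = "?s + L n"
    have r: "0 \<le> ?r" "?r < L n" using n False by linarith+
    then have bij: "bij (col n ?r)" by (intro col_bij)
    have "v (finv (col n ?r) a) (?r - L n) = col n ?r (finv (col n ?r) a)"
      using zero_fibre_values(2)[OF v(1,2) r] v(3) by metis
    then show ?thesis using bij by (intro bexI[of _ "v (finv (col n ?r) a)"]) (simp_all add: bij_is_surj surj_f_inv_f)
  qed
  then obtain x where x: "x \<in> range u \<union> range v" "x ?s = a" by blast
  have xX: "x \<in> X" "\<pi> x = zero" using x(1) u(1,2) v(1,2) by auto
  have "f x (- idx z) = a" using t x by simp
  moreover have "\<pi> (f x) = z" using f(2) xX z by simp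
  ultimately show ?thesis using ellis_in_X[OF f(1) xX(1)] False by blast
qed

lemma point:
  assumes "i \<in> I" "z \<in> Z"
  shows "point i z a \<in> X" "\<pi> (point i z a) = z" "point i z a (- idx z) = a"
    "orb z = orb0 \<Longrightarrow> point i z a (- idx z - 1) = finv i a"
proof -
  obtain x where x: "is_point i z a x" using is_point_exists[OF assms] by blast
  have "is_point i z a (point i z a)"
    unfolding point_def
    by (rule theI[of "is_point i z a" x, OF x]) (use is_point_unique[OF assms(2)] x in blast)
  then show "point i z a \<in> X" "\<pi> (point i z a) = z" "point i z a (- idx z) = a"
    "orb z = orb0 \<Longrightarrow> point i z a (- idx z - 1) = finv i a" by blast+
qed

lemma point_eqI:
  assumes "i \<in> I" "x \<in> X" "\<pi> x = z" "x (- idx z) = a" "orb z = orb0 \<Longrightarrow> x (- idx z - 1) = finv i a"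
  shows "x = point i z a"
proof -
  have z: "z \<in> Z" using factor_map_adic assms(2,3) by blast
  show ?thesis
    by (rule is_point_unique[OF z, where i = i and a = a]) (use assms point[OF assms(1) z] in simp_all)
qed

lemma coord_shift: assumes "x \<in> X" shows "coord s (shift k x) = coord s x"
  using factor_map_adic[OF assms]
  by (simp add: coord_def factor_map_shift[OF assms] idx_shift orb_shift) (simp add: shift_def)

lemma point_shift:
  assumes "i \<in> I" "z \<in> Z"
  shows "shift k (point i z a) = point i (z \<boxplus> emb k) a"
proof (rule point_eqI[OF assms(1)])
  note p = point[OF assms, of a]
  show "shift k (point i z a) \<in> X" using p(1) by (rule shift_in_X)
  show "\<pi> (shift k (point i z a)) = z \<boxplus> emb k" using factor_map_shift[OF p(1)] p(2) by simp
  show "shift k (point i z a) (- idx (z \<boxplus> emb k)) = a"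
    using p(3) by (simp add: idx_shift[OF assms(2)] shift_def)
  assume "orb (z \<boxplus> emb k) = orb0"
  then have "orb z = orb0" by (simp add: orb_shift[OF assms(2)])
  then show "shift k (point i z a) (- idx (z \<boxplus> emb k) - 1) = finv i a"
    using p(4) by (simp add: idx_shift[OF assms(2)] shift_def)
qed

abbreviation sand where "sand s i \<equiv> sandwich \<theta> l g0 s i"
abbreviation At where "At g \<equiv> at_zero_orbit \<theta> l g"

lemma sand_simps: "i \<in> I \<Longrightarrow> sand Minus i = g0 \<circ> finv i" "sand Plus i = id"
  by (simp_all add: struct_I_in_G g0_in_G G_inv_closed)

lemma sand_in_G: "i \<in> I \<Longrightarrow> sand s i \<in> carrier G"
  using G_comp[OF g0_in_G G_inv_closed[OF struct_I_in_G]] G_id by (cases s) (simp_all only: sand_simps)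

lemma At_apply: "c \<in> orbits \<Longrightarrow> At g c = (if c = orb0 then g else id)"
  by (simp add: at_zero_orbit_def)

lemma At_in_G: "g \<in> carrier G \<Longrightarrow> c \<in> orbits \<Longrightarrow> At g c \<in> carrier G"
  using G_id by (simp add: At_apply)

text \<open>The value read on side \<open>s\<close> after \<open>a\<close> has been written with left neighbour \<open>i^{-1} a\<close>. The factor
  \<^term>\<open>g0\<close> in the left coordinate produces the normalized sandwich matrix.\<close>

lemma coord_point:
  assumes "i \<in> I" "z \<in> Z"
  shows "coord s (point i z a) = At (sand s i) (orb z) a"
proof -
  note p = point[OF assms, of a]
  show ?thesis
    using assms p sand_simps(1)[OF assms(1)] sand_simps(2)
    by (cases s) (auto simp: coord_def At_apply simp del: sandwich.simps)
qed

lemma coord_surj: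
  assumes "z \<in> Z"
  shows "\<exists>x\<in>X. \<pi> x = z \<and> coord s x = a"
proof -
  let ?g = "At (sand s g0) (orb z)"
  have "bij ?g" using At_in_G[OF sand_in_G[OF g0_in_I]] assms G_bij by simp
  then have "coord s (point g0 z (finv ?g a)) = a"
    by (simp add: coord_point[OF g0_in_I assms] bij_is_surj surj_f_inv_f)
  then show ?thesis using point(1,2)[OF g0_in_I assms] by blast
qed

lemma coord_Plus: "coord Plus x = x (- idx (\<pi> x))"
  by (simp add: coord_def)

lemma coord_Minus_zero: "\<pi> x = zero \<Longrightarrow> coord Minus x = g0 (x (- 1))"
  by (simp add: coord_def orb0_eq idx_zero)

text \<open>This tells the two sides apart, and it separates the maps that read one coordinate from the
  shifts.\<close>

lemma coords_independent:
  assumes "bij \<rho>" "z \<in> Z" "orb z = orb0"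
  shows "\<exists>x\<in>X. \<pi> x = z \<and> coord Minus x \<noteq> \<rho> (coord Plus x)"
proof -
  obtain k where k: "z = emb k" using orb_zero_iff[OF assms(2)] assms(3) by blast
  have g0: "bij g0" using g0_in_G by (rule G_bij)
  obtain x where x: "x \<in> X" "\<pi> x = zero" "x (- 1) \<noteq> (finv g0 \<circ> \<rho>) (x 0)"
    using zero_fibre_not_permutation[OF bij_comp[OF assms(1) bij_imp_bij_inv[OF g0]]] by blast
  have "g0 (x (- 1)) \<noteq> \<rho> (x 0)"
  proof
    assume "g0 (x (- 1)) = \<rho> (x 0)"
    then have "finv g0 (\<rho> (x 0)) = x (- 1)" using g0 by (metis bij_is_inj inv_f_f)
    then show False using x(3) by simp
  qed
  then have "coord Minus (shift k x) \<noteq> \<rho> (coord Plus (shift k x))"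
    unfolding coord_shift[OF x(1)] using coord_Minus_zero[OF x(2)] x(2)
    by (simp add: coord_Plus idx_zero)
  moreover have "\<pi> (shift k x) = z" using factor_map_shift[OF x(1)] x(2) by (simp add: k emb_adic)
  ultimately show ?thesis using shift_in_X[OF x(1), of k] by blast
qed

end

section \<open>Elements of the Ellis semigroup in coordinates\<close>

context simplified_bijective_base begin

abbreviation Gfib where "Gfib \<equiv> power_group \<theta> l orbits"

lemma Gfib_carrier: "carrier Gfib = (\<Pi>\<^sub>E c\<in>orbits. carrier G)"
  by (simp add: power_group_def)

lemma Gfib_apply: "\<psi> \<in> carrier Gfib \<Longrightarrow> c \<in> orbits \<Longrightarrow> \<psi> c \<in> carrier G"
  by (auto simp: Gfib_carrier)

lemma Gfib_mult: "a \<in> carrier Gfib \<Longrightarrow> b \<in> carrier Gfib \<Longrightarrow> c \<in> orbits \<Longrightarrow> (a \<otimes>\<^bsub>Gfib\<^esub> b) c = a c \<circ> b c"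
  using Gfib_apply[of a c] Gfib_apply[of b c] by (simp add: power_group_def)

lemma Gfib_group: "group Gfib"
  unfolding power_group_def by (intro product_group) (rule G_group)

sublocale Gfib: group Gfib by (rule Gfib_group)

lemma Gfib_one: "c \<in> orbits \<Longrightarrow> \<one>\<^bsub>Gfib\<^esub> c = id"
  by (simp add: power_group_def)

lemma Gfib_eqI:
  "a \<in> carrier Gfib \<Longrightarrow> b \<in> carrier Gfib \<Longrightarrow> (\<And>c. c \<in> orbits \<Longrightarrow> a c = b c) \<Longrightarrow> a = b"
  unfolding Gfib_carrier by (rule PiE_ext)

lemma At_Gfib: "g \<in> carrier G \<Longrightarrow> At g \<in> carrier Gfib"
  using G_id by (auto simp: Gfib_carrier at_zero_orbit_def)

definition tr :: "(nat \<Rightarrow> int) \<Rightarrow> (nat \<Rightarrow> int) set \<Rightarrow> (nat \<Rightarrow> int) set" where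
  "tr v c = (\<lambda>z. z \<boxplus> v) ` c"

lemma tr_orb: assumes "z \<in> Z" "v \<in> Z" shows "tr v (orb z) = orb (z \<boxplus> v)"
proof -
  have "z \<boxplus> emb k \<boxplus> v = z \<boxplus> v \<boxplus> emb k" for k
    using assms emb_adic by (simp add: adic.m_ac)
  then show ?thesis unfolding tr_def orb_def' by (simp add: image_image)
qed

lemma tr_orbits: assumes "c \<in> orbits" "v \<in> Z" shows "tr v c \<in> orbits"
proof -
  obtain z where "z \<in> Z" "orb z = c" using orbitsE[OF assms(1)] by blast
  then show ?thesis using tr_orb[of z v] assms(2) by auto
qed

lemma tr_tr: assumes "c \<in> orbits" "v \<in> Z" "u \<in> Z" shows "tr u (tr v c) = tr (v \<boxplus> u) c"
proof -
  obtain z where "z \<in> Z" "orb z = c" using orbitsE[OF assms(1)] by blast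
  then show ?thesis using assms by (auto simp: tr_orb adic.m_assoc)
qed

lemma tr_zero: assumes "c \<in> orbits" shows "tr zero c = c"
proof -
  obtain z where "z \<in> Z" "orb z = c" using orbitsE[OF assms(1)] by blast
  then show ?thesis using tr_orb[of z zero] by simp
qed

text \<open>The action of the odometer on functions of its orbits, by translation of the argument.\<close>

definition rot :: "(nat \<Rightarrow> int) \<Rightarrow> ((nat \<Rightarrow> int) set \<Rightarrow> 'a \<Rightarrow> 'a) \<Rightarrow> (nat \<Rightarrow> int) set \<Rightarrow> 'a \<Rightarrow> 'a" where
  "rot w = (\<lambda>\<psi>\<in>carrier Gfib. \<lambda>c\<in>orbits. \<psi> (tr (zneg w) c))"

lemma rot_apply: "\<psi> \<in> carrier Gfib \<Longrightarrow> c \<in> orbits \<Longrightarrow> rot w \<psi> c = \<psi> (tr (zneg w) c)"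
  by (simp add: rot_def)

lemma rot_orb:
  assumes "\<psi> \<in> carrier Gfib" "w \<in> Z" "z \<in> Z"
  shows "rot w \<psi> (orb (z \<boxplus> w)) = \<psi> (orb z)"
  using assms by (simp add: rot_apply tr_orb adic.m_assoc)

lemma rot_closed: "w \<in> Z \<Longrightarrow> \<psi> \<in> carrier Gfib \<Longrightarrow> rot w \<psi> \<in> carrier Gfib"
  using tr_orbits[of _ "zneg w"] by (auto simp: rot_def Gfib_carrier PiE_iff)

lemma rot_mult:
  assumes "w \<in> Z" "a \<in> carrier Gfib" "b \<in> carrier Gfib"
  shows "rot w (a \<otimes>\<^bsub>Gfib\<^esub> b) = rot w a \<otimes>\<^bsub>Gfib\<^esub> rot w b"
proof (rule Gfib_eqI)
  fix c assume c: "c \<in> orbits"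
  then have "tr (zneg w) c \<in> orbits" using assms(1) tr_orbits by simp
  then show "rot w (a \<otimes>\<^bsub>Gfib\<^esub> b) c = (rot w a \<otimes>\<^bsub>Gfib\<^esub> rot w b) c"
    using assms c by (simp add: rot_apply Gfib_mult rot_closed comp_def)
qed (use assms rot_closed in simp_all)

lemma rot_rot:
  assumes "w \<in> Z" "v \<in> Z" "\<psi> \<in> carrier Gfib"
  shows "rot w (rot v \<psi>) = rot (w \<boxplus> v) \<psi>"
proof (rule Gfib_eqI)
  fix c assume c: "c \<in> orbits"
  then have "tr (zneg w) c \<in> orbits" using assms(1) tr_orbits by simp
  then show "rot w (rot v \<psi>) c = rot (w \<boxplus> v) \<psi> c"
    using assms c by (simp add: rot_apply rot_closed tr_tr adic.inv_mult)
qed (use assms rot_closed in simp_all)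

lemma rot_zero: assumes "\<psi> \<in> carrier Gfib" shows "rot zero \<psi> = \<psi>"
  by (rule Gfib_eqI) (use assms rot_closed in \<open>simp_all add: rot_apply tr_zero\<close>)

lemma rot_hom: "rot \<in> hom (adic_group l) (AutoGroup Gfib)"
proof (rule homI)
  have rot_Bij: "rot w \<in> Bij (carrier Gfib)" if w: "w \<in> Z" for w
  proof -
    have "bij_betw (rot w) (carrier Gfib) (carrier Gfib)"
      by (rule bij_betw_byWitness[where f' = "rot (zneg w)"])
        (use w rot_closed in \<open>auto simp: rot_rot rot_zero\<close>)
    then show ?thesis by (simp add: Bij_def rot_def)
  qed
  show "rot w \<in> carrier (AutoGroup Gfib)" if w: "w \<in> Z" for w
    using rot_Bij[OF w] w rot_closed rot_mult by (auto simp: AutoGroup_def auto_def hom_def)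
  show "rot (w \<boxplus> v) = rot w \<otimes>\<^bsub>AutoGroup Gfib\<^esub> rot v" if w: "w \<in> Z" and v: "v \<in> Z" for w v
  proof -
    have "rot (w \<boxplus> v) = compose (carrier Gfib) (rot w) (rot v)"
    proof (rule ext)
      fix \<psi>
      show "rot (w \<boxplus> v) \<psi> = compose (carrier Gfib) (rot w) (rot v) \<psi>"
        using rot_rot[OF w v, of \<psi>]
        by (cases "\<psi> \<in> carrier Gfib") (simp_all add: compose_def, simp add: rot_def)
    qed
    then show ?thesis using rot_Bij w v by (simp add: AutoGroup_def BijGroup_def)
  qed
qed

text \<open>Read a coordinate, act on it by the value of \<open>\<psi>\<close>, and write it at the displaced fibre. That
  \<open>\<psi>\<close> is evaluated at the target orbit, and not at the source, makes composition the product of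
  the semidirect product.\<close>

definition Psi :: "('a \<Rightarrow> 'a) \<Rightarrow> ((nat \<Rightarrow> int) set \<Rightarrow> 'a \<Rightarrow> 'a) \<Rightarrow> (nat \<Rightarrow> int) \<Rightarrow> pm \<Rightarrow> (int \<Rightarrow> 'a) \<Rightarrow> int \<Rightarrow> 'a" where
  "Psi i \<psi> w s = (\<lambda>x\<in>X. point i (\<pi> x \<boxplus> w) (\<psi> (orb (\<pi> x \<boxplus> w)) (coord s x)))"

lemma Psi_apply: "x \<in> X \<Longrightarrow> Psi i \<psi> w s x = point i (\<pi> x \<boxplus> w) (\<psi> (orb (\<pi> x \<boxplus> w)) (coord s x))"
  by (simp add: Psi_def)

lemma Psi_point:
  assumes "i \<in> I" "w \<in> Z" "x \<in> X"
  shows "Psi i \<psi> w s x \<in> X" "\<pi> (Psi i \<psi> w s x) = \<pi> x \<boxplus> w"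
    "coord t (Psi i \<psi> w s x) = At (sand t i) (orb (\<pi> x \<boxplus> w)) (\<psi> (orb (\<pi> x \<boxplus> w)) (coord s x))"
proof -
  have z: "\<pi> x \<boxplus> w \<in> Z" using assms factor_map_adic by simp
  show "Psi i \<psi> w s x \<in> X" "\<pi> (Psi i \<psi> w s x) = \<pi> x \<boxplus> w"
    "coord t (Psi i \<psi> w s x) = At (sand t i) (orb (\<pi> x \<boxplus> w)) (\<psi> (orb (\<pi> x \<boxplus> w)) (coord s x))"
    unfolding Psi_apply[OF assms(3)] using point[OF assms(1) z] coord_point[OF assms(1) z] by blast+
qed

lemma coord_Plus_Psi:
  assumes "i \<in> I" "w \<in> Z" "x \<in> X"
  shows "coord Plus (Psi i \<psi> w s x) = \<psi> (orb (\<pi> x \<boxplus> w)) (coord s x)"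
proof -
  have "\<pi> x \<boxplus> w \<in> Z" using assms factor_map_adic by simp
  then show ?thesis
    using Psi_point(3)[OF assms] by (simp add: At_apply sand_simps(2) del: sandwich.simps)
qed

lemma Psi_PiE: "i \<in> I \<Longrightarrow> w \<in> Z \<Longrightarrow> Psi i \<psi> w s \<in> X \<rightarrow>\<^sub>E X"
  using Psi_point(1) by (auto simp: Psi_def)

text \<open>The outer map reads, on its own side \<open>s\<close>, what the inner one has written with \<open>j\<close>; by
  \<open>coord_point\<close> this inserts the sandwich entry over the orbit of \<open>0\<close>, and nothing elsewhere.\<close>

lemma Psi_mult:
  assumes i: "i \<in> I" and j: "j \<in> I" and w: "w \<in> Z" "v \<in> Z"
    and psi: "\<psi> \<in> carrier Gfib" "\<xi> \<in> carrier Gfib"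
  shows "compose X (Psi i \<psi> w s) (Psi j \<xi> v t)
    = Psi i (\<psi> \<otimes>\<^bsub>Gfib\<^esub> rot w (At (sand s j)) \<otimes>\<^bsub>Gfib\<^esub> rot w \<xi>) (w \<boxplus> v) t"
proof
  fix x
  let ?A = "At (sand s j)"
  show "compose X (Psi i \<psi> w s) (Psi j \<xi> v t) x
    = Psi i (\<psi> \<otimes>\<^bsub>Gfib\<^esub> rot w ?A \<otimes>\<^bsub>Gfib\<^esub> rot w \<xi>) (w \<boxplus> v) t x"
  proof (cases "x \<in> X")
    case True
    let ?z = "\<pi> x \<boxplus> v"
    have x: "\<pi> x \<in> Z" and z: "?z \<in> Z" using True w factor_map_adic by simp_all
    have zw: "?z \<boxplus> w = \<pi> x \<boxplus> (w \<boxplus> v)" using x w by (simp add: adic.m_ac)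
    have A: "?A \<in> carrier Gfib" using At_Gfib sand_in_G[OF j] .
    have "orb (?z \<boxplus> w) \<in> orbits" using z w by simp
    then have eq: "(\<psi> \<otimes>\<^bsub>Gfib\<^esub> rot w ?A \<otimes>\<^bsub>Gfib\<^esub> rot w \<xi>) (orb (?z \<boxplus> w))
        = \<psi> (orb (?z \<boxplus> w)) \<circ> ?A (orb ?z) \<circ> \<xi> (orb ?z)"
      using psi A w z rot_closed by (simp only: Gfib_mult rot_orb Gfib.m_closed)
    have "compose X (Psi i \<psi> w s) (Psi j \<xi> v t) x
        = point i (?z \<boxplus> w) (\<psi> (orb (?z \<boxplus> w)) (?A (orb ?z) (\<xi> (orb ?z) (coord t x))))"
      using True Psi_point(1,2)[OF j w(2) True, of \<xi> t] Psi_point(3)[OF j w(2) True, where t = s and \<psi> = \<xi> and s = t] by (simp add: compose_def Psi_apply)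
    also have "\<dots> = Psi i (\<psi> \<otimes>\<^bsub>Gfib\<^esub> rot w ?A \<otimes>\<^bsub>Gfib\<^esub> rot w \<xi>) (w \<boxplus> v) t x"
      unfolding Psi_apply[OF True] zw[symmetric] eq by simp
    finally show ?thesis .
  qed (simp add: compose_def Psi_def)
qed

lemma Psi_sides_differ:
  assumes "i \<in> I" "j \<in> I" "w \<in> Z" "\<psi> \<in> carrier Gfib" "\<xi> \<in> carrier Gfib"
  shows "Psi i \<psi> w Plus \<noteq> Psi j \<xi> w Minus"
proof
  assume eq: "Psi i \<psi> w Plus = Psi j \<xi> w Minus"
  let ?c = "orb w"
  have c: "?c \<in> orbits" using assms(3) by simp
  have bij: "bij (\<psi> ?c)" "bij (\<xi> ?c)" using Gfib_apply[OF _ c] assms(4,5) G_bij by auto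
  have "coord Minus x = (finv (\<xi> ?c) \<circ> \<psi> ?c) (coord Plus x)" if x: "x \<in> X" "\<pi> x = zero" for x
  proof -
    have "\<psi> ?c (coord Plus x) = \<xi> ?c (coord Minus x)"
      using coord_Plus_Psi[OF assms(1,3) x(1), of \<psi> Plus] coord_Plus_Psi[OF assms(2,3) x(1), of \<xi> Minus]
      unfolding eq x(2) using assms(3) by simp
    then show ?thesis using bij(2) by (simp add: bij_is_inj)
  qed
  moreover have "bij (finv (\<xi> ?c) \<circ> \<psi> ?c)" using bij_comp[OF bij(1) bij_imp_bij_inv[OF bij(2)]] .
  moreover have "orb zero = orb0" by (simp add: orb0_eq)
  ultimately show False using coords_independent[of "finv (\<xi> ?c) \<circ> \<psi> ?c" zero] by auto
qed

lemma Psi_inj: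
  assumes i: "i \<in> I" "j \<in> I" and w: "w \<in> Z" "v \<in> Z" and psi: "\<psi> \<in> carrier Gfib" "\<xi> \<in> carrier Gfib"
    and eq: "Psi i \<psi> w s = Psi j \<xi> v t"
  shows "i = j \<and> \<psi> = \<xi> \<and> w = v \<and> s = t"
proof -
  obtain x0 where x0: "x0 \<in> X" using X_nonempty by blast
  have "\<pi> x0 \<boxplus> w = \<pi> x0 \<boxplus> v"
    using Psi_point(2)[OF i(1) w(1) x0, of \<psi> s] Psi_point(2)[OF i(2) w(2) x0, of \<xi> t] eq by simp
  then have wv: "w = v" using w factor_map_adic[OF x0] by simp
  have st: "s = t"
    using Psi_sides_differ[OF i w(1) psi] Psi_sides_differ[OF i(2,1) w(1) psi(2,1)] eq wv
    by (cases s; cases t) auto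
  have val: "\<psi> (orb (z \<boxplus> w)) a = \<xi> (orb (z \<boxplus> w)) a" if z: "z \<in> Z" for z a
  proof -
    obtain x where x: "x \<in> X" "\<pi> x = z" "coord s x = a" using coord_surj[OF z] by blast
    show ?thesis
      using coord_Plus_Psi[OF i(1) w(1) x(1), of \<psi> s] coord_Plus_Psi[OF i(2) w(2) x(1), of \<xi> t] eq x wv st
      by simp
  qed
  have "\<psi> = \<xi>"
  proof (rule Gfib_eqI[OF psi])
    fix c assume c: "c \<in> orbits"
    have "rep c \<boxplus> zneg w \<in> Z" "rep c \<boxplus> zneg w \<boxplus> w = rep c"
      using rep(1)[OF c] w by (simp_all add: adic.m_assoc)
    then show "\<psi> c = \<xi> c" using val[of "rep c \<boxplus> zneg w"] rep(2)[OF c] by auto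
  qed
  moreover have "i = j"
  proof -
    have same: "Psi i \<psi> w s = Psi j \<psi> w s" using eq wv st \<open>\<psi> = \<xi>\<close> by simp
    have bij: "bij i" "bij j" "bij (\<psi> orb0)"
      using i struct_I_in_G G_bij Gfib_apply[OF psi(1) orb0_in_orbits] by auto
    have "finv i a = finv j a" for a
    proof -
      obtain x where x: "x \<in> X" "\<pi> x = zneg w" "coord s x = finv (\<psi> orb0) a"
        using coord_surj[of "zneg w"] w by auto
      have "\<pi> x \<boxplus> w = zero" using x(2) w by simp
      then have "point i zero (\<psi> orb0 (coord s x)) = point j zero (\<psi> orb0 (coord s x))"
        using fun_cong[OF same, of x] unfolding Psi_apply[OF x(1)] by (simp add: orb0_eq)
      moreover have "\<psi> orb0 (coord s x) = a" using x(3) bij(3) by (simp add: bij_is_surj surj_f_inv_f)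
      ultimately show ?thesis
        using point(4)[OF i(1), of zero a] point(4)[OF i(2), of zero a] by (simp add: orb0_eq)
    qed
    then have "finv i = finv j" by blast
    then show ?thesis using bij by (metis inv_inv_eq)
  qed
  ultimately show ?thesis using wv st by blast
qed

text \<open>A shift keeps both coordinates over the orbit of \<open>0\<close>, whereas after \<open>Psi\<close> each of them is a
  permutation of the one coordinate that was read.\<close>

lemma Psi_not_shift:
  assumes i: "i \<in> I" and w: "w \<in> Z" and psi: "\<psi> \<in> carrier Gfib"
  shows "Psi i \<psi> w s \<notin> shift_maps \<theta>"
proof
  assume "Psi i \<psi> w s \<in> shift_maps \<theta>"
  then obtain k where k: "Psi i \<psi> w s = restrict (shift k) X" unfolding shift_maps_def by blast
  have sh: "Psi i \<psi> w s x = shift k x" if "x \<in> X" for x using that k by simp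
  obtain x0 where x0: "x0 \<in> X" using X_nonempty by blast
  have "\<pi> x0 \<boxplus> w = \<pi> x0 \<boxplus> emb k"
    using Psi_point(2)[OF i w x0, of \<psi> s] sh[OF x0] factor_map_shift[OF x0] by simp
  then have wk: "w = emb k" using w emb_adic factor_map_adic[OF x0] by simp
  let ?p = "\<psi> orb0" and ?q = "sand Minus i \<circ> \<psi> orb0"
  have bij: "bij ?p" "bij ?q"
    using G_bij Gfib_apply[OF psi orb0_in_orbits] sand_in_G[OF i] bij_comp by blast+
  have c: "coord Plus x = ?p (coord s x)" "coord Minus x = ?q (coord s x)"
    if x: "x \<in> X" "\<pi> x = zero" for x
  proof -
    have o: "orb (\<pi> x \<boxplus> w) = orb0" using x w wk by (simp add: orb_emb)
    show "coord Plus x = ?p (coord s x)"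
      using coord_Plus_Psi[OF i w x(1), of \<psi> s] unfolding o sh[OF x(1)] coord_shift[OF x(1)] .
    show "coord Minus x = ?q (coord s x)"
      using Psi_point(3)[OF i w x(1), where t = Minus and \<psi> = \<psi> and s = s]
      unfolding o sh[OF x(1)] coord_shift[OF x(1)] At_apply[OF orb0_in_orbits] by (simp del: sandwich.simps)
  qed
  have "\<exists>\<rho>. bij \<rho> \<and> (\<forall>x\<in>X. \<pi> x = zero \<longrightarrow> coord Minus x = \<rho> (coord Plus x))"
  proof (cases s)
    case Plus
    then show ?thesis using bij(2) c(2) by (intro exI[of _ ?q]) simp
  next
    case Minus
    then have "coord Minus x = finv ?p (coord Plus x)" if "x \<in> X" "\<pi> x = zero" for x
      using c(1)[OF that] bij(1) by (simp add: bij_is_inj)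
    then show ?thesis using bij_imp_bij_inv[OF bij(1)] by (intro exI[of _ "finv ?p"]) simp
  qed
  moreover have "orb zero = orb0" by (simp add: orb0_eq)
  ultimately show False using coords_independent[of _ zero] by auto
qed

lemma finite_rep_fibre: assumes "d \<in> orbits" shows "finite {x \<in> X. \<pi> x = rep d}"
proof -
  have "inj_on (\<lambda>x. (x 0, x (- 1))) {x \<in> X. \<pi> x = rep d}"
  proof (rule inj_onI)
    fix x y assume xy: "x \<in> {x \<in> X. \<pi> x = rep d}" "y \<in> {x \<in> X. \<pi> x = rep d}" "(x 0, x (- 1)) = (y 0, y (- 1))"
    show "x = y"
    proof (cases "d = orb0")
      case True
      then show ?thesis using xy zero_fibre_unique[of x y] by (simp add: rep_orb0)
    next
      case False
      then have "rep d \<notin> range emb" using orb_zero_iff rep[OF assms] by metis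
      then show ?thesis using xy regular_fibre_unique[of x y 0] by simp
    qed
  qed
  then show ?thesis by (rule inj_on_finite[of _ _ UNIV]) auto
qed

text \<open>Away from the origin, the letters of the points of one fibre are obtained from one coordinate
  by a single element of the structure group, and two adjacent ones differ by an element of
  \<^term>\<open>I\<close>. At the origin of the fixed points they do not depend on one coordinate only.\<close>

lemma letters_from_coord:
  assumes d: "d \<in> orbits" and m: "m \<noteq> 0"
  shows "\<exists>i\<in>I. \<exists>g\<in>carrier G. \<exists>s. \<forall>x\<in>X. \<pi> x = rep d \<longrightarrow>
    x m = g (coord s x) \<and> x (m - 1) = finv i (x m)"
proof -
  have step: "col n j \<circ> finv (col n (j - 1)) \<in> I" "bij (col n j)" "bij (col n (j - 1))"
    "col n j \<in> carrier G" "col n (j - 1) b = finv (col n j \<circ> finv (col n (j - 1))) (col n j b)"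
    if "1 \<le> j" "j < L n" for n j b
  proof -
    show "col n j \<circ> finv (col n (j - 1)) \<in> I" unfolding struct_I_iff using that by blast
    show bij: "bij (col n j)" "bij (col n (j - 1))" using that col_bij by auto
    show "col n j \<in> carrier G" using that col_in_G by auto
    show "col n (j - 1) b = finv (col n j \<circ> finv (col n (j - 1))) (col n j b)"
      unfolding inv_comp_inv[OF bij] using bij by (simp add: bij_is_inj)
  qed
  show ?thesis
  proof (cases "d = orb0")
    case True
    have rep: "rep d = zero" by (simp add: True rep_orb0)
    let ?n = "nat \<bar>m\<bar>"
    have n: "\<bar>m\<bar> < L ?n" using L_gt[of ?n] by simp
    show ?thesis
    proof (cases "0 < m")
      case pos: True
      then have m1: "1 \<le> m" "m < L ?n" using n by linarith+
      have "x m = col ?n m (coord Plus x) \<and>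
          x (m - 1) = finv (col ?n m \<circ> finv (col ?n (m - 1))) (x m)" if x: "x \<in> X" "\<pi> x = rep d" for x
      proof -
        have 0: "coord Plus x = x 0" using x(2) by (simp add: coord_Plus rep idx_zero)
        have pi: "\<pi> x = zero" using x(2) rep by simp
        have v: "x m = col ?n m (x 0)" using zero_fibre_values(1)[OF x(1) pi, of m] m1 by simp
        have "x (m - 1) = col ?n (m - 1) (x 0)"
          using zero_fibre_values(1)[OF x(1) pi, of "m - 1"] m1 by simp
        then show ?thesis using v 0 step(5)[OF m1, of "x 0"] by simp
      qed
      then show ?thesis using step(1,4)[OF m1] by blast
    next
      case False
      let ?r = "m + L ?n"
      have r: "1 \<le> ?r" "?r < L ?n" using n m False by linarith+
      have g0: "bij g0" using g0_in_G by (rule G_bij)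
      have "x m = (col ?n ?r \<circ> finv g0) (coord Minus x) \<and>
          x (m - 1) = finv (col ?n ?r \<circ> finv (col ?n (?r - 1))) (x m)" if x: "x \<in> X" "\<pi> x = rep d" for x
      proof -
        have pi: "\<pi> x = zero" using x(2) rep by simp
        have 0: "finv g0 (coord Minus x) = x (- 1)"
          using coord_Minus_zero[OF pi] g0 by (simp add: bij_is_inj)
        have v: "x m = col ?n ?r (x (- 1))" using zero_fibre_values(2)[OF x(1) pi, of ?r ?n] r by simp
        have "m - 1 = ?r - 1 - L ?n" by simp
        then have "x (m - 1) = col ?n (?r - 1) (x (- 1))"
          using zero_fibre_values(2)[OF x(1) pi, of "?r - 1" ?n] r by simp
        then show ?thesis using v 0 step(5)[OF r, of "x (- 1)"] by simp
      qed
      moreover have "col ?n ?r \<circ> finv g0 \<in> carrier G"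
        using step(4)[OF r] G_inv_closed[OF g0_in_G] by (rule G_comp)
      ultimately show ?thesis using step(1)[OF r] by blast
    qed
  next
    case False
    let ?z = "rep d"
    have z: "?z \<in> Z" "?z \<notin> range emb" using orb_zero_iff rep[OF d] False by metis+
    obtain n0 where n0: "\<forall>n\<ge>n0. 0 \<le> ?z n + m \<and> ?z n + m < L n" using adic_window[OF z] by blast
    obtain n1 where n1: "\<forall>n\<ge>n1. 0 \<le> ?z n + (m - 1) \<and> ?z n + (m - 1) < L n" using adic_window[OF z] by blast
    define n where "n = max n0 n1"
    have 1: "0 \<le> ?z n + m" "?z n + m < L n" "0 \<le> ?z n + (m - 1)" "?z n + (m - 1) < L n"
      using n0 n1 by (auto simp: n_def)
    have 0: "0 \<le> ?z n" "?z n < L n" using z(1) by (auto simp: adic_iff)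
    define r where "r = ?z n + m"
    have r: "1 \<le> r" "r < L n" using 1 by (auto simp: r_def)
    have "x m = (col n r \<circ> finv (col n (?z n))) (coord Plus x) \<and>
        x (m - 1) = finv (col n r \<circ> finv (col n (r - 1))) (x m)" if x: "x \<in> X" "\<pi> x = rep d" for x
    proof -
      have c: "coord Plus x = x 0" using x(2) by (simp add: coord_Plus idx_rep[OF d])
      have v: "x m = col n r (finv (col n (?z n)) (x 0))"
        using block_values[OF x(1), of n 0 m] x(2) 0 1 by (simp add: r_def)
      have "x (m - 1) = col n (r - 1) (finv (col n (?z n)) (x 0))"
        using block_values[OF x(1), of n 0 "m - 1"] x(2) 0 1 by (simp add: r_def algebra_simps)
      then show ?thesis using v c step(5)[OF r, of "finv (col n (?z n)) (x 0)"] by simp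
    qed
    moreover have "col n r \<circ> finv (col n (?z n)) \<in> carrier G"
      using step(4)[OF r] G_inv_closed[OF col_in_G[OF 0]] by (rule G_comp)
    ultimately show ?thesis using step(1)[OF r] by blast
  qed
qed

text \<open>Since the map is not a shift, it differs at some point \<open>x1\<close> from the shift that would read the
  letters at the origin of the fixed points. Approximating the map at \<open>x1\<close> too excludes that shift,
  and \<open>letters_from_coord\<close> applies.\<close>

lemma ellis_on_orbit:
  assumes f: "f \<in> E" "f \<notin> shift_maps \<theta>" and w: "w \<in> Z" "\<forall>x\<in>X. \<pi> (f x) = \<pi> x \<boxplus> w" and d: "d \<in> orbits"
  shows "\<exists>i\<in>I. \<exists>g\<in>carrier G. \<exists>s. \<forall>x\<in>X. orb (\<pi> x) = d \<longrightarrow> f x = point i (\<pi> x \<boxplus> w) (g (coord s x))"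
proof -
  let ?z = "rep d" let ?v = "rep d \<boxplus> w" let ?k = "idx (rep d \<boxplus> w)"
  have z: "?z \<in> Z" "?v \<in> Z" using rep[OF d] w by simp_all
  have "f \<noteq> restrict (shift ?k) X" using f(2) unfolding shift_maps_def by blast
  then obtain x1 where x1: "x1 \<in> X" "f x1 \<noteq> shift ?k x1"
    using extensionalityI[OF ellis_extensional[OF f(1)] restrict_extensional[of "shift ?k" X]] by fastforce
  then obtain k1 where k1: "f x1 k1 \<noteq> x1 (k1 + ?k)" by (auto simp: shift_def fun_eq_iff)
  \<comment> \<open>The radius covers the positions \<open>- ?k\<close> and \<open>- ?k - 1\<close>, where the coordinates are read, and \<open>k1\<close>.\<close>
  let ?F = "insert x1 {x \<in> X. \<pi> x = ?z}" let ?N = "nat \<bar>?k\<bar> + 1 + nat \<bar>k1\<bar>"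
  have F: "finite ?F" "?F \<subseteq> X" using finite_rep_fibre[OF d] x1(1) by auto
  obtain t where t: "\<forall>x\<in>?F. \<forall>k. \<bar>k\<bar> \<le> int ?N \<longrightarrow> f x k = x (k + t)"
    using ellis_approx[OF f(1) F, of ?N] by blast
  have "f x1 k1 = x1 (k1 + t)" using t by simp
  then have m: "t - ?k \<noteq> 0" using k1 by auto
  obtain i g s where i: "i \<in> I" and g: "g \<in> carrier G"
    and v: "\<forall>x\<in>X. \<pi> x = ?z \<longrightarrow> x (t - ?k) = g (coord s x) \<and> x (t - ?k - 1) = finv i (x (t - ?k))"
    using letters_from_coord[OF d m] by blast
  have "f x = point i (\<pi> x \<boxplus> w) (g (coord s x))" if x: "x \<in> X" "orb (\<pi> x) = d" for x
  proof -
    let ?j = "idx (\<pi> x)" let ?y = "shift (- idx (\<pi> x)) x"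
    have piz: "\<pi> x = ?z \<boxplus> emb ?j" using idx[OF factor_map_adic[OF x(1)]] x(2) by simp
    have y: "?y \<in> X" using shift_in_X x(1) by blast
    have "\<pi> ?y = ?z \<boxplus> emb ?j \<boxplus> emb (- ?j)" using factor_map_shift[OF x(1)] piz by simp
    also have "\<dots> = ?z" using z(1) emb_adic by (simp add: adic.m_assoc emb_0 flip: emb_add)
    finally have piy: "\<pi> ?y = ?z" .
    have fy: "f ?y k = ?y (k + t)" if "\<bar>k\<bar> \<le> int ?N" for k
      using t y piy that by simp
    have "f ?y (- ?k) = ?y (t - ?k)" "f ?y (- ?k - 1) = ?y (t - ?k - 1)"
      using fy[of "- ?k"] fy[of "- ?k - 1"] by (simp_all add: algebra_simps)
    then have "f ?y = point i ?v (g (coord s ?y))"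
      using v y piy w(2) ellis_in_X[OF f(1) y] i by (intro point_eqI) simp_all
    then have "shift ?j (f ?y) = point i (?v \<boxplus> emb ?j) (g (coord s x))"
      using point_shift[OF i z(2)] coord_shift[OF x(1)] by simp
    moreover have "shift ?j (f ?y) = f x"
      using ellis_shift[OF f(1) y, of ?j] by (simp add: shift_shift)
    moreover have "?v \<boxplus> emb ?j = ?z \<boxplus> emb ?j \<boxplus> w"
      using rep[OF d] w emb_adic by (simp add: adic.m_ac)
    ultimately show ?thesis using piz by simp
  qed
  then show ?thesis using i g by blast
qed

lemma point_regular: "orb z \<noteq> orb0 \<Longrightarrow> point i z a = point j z a"
  by (simp add: point_def)

lemma coord_regular: "orb (\<pi> x) \<noteq> orb0 \<Longrightarrow> coord s x = coord t x"
  by (simp add: coord_def)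

text \<open>The data on different orbits fit together: the side matters on one source orbit only, that of
  \<open>0\<close>, and the element of \<open>I\<close> on one target orbit only, again that of \<open>0\<close>.\<close>

lemma ellis_is_Psi:
  assumes f: "f \<in> E" "f \<notin> shift_maps \<theta>" and w: "w \<in> Z" "\<forall>x\<in>X. \<pi> (f x) = \<pi> x \<boxplus> w"
  shows "\<exists>i\<in>I. \<exists>\<psi>\<in>carrier Gfib. \<exists>s. f = Psi i \<psi> w s"
proof -
  have "\<forall>d\<in>orbits. \<exists>i g s. i \<in> I \<and> g \<in> carrier G \<and>
      (\<forall>x\<in>X. orb (\<pi> x) = d \<longrightarrow> f x = point i (\<pi> x \<boxplus> w) (g (coord s x)))"
    using ellis_on_orbit[OF f w] by blast
  then obtain di dg ds where D: "\<And>d. d \<in> orbits \<Longrightarrow> di d \<in> I" "\<And>d. d \<in> orbits \<Longrightarrow> dg d \<in> carrier G"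
    "\<And>d x. d \<in> orbits \<Longrightarrow> x \<in> X \<Longrightarrow> orb (\<pi> x) = d \<Longrightarrow> f x = point (di d) (\<pi> x \<boxplus> w) (dg d (coord (ds d) x))"
    by metis
  let ?i = "di (orb (zneg w))" let ?s = "ds orb0" let ?psi = "\<lambda>c\<in>orbits. dg (tr (zneg w) c)"
  have "?i \<in> I" using D(1) w by simp
  moreover have "?psi \<in> carrier Gfib"
    using D(2) tr_orbits[of _ "zneg w"] w(1) by (auto simp: Gfib_carrier)
  moreover have "f = Psi ?i ?psi w ?s"
  proof (rule extensionalityI[OF ellis_extensional[OF f(1)]])
    show "Psi ?i ?psi w ?s \<in> extensional X" by (simp add: Psi_def)
    fix x assume x: "x \<in> X"
    let ?d = "orb (\<pi> x)" let ?c = "orb (\<pi> x \<boxplus> w)"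
    have pix: "\<pi> x \<in> Z" using x factor_map_adic by blast
    have trc: "tr (zneg w) ?c = ?d" using pix w(1) by (simp add: tr_orb adic.m_assoc)
    have "f x = point (di ?d) (\<pi> x \<boxplus> w) (dg ?d (coord (ds ?d) x))" using D(3) x pix by simp
    also have "coord (ds ?d) x = coord ?s x" using coord_regular by (cases "?d = orb0") auto
    also have "point (di ?d) (\<pi> x \<boxplus> w) (dg ?d (coord ?s x)) = point ?i (\<pi> x \<boxplus> w) (dg ?d (coord ?s x))"
    proof (cases "?c = orb0")
      case True
      then have "?d = tr (zneg w) (orb zero)" using trc orb0_eq by simp
      also have "\<dots> = orb (zneg w)" using w(1) by (simp add: tr_orb)
      finally show ?thesis by simp
    qed (rule point_regular)
    also have "dg ?d = ?psi ?c" using trc pix w(1) by simp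
    finally show "f x = Psi ?i ?psi w ?s x" using x by (simp add: Psi_apply)
  qed
  ultimately show ?thesis by blast
qed

end

section \<open>Generating the Ellis semigroup\<close>

declare sandwich.simps [simp del]

context simplified_bijective_base begin

declare sand_simps(2) [simp]

lemma At_id: "At id = \<one>\<^bsub>Gfib\<^esub>"
  by (rule Gfib_eqI) (simp_all add: At_Gfib G_id Gfib_one At_apply)

lemma At_comp:
  assumes "g \<in> carrier G" "h \<in> carrier G"
  shows "At (g \<circ> h) = At g \<otimes>\<^bsub>Gfib\<^esub> At h"
  by (rule Gfib_eqI) (use assms in \<open>simp_all add: At_Gfib G_comp Gfib_mult At_apply\<close>)

lemma rot_one: "w \<in> Z \<Longrightarrow> rot w \<one>\<^bsub>Gfib\<^esub> = \<one>\<^bsub>Gfib\<^esub>"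
  by (rule Gfib_eqI) (simp_all add: rot_closed rot_apply Gfib_one tr_orbits id_def)

lemma sand_Plus: "At (sand Plus j) = \<one>\<^bsub>Gfib\<^esub>"
  using At_id by simp

text \<open>For the base element \<^term>\<open>g0\<close> all sandwich entries are trivial, so that right multiplication by
  \<open>Psi g0 \<one> 0 t\<close> changes the side and nothing else.\<close>

lemma sand_g0: "sand s g0 = id"
proof -
  have "g0 \<circ> finv g0 = id" using G_bij[OF g0_in_G] by (metis bij_is_surj surj_iff)
  then show ?thesis using sand_simps(1)[OF g0_in_I] by (cases s) simp_all
qed

lemma sand_base: "At (sand s g0) = \<one>\<^bsub>Gfib\<^esub>"
  by (simp only: sand_g0 At_id)

lemma Psi_mult_trivial:
  assumes "i \<in> I" "j \<in> I" "w \<in> Z" "v \<in> Z" "\<psi> \<in> carrier Gfib" "\<xi> \<in> carrier Gfib"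
    and "At (sand s j) = \<one>\<^bsub>Gfib\<^esub>"
  shows "compose X (Psi i \<psi> w s) (Psi j \<xi> v t) = Psi i (\<psi> \<otimes>\<^bsub>Gfib\<^esub> rot w \<xi>) (w \<boxplus> v) t"
  using assms by (simp add: Psi_mult rot_one)

lemma Psi_mult_fib:
  assumes "i \<in> I" "j \<in> I" "\<psi> \<in> carrier Gfib" "\<xi> \<in> carrier Gfib"
  shows "compose X (Psi i \<psi> zero s) (Psi j \<xi> zero t)
    = Psi i (\<psi> \<otimes>\<^bsub>Gfib\<^esub> At (sand s j) \<otimes>\<^bsub>Gfib\<^esub> \<xi>) zero t"
  using assms At_Gfib[OF sand_in_G[OF assms(2)]] by (simp add: Psi_mult rot_zero)

lemma Psi_mult_fib_trivial:
  assumes "i \<in> I" "j \<in> I" "\<psi> \<in> carrier Gfib" "\<xi> \<in> carrier Gfib" "At (sand s j) = \<one>\<^bsub>Gfib\<^esub>"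
  shows "compose X (Psi i \<psi> zero s) (Psi j \<xi> zero t) = Psi i (\<psi> \<otimes>\<^bsub>Gfib\<^esub> \<xi>) zero t"
  using assms by (simp add: Psi_mult_trivial rot_zero)

lemma zero_fibre_scaled:
  assumes x: "x \<in> X" "\<pi> x = zero" and j: "1 \<le> j" "j < L n"
  shows "x (L m * j) = col n j (x 0)" "x (L m * j - 1) = col n (j - 1) (x 0)"
    "x (L m * j - L (m + n)) = col n j (x (- 1))"
    "x (L m * j - 1 - L (m + n)) = col n (j - 1) (x (- 1))"
proof -
  have c1: "col (m + n) (L m * j) = col n j"
    using col_add[of 0 m j n] j L_pos[of m] by (simp add: col_ends)
  have e: "(L m - 1) + L m * (j - 1) = L m * j - 1" by (simp add: algebra_simps)
  have c2: "col (m + n) (L m * j - 1) = col n (j - 1)"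
    using col_add[of "L m - 1" m "j - 1" n] j L_pos[of m] unfolding e by (simp add: col_ends)
  have "L m * j < L m * L n" "L m * 1 \<le> L m * j"
    using j L_pos[of m] by (auto intro!: mult_left_mono mult_strict_left_mono)
  then have r: "0 \<le> L m * j" "L m * j < L (m + n)" "0 \<le> L m * j - 1" "L m * j - 1 < L (m + n)"
    using L_ge_1[of m] unfolding power_add by linarith+
  show "x (L m * j) = col n j (x 0)" "x (L m * j - 1) = col n (j - 1) (x 0)"
    "x (L m * j - L (m + n)) = col n j (x (- 1))"
    "x (L m * j - 1 - L (m + n)) = col n (j - 1) (x (- 1))"
    using zero_fibre_values[OF x r(1,2)] zero_fibre_values[OF x r(3,4)] c1 c2 by simp_all
qed

text \<open>The translations by \<open>l ^ m * j\<close> accumulate, as \<open>m\<close> grows, at an element of the Ellis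
  semigroup that preserves fibres and whose action over \<open>0\<close> is read off from the letters around
  the position \<open>j\<close>; those by \<open>l ^ m * (j - l ^ n)\<close> do the same with the left coordinate.\<close>

lemma column_element:
  assumes j: "1 \<le> j" "j < L n"
  shows "\<exists>\<psi>\<in>carrier Gfib. Psi (col n j \<circ> finv (col n (j - 1))) \<psi> zero s \<in> E
    \<and> (s = Plus \<longrightarrow> \<psi> orb0 = col n j)"
proof -
  let ?i = "col n j \<circ> finv (col n (j - 1))"
  have bij: "bij (col n j)" "bij (col n (j - 1))" using j col_bij by auto
  have i: "?i \<in> I" unfolding struct_I_iff using j by blast
  \<comment> \<open>On the left side the letters are counted from the left end of the last block of length
    \<open>l ^ (m + n)\<close> before the origin.\<close>
  define e :: int where "e = (if s = Plus then 0 else - 1)"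
  define t where "t m = L m * j + e * L (m + n)" for m
  have dvd: "L m dvd t m'" if "m \<le> m'" for m m'
  proof -
    have "L m dvd L m'" "L m dvd L (m' + n)" using that by (auto intro!: le_imp_power_dvd)
    then show ?thesis unfolding t_def by (intro dvd_add dvd_mult2[of _ "L m'"] dvd_mult[of _ "L (m' + n)"])
  qed
  have zero: "zero \<in> Z" by simp
  have "\<exists>f\<in>E. (\<forall>x\<in>X. \<pi> (f x) = \<pi> x \<boxplus> zero) \<and>
    (\<forall>F N m. finite F \<longrightarrow> F \<subseteq> X \<longrightarrow> (\<exists>n\<ge>m. \<forall>x\<in>F. \<forall>k. \<bar>k\<bar> \<le> int N \<longrightarrow> f x k = x (k + t n)))"
    by (rule ellis_cluster_adic[OF zero]) (simp add: adic_zero dvd)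
  then obtain f where f: "f \<in> E" "\<forall>x\<in>X. \<pi> (f x) = \<pi> x \<boxplus> zero"
    and cl: "\<forall>F N m. finite F \<longrightarrow> F \<subseteq> X \<longrightarrow> (\<exists>n\<ge>m. \<forall>x\<in>F. \<forall>k. \<bar>k\<bar> \<le> int N \<longrightarrow> f x k = x (k + t n))"
    by (elim bexE conjE) (rule that)
  have val: "f x 0 = col n j (x e)" "f x (- 1) = finv ?i (f x 0)" if x: "x \<in> X" "\<pi> x = zero" for x
  proof -
    have "finite {x}" "{x} \<subseteq> X" using x(1) by auto
    from cl[rule_format, OF this, where m = 0 and N = 1] obtain m
      where m: "\<forall>k. \<bar>k\<bar> \<le> int 1 \<longrightarrow> f x k = x (k + t m)" by auto
    have "f x 0 = x (t m)" "f x (- 1) = x (t m - 1)"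
      using m[rule_format, of 0] m[rule_format, of "- 1"] by simp_all
    moreover have "x (t m) = col n j (x e) \<and> x (t m - 1) = col n (j - 1) (x e)"
      using zero_fibre_scaled[OF x j, of m] by (auto simp: t_def e_def algebra_simps)
    ultimately have v: "f x 0 = col n j (x e)" "f x (- 1) = col n (j - 1) (x e)" by auto
    show "f x 0 = col n j (x e)" by (rule v)
    show "f x (- 1) = finv ?i (f x 0)"
      unfolding inv_comp_inv[OF bij] v using bij(1) by (simp add: bij_is_inj)
  qed
  have bij_i: "bij ?i" using i struct_I_in_G G_bij by blast
  have "f \<notin> shift_maps \<theta>"
  proof
    assume "f \<in> shift_maps \<theta>"
    then obtain k where k: "f = restrict (shift k) X" unfolding shift_maps_def by blast
    obtain x where x: "x \<in> X" "\<pi> x = zero" "x (- 1) \<noteq> finv ?i (x 0)"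
      using zero_fibre_not_permutation[OF bij_imp_bij_inv[OF bij_i]] by blast
    have fx: "f x = shift k x" using k x(1) by simp
    have "\<pi> x \<boxplus> emb k = \<pi> x \<boxplus> zero"
      using bspec[OF f(2) x(1)] unfolding fx factor_map_shift[OF x(1)] .
    then have "emb k = emb 0" using x(2) emb_adic by (simp add: emb_0)
    then have "k = 0" by (rule emb_inj)
    then show False using val(2)[OF x(1,2)] x(3) fx by simp
  qed
  then obtain i' \<psi> s' where i': "i' \<in> I" and psi: "\<psi> \<in> carrier Gfib" and fP: "f = Psi i' \<psi> zero s'"
    using ellis_is_Psi[OF f(1) _ zero f(2)] by blast
  have p: "bij (\<psi> orb0)" using Gfib_apply[OF psi orb0_in_orbits] G_bij by blast
  have f0: "f x 0 = \<psi> orb0 (coord s' x)" "f x (- 1) = finv i' (f x 0)" if x: "x \<in> X" "\<pi> x = zero" for x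
  proof -
    have "f x = point i' zero (\<psi> orb0 (coord s' x))"
      unfolding fP Psi_apply[OF x(1)] using x(2) by (simp add: orb0_eq)
    then show "f x 0 = \<psi> orb0 (coord s' x)" "f x (- 1) = finv i' (f x 0)"
      using point(3,4)[OF i' zero] by (simp_all add: idx_zero orb0_eq)
  qed
  have "finv i' a = finv ?i a" for a
  proof -
    obtain x where x: "x \<in> X" "\<pi> x = zero" "coord s' x = finv (\<psi> orb0) a"
      using coord_surj[OF zero] by blast
    then have "f x 0 = a" using f0(1)[OF x(1,2)] p by (simp add: bij_is_surj surj_f_inv_f)
    then show ?thesis using f0(2)[OF x(1,2)] val(2)[OF x(1,2)] by metis
  qed
  then have "finv i' = finv ?i" by blast
  then have ii: "i' = ?i" using bij_i i' struct_I_in_G G_bij by (metis inv_inv_eq)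
  have eq: "col n j (x e) = \<psi> orb0 (coord s' x)" if "x \<in> X" "\<pi> x = zero" for x
    using val(1)[OF that] f0(1)[OF that] by simp
  have cP: "coord Plus x = x 0" if "\<pi> x = zero" for x using that by (simp add: coord_Plus idx_zero)
  have g0: "bij g0" using g0_in_G by (rule G_bij)
  have ind: False if "bij \<rho>" "\<forall>x\<in>X. \<pi> x = zero \<longrightarrow> coord Minus x = \<rho> (coord Plus x)" for \<rho>
    using coords_independent[OF that(1) zero] that(2) by (auto simp: orb0_eq)
  have ss: "s' = s"
  proof (cases s)
    case Plus
    show ?thesis
    proof (rule ccontr)
      assume "s' \<noteq> s"
      then have s': "s' = Minus" using Plus by (cases s') auto
      have "coord Minus x = (finv (\<psi> orb0) \<circ> col n j) (coord Plus x)" if "x \<in> X" "\<pi> x = zero" for x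
        using eq[OF that] cP[OF that(2)] p Plus s' by (metis bij_is_inj comp_apply e_def inv_f_f)
      then show False using ind[OF bij_comp[OF bij(1) bij_imp_bij_inv[OF p]]] by blast
    qed
  next
    case Minus
    show ?thesis
    proof (rule ccontr)
      assume "s' \<noteq> s"
      then have s': "s' = Plus" using Minus by (cases s') auto
      have "coord Minus x = (g0 \<circ> (finv (col n j) \<circ> \<psi> orb0)) (coord Plus x)" if x: "x \<in> X" "\<pi> x = zero" for x
      proof -
        have "col n j (x (- 1)) = \<psi> orb0 (coord Plus x)" using eq[OF x] Minus s' by (simp add: e_def)
        then have "x (- 1) = finv (col n j) (\<psi> orb0 (coord Plus x))" using bij(1) by (metis bij_is_inj inv_f_f)
        then show ?thesis using coord_Minus_zero[OF x(2)] by simp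
      qed
      then show False using ind[OF bij_comp[OF bij_comp[OF p bij_imp_bij_inv[OF bij(1)]] g0]] by blast
    qed
  qed
  have "\<psi> orb0 = col n j" if "s = Plus"
  proof
    fix a
    obtain x where x: "x \<in> X" "\<pi> x = zero" "coord Plus x = a" using coord_surj[OF zero] by blast
    then show "\<psi> orb0 a = col n j a" using eq[OF x(1,2)] cP[OF x(2)] that ss by (simp add: e_def)
  qed
  then show ?thesis using psi f(1) fP ii ss by blast
qed

text \<open>By \<open>H_if\<close> and \<open>Psi_in_E\<close> it makes no difference with which \<open>i\<close> and \<open>s\<close> a function \<open>\<psi>\<close> occurs,
  so that this one set describes all elements other than the identity
  that preserve the fibres.\<close>

definition H :: "((nat \<Rightarrow> int) set \<Rightarrow> 'a \<Rightarrow> 'a) set" where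
  "H = {\<psi> \<in> carrier Gfib. \<forall>i\<in>I. Psi i \<psi> zero Plus \<in> E}"

lemma H_Gfib: "\<psi> \<in> H \<Longrightarrow> \<psi> \<in> carrier Gfib"
  by (simp add: H_def)

lemma Gfib_pow_apply:
  assumes "\<psi> \<in> carrier Gfib" "c \<in> orbits"
  shows "(\<psi> [^]\<^bsub>Gfib\<^esub> (n::nat)) c = \<psi> c [^]\<^bsub>G\<^esub> n"
proof (induction n)
  case 0
  then show ?case using assms(2) by (simp add: Gfib_one)
next
  case (Suc n)
  then show ?case
    using Gfib_mult[OF Gfib.nat_pow_closed[OF assms(1)] assms] Gfib_apply[OF assms]
    by (simp add: G.nat_pow_closed)
qed

lemma Gfib_pow_order: assumes "\<psi> \<in> carrier Gfib" shows "\<psi> [^]\<^bsub>Gfib\<^esub> order G = \<one>\<^bsub>Gfib\<^esub>"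
proof (rule Gfib_eqI)
  fix c assume c: "c \<in> orbits"
  show "(\<psi> [^]\<^bsub>Gfib\<^esub> order G) c = \<one>\<^bsub>Gfib\<^esub> c"
    using G.pow_order_eq_1[OF Gfib_apply[OF assms c]] c
    by (simp add: Gfib_pow_apply[OF assms c] Gfib_one)
qed (use assms in simp_all)

lemma order_G_pos: "0 < order G"
  using G_finite G.order_gt_0_iff_finite by blast

lemma Psi_pow:
  assumes "i \<in> I" "\<psi> \<in> carrier Gfib" "Psi i \<psi> zero Plus \<in> E"
  shows "Psi i (\<psi> [^]\<^bsub>Gfib\<^esub> Suc n) zero Plus \<in> E"
proof (induction n)
  case 0
  then show ?case using assms by simp
next
  case (Suc n)
  have "Psi i (\<psi> [^]\<^bsub>Gfib\<^esub> Suc (Suc n)) zero Plus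
      = compose X (Psi i (\<psi> [^]\<^bsub>Gfib\<^esub> Suc n) zero Plus) (Psi i \<psi> zero Plus)"
    using Psi_mult_fib_trivial[OF assms(1,1) Gfib.nat_pow_closed[OF assms(2), of "Suc n"] assms(2) sand_Plus]
    by simp
  then show ?case using ellis_compose[OF Suc assms(3)] by simp
qed

text \<open>On the right side the sandwich entries are trivial, and a power with the order of \<^term>\<open>G\<close> as
  exponent has trivial \<open>\<psi>\<close>.\<close>

lemma one_in_H: "\<one>\<^bsub>Gfib\<^esub> \<in> H"
proof -
  have "Psi i \<one>\<^bsub>Gfib\<^esub> zero Plus \<in> E" if i: "i \<in> I" for i
  proof -
    obtain n j where j: "1 \<le> j" "j < L n" "i = col n j \<circ> finv (col n (j - 1))"
      using i unfolding struct_I_iff by blast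
    obtain \<psi> where psi: "\<psi> \<in> carrier Gfib" "Psi i \<psi> zero Plus \<in> E"
      using column_element[OF j(1,2), of Plus] j(3) by blast
    show ?thesis
      using Psi_pow[OF i psi, of "order G - 1"] order_G_pos Gfib_pow_order[OF psi(1)] by simp
  qed
  then show ?thesis unfolding H_def by simp
qed

lemma unit_in_E: "i \<in> I \<Longrightarrow> Psi i \<one>\<^bsub>Gfib\<^esub> zero Plus \<in> E"
  using one_in_H by (simp add: H_def)

lemma H_if:
  assumes i: "i \<in> I" and psi: "\<psi> \<in> carrier Gfib" "Psi i \<psi> zero s \<in> E"
  shows "\<psi> \<in> H"
proof -
  have "Psi j \<psi> zero Plus \<in> E" if j: "j \<in> I" for j
  proof -
    have "compose X (compose X (Psi j \<one>\<^bsub>Gfib\<^esub> zero Plus) (Psi i \<psi> zero s)) (Psi g0 \<one>\<^bsub>Gfib\<^esub> zero Plus)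
        = Psi j \<psi> zero Plus"
      using i j psi(1) by (simp add: Psi_mult_fib_trivial At_id sand_base g0_in_I)
    then show ?thesis
      using ellis_compose[OF ellis_compose[OF unit_in_E[OF j] psi(2)] unit_in_E[OF g0_in_I]] by simp
  qed
  then show ?thesis using psi(1) by (simp add: H_def)
qed

lemma H_mult: assumes "\<psi> \<in> H" "\<xi> \<in> H" shows "\<psi> \<otimes>\<^bsub>Gfib\<^esub> \<xi> \<in> H"
proof -
  have "compose X (Psi g0 \<psi> zero Plus) (Psi g0 \<xi> zero Plus) \<in> E"
    using assms g0_in_I by (intro ellis_compose) (auto simp: H_def)
  then show ?thesis
    using assms g0_in_I H_if[OF g0_in_I, of "\<psi> \<otimes>\<^bsub>Gfib\<^esub> \<xi>" Plus] H_Gfib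
    by (simp add: Psi_mult_fib_trivial At_id)
qed

lemma H_inv: assumes "\<psi> \<in> H" shows "inv\<^bsub>Gfib\<^esub> \<psi> \<in> H"
proof -
  note psi = H_Gfib[OF assms]
  have pow: "\<psi> [^]\<^bsub>Gfib\<^esub> (n::nat) \<in> H" for n
  proof (induction n)
    case 0
    then show ?case using one_in_H by simp
  next
    case (Suc n)
    then show ?case using H_mult assms by simp
  qed
  have "\<psi> [^]\<^bsub>Gfib\<^esub> (order G - 1) \<otimes>\<^bsub>Gfib\<^esub> \<psi> = \<psi> [^]\<^bsub>Gfib\<^esub> Suc (order G - 1)" by simp
  also have "\<dots> = \<one>\<^bsub>Gfib\<^esub>" using order_G_pos Gfib_pow_order[OF psi] by simp
  finally have "inv\<^bsub>Gfib\<^esub> \<psi> = \<psi> [^]\<^bsub>Gfib\<^esub> (order G - 1)"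
    using psi by (intro Gfib.inv_equality) simp_all
  then show ?thesis using pow by simp
qed

text \<open>For the left side, one element that exists by \<open>column_element\<close> is enough: its \<open>\<psi>\<close> lies in the
  group \<^term>\<open>H\<close>, so it can be corrected by multiplication from the left.\<close>

lemma Psi_in_E: assumes "i \<in> I" "\<psi> \<in> H" shows "Psi i \<psi> zero s \<in> E"
proof (cases s)
  case Plus
  then show ?thesis using assms by (simp add: H_def)
next
  case Minus
  have j: "(1::int) \<le> 1" "(1::int) < L 1" using l_ge2 by auto
  let ?i = "col 1 1 \<circ> finv (col 1 (1 - 1))"
  have i': "?i \<in> I" unfolding struct_I_iff using j by blast
  obtain \<psi>0 where psi0: "\<psi>0 \<in> carrier Gfib" "Psi ?i \<psi>0 zero Minus \<in> E"
    using column_element[OF j, of Minus] by blast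
  have H0: "\<psi>0 \<in> H" using H_if[OF i' psi0] .
  have H1: "\<psi> \<otimes>\<^bsub>Gfib\<^esub> inv\<^bsub>Gfib\<^esub> \<psi>0 \<in> H" using H_mult[OF assms(2) H_inv[OF H0]] .
  have "compose X (Psi i (\<psi> \<otimes>\<^bsub>Gfib\<^esub> inv\<^bsub>Gfib\<^esub> \<psi>0) zero Plus) (Psi ?i \<psi>0 zero Minus) \<in> E"
    using H1 assms(1) psi0(2) by (intro ellis_compose) (auto simp: H_def)
  also have "compose X (Psi i (\<psi> \<otimes>\<^bsub>Gfib\<^esub> inv\<^bsub>Gfib\<^esub> \<psi>0) zero Plus) (Psi ?i \<psi>0 zero Minus)
      = Psi i (\<psi> \<otimes>\<^bsub>Gfib\<^esub> inv\<^bsub>Gfib\<^esub> \<psi>0 \<otimes>\<^bsub>Gfib\<^esub> \<psi>0) zero Minus"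
    by (rule Psi_mult_fib_trivial[OF assms(1) i' H_Gfib[OF H1] psi0(1) sand_Plus])
  also have "\<psi> \<otimes>\<^bsub>Gfib\<^esub> inv\<^bsub>Gfib\<^esub> \<psi>0 \<otimes>\<^bsub>Gfib\<^esub> \<psi>0 = \<psi>"
    using psi0(1) H_Gfib[OF assms(2)] by (simp add: Gfib.m_assoc)
  finally show ?thesis using Minus by simp
qed

lemma sand_in_H: assumes "j \<in> I" shows "At (sand s j) \<in> H"
proof -
  have "compose X (Psi g0 \<one>\<^bsub>Gfib\<^esub> zero s) (Psi j \<one>\<^bsub>Gfib\<^esub> zero Plus) \<in> E"
    using assms g0_in_I one_in_H by (intro ellis_compose Psi_in_E)
  then show ?thesis
    using assms g0_in_I H_if[OF g0_in_I, of "At (sand s j)" Plus] At_Gfib[OF sand_in_G[OF assms]]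
    by (simp add: Psi_mult_fib del: sandwich.simps)
qed

text \<open>The columns generate \<^term>\<open>G\<close>, and \<open>column_element\<close> provides each of them.\<close>

lemma H_onto_G: assumes "g \<in> carrier G" shows "\<exists>\<psi>\<in>H. \<psi> orb0 = g"
  using assms
proof (rule G_induct)
  fix n i assume i: "0 \<le> i" "i < L n"
  show "\<exists>\<psi>\<in>H. \<psi> orb0 = col n i"
  proof (cases "i = 0")
    case True
    then show ?thesis using one_in_H by (intro bexI[of _ "\<one>\<^bsub>Gfib\<^esub>"]) (simp_all add: col_ends Gfib_one)
  next
    case False
    then have j: "1 \<le> i" using i by simp
    then have "col n i \<circ> finv (col n (i - 1)) \<in> I" unfolding struct_I_iff using i by blast
    then show ?thesis using column_element[OF j i(2), of Plus] H_if by blast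
  qed
next
  fix f g assume "f \<in> carrier G" "g \<in> carrier G" "\<exists>\<psi>\<in>H. \<psi> orb0 = f" "\<exists>\<psi>\<in>H. \<psi> orb0 = g"
  then obtain \<psi> \<xi> where "\<psi> \<in> H" "\<xi> \<in> H" "\<psi> orb0 = f" "\<xi> orb0 = g" by blast
  then show "\<exists>\<psi>\<in>H. \<psi> orb0 = f \<circ> g"
    using H_mult H_Gfib by (intro bexI[of _ "\<psi> \<otimes>\<^bsub>Gfib\<^esub> \<xi>"]) (simp_all add: Gfib_mult)
qed

section \<open>The structural semigroup\<close>

abbreviation F0 where "F0 \<equiv> zero_fibre \<theta> l"

lemma F0_iff: "x \<in> F0 \<longleftrightarrow> x \<in> X \<and> \<pi> x = zero"
  by (simp add: fibre_def)

text \<open>The action of \<open>Psi i \<psi> 0 s\<close> on the fibre over \<open>0\<close>, where only the value \<open>g\<close> of \<open>\<psi>\<close> at the orbit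
  of \<open>0\<close> is involved (\<open>Psi_restrict\<close>).\<close>

definition mu :: "('a \<Rightarrow> 'a) \<Rightarrow> ('a \<Rightarrow> 'a) \<Rightarrow> pm \<Rightarrow> (int \<Rightarrow> 'a) \<Rightarrow> int \<Rightarrow> 'a" where
  "mu i g s = (\<lambda>x\<in>F0. point i zero (g (coord s x)))"

abbreviation M where "M \<equiv> {mu i g s | i g s. i \<in> I \<and> g \<in> carrier G}"

lemma ellis_fib_iff: "f \<in> ellis_fib \<theta> l \<longleftrightarrow> f \<in> E \<and> (\<forall>x\<in>X. \<pi> (f x) = \<pi> x)"
proof
  assume f: "f \<in> ellis_fib \<theta> l"
  have "\<pi> (f x) = \<pi> x" if x: "x \<in> X" for x
  proof -
    have "f x \<in> fibre \<theta> l (\<pi> x)"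
      using f x factor_map_adic[OF x] unfolding ellis_fib_def by (auto simp: fibre_def image_subset_iff)
    then show ?thesis by (simp add: fibre_def)
  qed
  then show "f \<in> E \<and> (\<forall>x\<in>X. \<pi> (f x) = \<pi> x)" using f by (simp add: ellis_fib_def)
next
  assume "f \<in> E \<and> (\<forall>x\<in>X. \<pi> (f x) = \<pi> x)"
  then show "f \<in> ellis_fib \<theta> l" using ellis_in_X by (auto simp: ellis_fib_def fibre_def)
qed

lemma ellis_fib_eq:
  "ellis_fib \<theta> l = insert (\<lambda>x\<in>X. x) {Psi i \<psi> zero s | i \<psi> s. i \<in> I \<and> \<psi> \<in> H}"
proof (rule equalityI; rule subsetI)
  fix f assume "f \<in> ellis_fib \<theta> l"
  then have f: "f \<in> E" "\<forall>x\<in>X. \<pi> (f x) = \<pi> x \<boxplus> zero"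
    using factor_map_adic by (auto simp: ellis_fib_iff)
  show "f \<in> insert (\<lambda>x\<in>X. x) {Psi i \<psi> zero s | i \<psi> s. i \<in> I \<and> \<psi> \<in> H}"
  proof (cases "f \<in> shift_maps \<theta>")
    case True
    then obtain k where k: "f = restrict (shift k) X" unfolding shift_maps_def by blast
    obtain x where x: "x \<in> X" using X_nonempty by blast
    have fx: "f x = shift k x" using k x by simp
    have "\<pi> x \<boxplus> emb k = \<pi> x \<boxplus> zero"
      using bspec[OF f(2) x] unfolding fx factor_map_shift[OF x] .
    then have "emb k = emb 0" using factor_map_adic[OF x] emb_adic by (simp add: emb_0)
    then have "k = 0" by (rule emb_inj)
    then have "f = (\<lambda>x\<in>X. x)" by (auto simp: k)
    then show ?thesis by simp
  next
    case False
    obtain i \<psi> s where P: "i \<in> I" "\<psi> \<in> carrier Gfib" "f = Psi i \<psi> zero s"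
      using ellis_is_Psi[OF f(1) False adic.one_closed f(2)] by blast
    then have "\<psi> \<in> H" using H_if[OF P(1,2)] f(1) by simp
    then show ?thesis using P by blast
  qed
next
  fix f assume "f \<in> insert (\<lambda>x\<in>X. x) {Psi i \<psi> zero s | i \<psi> s. i \<in> I \<and> \<psi> \<in> H}"
  then consider "f = (\<lambda>x\<in>X. x)" | i \<psi> s where "i \<in> I" "\<psi> \<in> H" "f = Psi i \<psi> zero s" by blast
  then show "f \<in> ellis_fib \<theta> l"
  proof cases
    case 1
    have "restrict (shift 0) X \<in> shift_maps \<theta>" unfolding shift_maps_def by blast
    then have "restrict (shift 0) X \<in> E" using shift_maps_subset_ellis by blast
    moreover have "restrict (shift 0) X = f" using 1 by auto
    ultimately show ?thesis using 1 by (auto simp: ellis_fib_iff)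
  next
    case 2
    then show ?thesis
      using Psi_in_E Psi_point(2)[OF 2(1) adic.one_closed] factor_map_adic by (simp add: ellis_fib_iff)
  qed
qed

lemma Psi_restrict: "restrict (Psi i \<psi> zero s) F0 = mu i (\<psi> orb0) s"
  by (rule ext) (auto simp: mu_def F0_iff Psi_def orb0_eq)

lemma ellis_fib0_eq: "ellis_fib0 \<theta> l = insert (\<lambda>x\<in>F0. x) M"
proof -
  have "restrict (\<lambda>x\<in>X. x) F0 = (\<lambda>x\<in>F0. x)" by (rule ext) (auto simp: F0_iff)
  moreover have "(\<lambda>f. restrict f F0) ` {Psi i \<psi> zero s | i \<psi> s. i \<in> I \<and> \<psi> \<in> H} = M"
  proof (rule equalityI; rule subsetI)
    fix f assume "f \<in> (\<lambda>f. restrict f F0) ` {Psi i \<psi> zero s | i \<psi> s. i \<in> I \<and> \<psi> \<in> H}"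
    then obtain i \<psi> s where "i \<in> I" "\<psi> \<in> H" "f = restrict (Psi i \<psi> zero s) F0" by blast
    then show "f \<in> M" using Gfib_apply[OF H_Gfib orb0_in_orbits] Psi_restrict by blast
  next
    fix f assume "f \<in> M"
    then obtain i g s where f: "i \<in> I" "g \<in> carrier G" "f = mu i g s" by blast
    obtain \<psi> where psi: "\<psi> \<in> H" "\<psi> orb0 = g" using H_onto_G[OF f(2)] by blast
    then have "f = restrict (Psi i \<psi> zero s) F0" using Psi_restrict[of i \<psi> s] f(3) by simp
    then show "f \<in> (\<lambda>f. restrict f F0) ` {Psi i \<psi> zero s | i \<psi> s. i \<in> I \<and> \<psi> \<in> H}"
      using f(1) psi(1) by blast
  qed
  ultimately show ?thesis by (simp add: ellis_fib0_def ellis_fib_eq)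
qed

lemma mu_point:
  assumes "i \<in> I" "x \<in> F0"
  shows "mu i g s x \<in> F0" "coord t (mu i g s x) = sand t i (g (coord s x))"
proof -
  have "mu i g s x = point i zero (g (coord s x))" using assms(2) by (simp add: mu_def)
  then show "mu i g s x \<in> F0" "coord t (mu i g s x) = sand t i (g (coord s x))"
    using point(1,2)[OF assms(1) adic.one_closed] coord_point[OF assms(1) adic.one_closed]
    by (simp_all add: F0_iff At_apply orb0_eq del: sandwich.simps)
qed

lemma mu_mult: "j \<in> I \<Longrightarrow> compose F0 (mu i g s) (mu j h t) = mu i (g \<circ> sand s j \<circ> h) t"
proof
  fix x assume j: "j \<in> I"
  show "compose F0 (mu i g s) (mu j h t) x = mu i (g \<circ> sand s j \<circ> h) t x"
  proof (cases "x \<in> F0")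
    case True
    have "compose F0 (mu i g s) (mu j h t) x = point i zero (g (coord s (mu j h t x)))"
      using True mu_point(1)[OF j True, of h t] by (simp add: compose_def mu_def[of i])
    then show ?thesis using True mu_point(2)[OF j True, of s h t] by (simp add: mu_def[of i])
  qed (simp add: compose_def mu_def)
qed

lemma F0_coord_surj: "\<exists>x\<in>F0. coord s x = a"
  using coord_surj[OF adic.one_closed, of s a] by (auto simp: F0_iff)

lemma F0_independent: assumes "bij \<rho>" shows "\<exists>x\<in>F0. coord Minus x \<noteq> \<rho> (coord Plus x)"
  using coords_independent[OF assms adic.one_closed] by (auto simp: F0_iff orb0_eq)

lemma mu_inj:
  assumes i: "i \<in> I" "j \<in> I" and g: "g \<in> carrier G" "h \<in> carrier G" and eq: "mu i g s = mu j h t"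
  shows "i = j \<and> g = h \<and> s = t"
proof -
  have bij: "bij i" "bij j" "bij g" "bij h" using i g struct_I_in_G G_bij by auto
  have c: "g (coord s x) = h (coord t x)" if x: "x \<in> F0" for x
    using mu_point(2)[OF i(1) x, of Plus g s] mu_point(2)[OF i(2) x, of Plus h t] eq by simp
  have no: False if "bij g" "bij h" "\<forall>x\<in>F0. g (coord Plus x) = h (coord Minus x)" for g h :: "'a \<Rightarrow> 'a"
  proof -
    have "coord Minus x = (finv h \<circ> g) (coord Plus x)" if x: "x \<in> F0" for x
      using that(1) \<open>\<forall>x\<in>F0. g (coord Plus x) = h (coord Minus x)\<close> \<open>bij h\<close>
      by (metis bij_is_inj comp_apply inv_f_f)
    then show False using F0_independent[OF bij_comp[OF that(1) bij_imp_bij_inv[OF that(2)]]] by blast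
  qed
  have st: "s = t"
    using no[OF bij(3,4)] no[OF bij(4,3)] c by (cases s; cases t) auto
  have gh: "g a = h a" for a using F0_coord_surj[of s a] c st by metis
  have "finv i a = finv j a" for a
  proof -
    obtain x where x: "x \<in> F0" "coord s x = finv g a" using F0_coord_surj by blast
    have a: "g (coord s x) = a" "h (coord t x) = a"
      using x(2) bij(3) gh st by (simp_all add: bij_is_surj surj_f_inv_f flip: gh)
    have "point i zero a = point j zero a"
      using fun_cong[OF eq, of x] x(1) a by (simp add: mu_def)
    then show ?thesis
      using point(4)[OF i(1), of zero a] point(4)[OF i(2), of zero a] by (simp add: orb0_eq)
  qed
  then have "finv i = finv j" by blast
  then have "i = j" using bij by (metis inv_inv_eq)
  then show ?thesis using gh st by blast
qed

lemma compose_id: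
  assumes "f \<in> extensional F0" "f \<in> F0 \<rightarrow> F0"
  shows "compose F0 (\<lambda>x\<in>F0. x) f = f" "compose F0 f (\<lambda>x\<in>F0. x) = f"
  using assms by (auto simp: compose_def extensional_def fun_eq_iff Pi_iff)

lemma mu_ext: "i \<in> I \<Longrightarrow> mu i g s \<in> extensional F0 \<and> mu i g s \<in> F0 \<rightarrow> F0"
  using mu_point(1) by (auto simp: mu_def)

lemma mu_mult_in_M: "f \<in> M \<Longrightarrow> h \<in> M \<Longrightarrow> compose F0 f h \<in> M"
proof -
  assume "f \<in> M" "h \<in> M"
  then obtain i g s j k t where fh: "f = mu i g s" "h = mu j k t" "i \<in> I" "g \<in> carrier G" "j \<in> I" "k \<in> carrier G"
    by blast
  have "compose F0 f h = mu i (g \<circ> sand s j \<circ> k) t" unfolding fh(1,2) using mu_mult[OF fh(5)] .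
  moreover have "g \<circ> sand s j \<circ> k \<in> carrier G" using fh sand_in_G G_comp by blast
  ultimately show ?thesis using fh(3) by blast
qed

text \<open>The set \<open>M\<close> is an ideal. Any ideal meets it, because it absorbs products, and then contains it,
  because it is a Rees matrix semigroup over a group.\<close>

lemma kernel_eq: "semigroup_kernel (map_semigroup F0 (ellis_fib0 \<theta> l)) = M"
proof
  let ?S = "map_semigroup F0 (ellis_fib0 \<theta> l)"
  have S: "carrier ?S = insert (\<lambda>x\<in>F0. x) M" "mult ?S = compose F0"
    by (simp_all add: map_semigroup_def ellis_fib0_eq)
  have g0id: "mu g0 id Plus \<in> M" using g0_in_I G_id by blast
  have "two_sided_ideal ?S M"
    unfolding two_sided_ideal_def S
  proof (intro conjI ballI)
    show "M \<noteq> {}" using g0id by blast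
    show "M \<subseteq> insert (\<lambda>x\<in>F0. x) M" by blast
    fix f h assume f: "f \<in> insert (\<lambda>x\<in>F0. x) M" and h: "h \<in> M"
    then have hh: "h \<in> extensional F0" "h \<in> F0 \<rightarrow> F0" using mu_ext by blast+
    from f have "compose F0 f h \<in> M \<and> compose F0 h f \<in> M"
    proof (elim insertE)
      assume "f = (\<lambda>x\<in>F0. x)"
      then show "compose F0 f h \<in> M \<and> compose F0 h f \<in> M" using compose_id[OF hh] h by simp
    next
      assume "f \<in> M"
      then show "compose F0 f h \<in> M \<and> compose F0 h f \<in> M"
        using mu_mult_in_M[of f h] mu_mult_in_M[of h f] h by blast
    qed
    then show "compose F0 f h \<in> M" "compose F0 h f \<in> M" by blast+
  qed
  then show "semigroup_kernel ?S \<subseteq> M" unfolding semigroup_kernel_def by blast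
  show "M \<subseteq> semigroup_kernel ?S" unfolding semigroup_kernel_def
  proof (intro Inter_greatest)
    fix J assume "J \<in> {J. two_sided_ideal ?S J}"
    then have J: "J \<noteq> {}" "J \<subseteq> insert (\<lambda>x\<in>F0. x) M"
      "\<And>f h. f \<in> insert (\<lambda>x\<in>F0. x) M \<Longrightarrow> h \<in> J \<Longrightarrow> compose F0 f h \<in> J"
      "\<And>f h. f \<in> insert (\<lambda>x\<in>F0. x) M \<Longrightarrow> h \<in> J \<Longrightarrow> compose F0 h f \<in> J"
      unfolding two_sided_ideal_def S by blast+
    obtain y where y: "y \<in> J" using J(1) by blast
    let ?m = "compose F0 (mu g0 id Plus) y"
    have "?m \<in> J" using J(3) y g0id by blast
    moreover have "?m \<in> M"
    proof (cases "y \<in> M")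
      case True
      then show ?thesis using mu_mult_in_M[OF g0id] by blast
    next
      case False
      then have "y = (\<lambda>x\<in>F0. x)" using y J(2) by blast
      then have "?m = mu g0 id Plus"
        using compose_id(2)[OF conjunct1 conjunct2, OF mu_ext mu_ext, OF g0_in_I g0_in_I, of id Plus]
        by (simp only:)
      then show ?thesis using g0id by (simp only:)
    qed
    then obtain j h t where jht: "?m = mu j h t" "j \<in> I" "h \<in> carrier G" by blast
    ultimately have m: "mu j h t \<in> J" "j \<in> I" "h \<in> carrier G" by simp_all
    show "M \<subseteq> J"
    proof
      fix f assume "f \<in> M"
      then obtain i g s where f: "f = mu i g s" "i \<in> I" "g \<in> carrier G" by blast
      let ?a = "mu i (g \<circ> finv h) Plus" and ?b = "mu g0 id s"
      have "?a \<in> M" using f m(3) G_comp G_inv_closed by blast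
      moreover have "?b \<in> M" using g0_in_I G_id by blast
      ultimately have "compose F0 (compose F0 ?a (mu j h t)) ?b \<in> J" using J(3,4) m(1) by blast
      moreover have "compose F0 (compose F0 ?a (mu j h t)) ?b = f"
      proof -
        have 1: "finv h \<circ> h = id" using G_bij[OF m(3)] by (simp add: bij_is_inj)
        show ?thesis
          using mu_mult[OF m(2), of i "g \<circ> finv h" Plus h t] mu_mult[OF g0_in_I, of i g t id s] 1 f(1)
          by (simp only: sand_simps(2) sand_g0 comp_id comp_assoc)
      qed
      ultimately show "f \<in> J" by simp
    qed
  qed
qed

lemma struct_semigroup_simps:
  "carrier (struct_semigroup \<theta> l) = M" "mult (struct_semigroup \<theta> l) = compose F0"
  by (simp_all add: struct_semigroup_def map_semigroup_def kernel_eq[unfolded map_semigroup_def])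

text \<open>The group part of an idempotent is the inverse of a sandwich entry. The function with this value
  at the orbit of \<open>0\<close> and trivial values elsewhere lies in \<^term>\<open>H\<close> by \<open>sand_in_H\<close>, and products of
  idempotents multiply such functions.\<close>

lemma At_in_H_if_generated:
  assumes gen: "generated_by_idempotents (struct_semigroup \<theta> l)" and g: "g \<in> carrier G"
  shows "At g \<in> H"
proof -
  let ?S = "struct_semigroup \<theta> l"
  have "\<exists>i g s. f = mu i g s \<and> i \<in> I \<and> g \<in> carrier G \<and> At g \<in> H"
    if "f \<in> semigroup_generate ?S (idempotents ?S)" for f
    using that
  proof (induction rule: semigroup_generate.induct)
    case (incl f)
    then have fM: "f \<in> M" "compose F0 f f = f"
      by (simp_all add: idempotents_def struct_semigroup_simps)
    then obtain i g s where f: "f = mu i g s" "i \<in> I" "g \<in> carrier G" by blast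
    have gs: "g \<circ> sand s i \<circ> g \<in> carrier G" using f sand_in_G G_comp by blast
    have "mu i (g \<circ> sand s i \<circ> g) s = mu i g s" using fM(2) mu_mult[OF f(2)] f(1) by simp
    then have "g \<circ> sand s i \<circ> g = g" using mu_inj[OF f(2,2) gs f(3)] by blast
    then have "g (sand s i (g a)) = g a" for a by (metis comp_apply)
    then have gid: "g \<circ> sand s i = id"
      using G_bij[OF f(3)] by (metis bij_is_surj comp_apply eq_id_iff surjD)
    have "At g \<otimes>\<^bsub>Gfib\<^esub> At (sand s i) = \<one>\<^bsub>Gfib\<^esub>"
      using At_comp[OF f(3) sand_in_G[OF f(2), of s]] unfolding gid At_id by (rule sym)
    then have "At g = inv\<^bsub>Gfib\<^esub> (At (sand s i))"
      using At_Gfib[OF f(3)] At_Gfib[OF sand_in_G[OF f(2)]] Gfib.inv_equality by metis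
    then have "At g \<in> H" using H_inv[OF sand_in_H[OF f(2)]] by simp
    then show ?case using f by blast
  next
    case (mult f h)
    then obtain i g s j k t where fh: "f = mu i g s" "i \<in> I" "g \<in> carrier G" "At g \<in> H"
      "h = mu j k t" "j \<in> I" "k \<in> carrier G" "At k \<in> H" by blast
    have "f \<otimes>\<^bsub>?S\<^esub> h = mu i (g \<circ> sand s j \<circ> k) t"
      unfolding struct_semigroup_simps fh(1,5) using mu_mult[OF fh(6)] .
    moreover have "g \<circ> sand s j \<circ> k \<in> carrier G" using fh sand_in_G G_comp by blast
    moreover have "At (g \<circ> sand s j \<circ> k) \<in> H"
      using fh sand_in_G[OF fh(6)] sand_in_H[OF fh(6)] H_mult G_comp At_comp by metis
    ultimately show ?case using fh(2) by blast
  qed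
  moreover have "mu g0 g Plus \<in> semigroup_generate ?S (idempotents ?S)"
    using gen g g0_in_I unfolding generated_by_idempotents_def struct_semigroup_simps by blast
  ultimately obtain i g' s where "mu g0 g Plus = mu i g' s" "i \<in> I" "g' \<in> carrier G" "At g' \<in> H" by blast
  then show ?thesis using mu_inj[OF g0_in_I _ g] by blast
qed

end

section \<open>Completely simple semigroups of maps and Rees matrix semigroups\<close>

lemma map_semigroup_simps:
  "carrier (map_semigroup A S) = S" "mult (map_semigroup A S) = compose A"
  by (simp_all add: map_semigroup_def)

lemma rees_semigroup_simps:
  "carrier (rees_semigroup K I L A) = I \<times> carrier K \<times> L"
  "(i, g, s) \<otimes>\<^bsub>rees_semigroup K I L A\<^esub> (j, h, t) = (i, g \<otimes>\<^bsub>K\<^esub> A s j \<otimes>\<^bsub>K\<^esub> h, t)"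
  by (simp_all add: rees_semigroup_def)

lemma semidirect_product_simps:
  "carrier (semidirect_product K N \<phi>) = carrier K \<times> carrier N"
  "(g, h) \<otimes>\<^bsub>semidirect_product K N \<phi>\<^esub> (g', h') = (g \<otimes>\<^bsub>K\<^esub> \<phi> h g', h \<otimes>\<^bsub>N\<^esub> h')"
  by (simp_all add: semidirect_product_def)

text \<open>A faithful multiplicative parametrization of a set of self-maps: associativity of the parameters
  is inherited from the composition of maps.\<close>

lemma isomorphic_by_maps:
  assumes closed: "\<And>a b. a \<in> carrier T \<Longrightarrow> b \<in> carrier T \<Longrightarrow> a \<otimes>\<^bsub>T\<^esub> b \<in> carrier T"
    and hom: "\<And>a b. a \<in> carrier T \<Longrightarrow> b \<in> carrier T \<Longrightarrow> Phi (a \<otimes>\<^bsub>T\<^esub> b) = compose A (Phi a) (Phi b)"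
    and image: "Phi ` carrier T = S" and maps: "S \<subseteq> A \<rightarrow>\<^sub>E A"
    and inv: "\<And>a. a \<in> carrier T \<Longrightarrow> g (Phi a) = a"
  shows "is_semigroup (map_semigroup A S)" "is_semigroup T" "g \<in> iso (map_semigroup A S) T"
    "Phi \<in> iso T (map_semigroup A S)"
proof -
  have in_S: "Phi a \<in> S" if "a \<in> carrier T" for a using image that by blast
  have S_closed: "compose A f h \<in> S" if f: "f \<in> S" and h: "h \<in> S" for f h
  proof -
    obtain a b where "a \<in> carrier T" "b \<in> carrier T" "f = Phi a" "h = Phi b"
      using f h image by (metis imageE)
    then show ?thesis using in_S[OF closed] hom by metis
  qed
  have assoc: "compose A (compose A f h) k = compose A f (compose A h k)" if "k \<in> S" for f h k
  proof -
    have "k \<in> A \<rightarrow> A" using maps that by auto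
    then show ?thesis by (rule compose_assoc[symmetric])
  qed
  show "is_semigroup (map_semigroup A S)"
    unfolding is_semigroup_def map_semigroup_simps using S_closed assoc by blast
  have inj: "a = b" if "a \<in> carrier T" "b \<in> carrier T" "Phi a = Phi b" for a b
    using inv that by metis
  show "is_semigroup T" unfolding is_semigroup_def
  proof (intro conjI ballI)
    fix a b c assume abc: "a \<in> carrier T" "b \<in> carrier T" "c \<in> carrier T"
    show "a \<otimes>\<^bsub>T\<^esub> b \<otimes>\<^bsub>T\<^esub> c = a \<otimes>\<^bsub>T\<^esub> (b \<otimes>\<^bsub>T\<^esub> c)"
      by (rule inj) (use abc closed hom assoc[OF in_S] in simp_all)
  qed (rule closed)
  have bij: "bij_betw Phi (carrier T) S" "bij_betw g S (carrier T)"
  proof -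
    show "bij_betw Phi (carrier T) S" using inj image by (auto simp: bij_betw_def inj_on_def)
    show "bij_betw g S (carrier T)"
      by (rule bij_betw_byWitness[where f' = Phi]) (use inv image in auto)
  qed
  show "Phi \<in> iso T (map_semigroup A S)"
    unfolding iso_def hom_def map_semigroup_simps using bij(1) in_S hom by auto
  have "g (compose A f h) = g f \<otimes>\<^bsub>T\<^esub> g h" if f: "f \<in> S" and h: "h \<in> S" for f h
  proof -
    obtain a b where "a \<in> carrier T" "b \<in> carrier T" "f = Phi a" "h = Phi b"
      using f h image by (metis imageE)
    then show ?thesis using hom inv closed by metis
  qed
  moreover have "g f \<in> carrier T" if "f \<in> S" for f
    using bij(2) that by (auto simp: bij_betw_def)
  ultimately show "g \<in> iso (map_semigroup A S) T"
    unfolding iso_def hom_def map_semigroup_simps using bij(2) by auto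
qed

lemma completely_simple_rees:
  assumes "group K" "I \<noteq> {}" "L \<noteq> {}"
    and A: "\<And>s i. s \<in> L \<Longrightarrow> i \<in> I \<Longrightarrow> A s i \<in> carrier K"
  shows "completely_simple (rees_semigroup K I L A)"
proof -
  interpret K: group K by fact
  let ?R = "rees_semigroup K I L A"
  have "is_semigroup ?R"
    unfolding is_semigroup_def rees_semigroup_simps(1)
    by (auto simp: rees_semigroup_simps(2) A K.m_assoc)
  moreover have "J = carrier ?R" if J: "two_sided_ideal ?R J" for J
  proof
    show sub: "J \<subseteq> carrier ?R" using J by (simp add: two_sided_ideal_def)
    obtain j h t where y: "(j, h, t) \<in> J" "j \<in> I" "h \<in> carrier K" "t \<in> L"
      using J sub unfolding two_sided_ideal_def rees_semigroup_simps(1) by fastforce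
    have ideal: "x \<otimes>\<^bsub>?R\<^esub> z \<in> J" "z \<otimes>\<^bsub>?R\<^esub> x \<in> J" if "x \<in> carrier ?R" "z \<in> J" for x z
      using J that by (auto simp: two_sided_ideal_def)
    show "carrier ?R \<subseteq> J"
    proof
      fix x assume "x \<in> carrier ?R"
      then obtain i g s where x: "x = (i, g, s)" "i \<in> I" "g \<in> carrier K" "s \<in> L"
        unfolding rees_semigroup_simps(1) by blast
      let ?u = "(i, g \<otimes>\<^bsub>K\<^esub> inv\<^bsub>K\<^esub> (A t j \<otimes>\<^bsub>K\<^esub> h), t)" and ?v = "(j, inv\<^bsub>K\<^esub> (A t j), s)"
      have "?u \<in> carrier ?R" "?v \<in> carrier ?R"
        using x y A by (simp_all add: rees_semigroup_simps(1))
      then have "?u \<otimes>\<^bsub>?R\<^esub> (j, h, t) \<otimes>\<^bsub>?R\<^esub> ?v \<in> J" using ideal y(1) by blast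
      moreover have "?u \<otimes>\<^bsub>?R\<^esub> (j, h, t) = (i, g, t)"
        using x y A by (simp add: rees_semigroup_simps(2) K.m_assoc)
      moreover have "(i, g, t) \<otimes>\<^bsub>?R\<^esub> ?v = x"
        using x y A by (simp add: rees_semigroup_simps(2) K.m_assoc)
      ultimately show "x \<in> J" by simp
    qed
  qed
  moreover have "\<exists>p\<in>idempotents ?R. \<forall>q\<in>idempotents ?R. idem_le ?R q p \<longrightarrow> q = p"
  proof -
    obtain i s where is_in: "i \<in> I" "s \<in> L" using assms(2,3) by blast
    let ?p = "(i, inv\<^bsub>K\<^esub> (A s i), s)"
    have "?p \<in> idempotents ?R"
      using is_in A by (simp add: idempotents_def rees_semigroup_simps)
    moreover have "q = ?p" if q: "q \<in> idempotents ?R" "idem_le ?R q ?p" for q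
    proof -
      obtain j h t where jht: "q = (j, h, t)" "j \<in> I" "h \<in> carrier K" "t \<in> L"
        using q(1) unfolding idempotents_def rees_semigroup_simps(1) by blast
      have ij: "t = s" "j = i"
        using q(2) unfolding idem_le_def jht(1) rees_semigroup_simps(2) by simp_all
      have "h \<otimes>\<^bsub>K\<^esub> A s i \<otimes>\<^bsub>K\<^esub> h = \<one>\<^bsub>K\<^esub> \<otimes>\<^bsub>K\<^esub> h"
        using q(1) jht ij by (simp add: idempotents_def rees_semigroup_simps(2))
      then have "h \<otimes>\<^bsub>K\<^esub> A s i = \<one>\<^bsub>K\<^esub>"
        using jht(3) A[OF is_in(2,1)] by (metis K.m_closed K.one_closed K.right_cancel)
      then have "h = inv\<^bsub>K\<^esub> (A s i)" using jht(3) A[OF is_in(2,1)] by (metis K.inv_equality)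
      then show ?thesis using jht(1) ij by simp
    qed
    ultimately show ?thesis by blast
  qed
  ultimately show ?thesis by (simp add: completely_simple_def)
qed

lemma completely_simple_iso:
  assumes f: "f \<in> iso T S" and S: "is_semigroup S" and T: "completely_simple T"
  shows "completely_simple S"
proof -
  have bij: "bij_betw f (carrier T) (carrier S)"
    and hom: "\<And>a b. a \<in> carrier T \<Longrightarrow> b \<in> carrier T \<Longrightarrow> f (a \<otimes>\<^bsub>T\<^esub> b) = f a \<otimes>\<^bsub>S\<^esub> f b"
    using f by (auto simp: iso_def hom_def)
  have inj: "a = b" if "a \<in> carrier T" "b \<in> carrier T" "f a = f b" for a b
    using bij that by (auto simp: bij_betw_def inj_on_def)
  have image: "f ` carrier T = carrier S" using bij by (simp add: bij_betw_def)
  have closed: "a \<otimes>\<^bsub>T\<^esub> b \<in> carrier T" if "a \<in> carrier T" "b \<in> carrier T" for a b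
    using conjunct1[OF T[unfolded completely_simple_def]] that by (simp add: is_semigroup_def)
  have T_simple: "K = carrier T" if "two_sided_ideal T K" for K
    using conjunct1[OF conjunct2[OF T[unfolded completely_simple_def]]] that by (elim allE[of _ K] impE)
  have "J = carrier S" if J: "two_sided_ideal S J" for J
  proof -
    have J_sub: "J \<subseteq> carrier S" "J \<noteq> {}"
      and J_ideal: "\<And>x y. x \<in> carrier S \<Longrightarrow> y \<in> J \<Longrightarrow> x \<otimes>\<^bsub>S\<^esub> y \<in> J \<and> y \<otimes>\<^bsub>S\<^esub> x \<in> J"
      using J by (simp_all add: two_sided_ideal_def)
    have in_S: "f a \<in> carrier S" if "a \<in> carrier T" for a using image that by blast
    let ?J = "{a \<in> carrier T. f a \<in> J}"
    have "two_sided_ideal T ?J"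
      unfolding two_sided_ideal_def
    proof (intro conjI ballI)
      obtain y where "y \<in> J" using J_sub(2) by blast
      moreover from this have "y \<in> f ` carrier T" using J_sub(1) image by blast
      ultimately show "?J \<noteq> {}" by blast
      fix a b assume "a \<in> carrier T" "b \<in> ?J"
      then show "a \<otimes>\<^bsub>T\<^esub> b \<in> ?J" "b \<otimes>\<^bsub>T\<^esub> a \<in> ?J"
        using J_ideal[OF in_S, of a "f b"] closed by (simp_all add: hom)
    qed auto
    then have "?J = carrier T" by (rule T_simple)
    then have "f a \<in> J" if "a \<in> carrier T" for a using that by blast
    then have "carrier S \<subseteq> J" unfolding image[symmetric] by blast
    then show ?thesis using J_sub(1) by (rule subset_antisym[rotated])
  qed
  moreover have "\<exists>p\<in>idempotents S. \<forall>q\<in>idempotents S. idem_le S q p \<longrightarrow> q = p"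
  proof -
    obtain p where p: "p \<in> idempotents T" "\<forall>q\<in>idempotents T. idem_le T q p \<longrightarrow> q = p"
      using conjunct2[OF conjunct2[OF T[unfolded completely_simple_def]]] by (elim bexE) (rule that)
    have pT: "p \<in> carrier T" "p \<otimes>\<^bsub>T\<^esub> p = p" using p(1) by (auto simp: idempotents_def)
    have "f p \<in> idempotents S"
      using pT hom[of p p] image by (auto simp: idempotents_def)
    moreover have "q = f p" if q: "q \<in> idempotents S" "idem_le S q (f p)" for q
    proof -
      obtain a where a: "a \<in> carrier T" "q = f a"
        using q(1) image unfolding idempotents_def by blast
      have "f (a \<otimes>\<^bsub>T\<^esub> a) = f a" "f (a \<otimes>\<^bsub>T\<^esub> p) = f a" "f (p \<otimes>\<^bsub>T\<^esub> a) = f a"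
        using q a pT(1) by (simp_all add: idempotents_def idem_le_def hom)
      then have "a \<otimes>\<^bsub>T\<^esub> a = a" "a \<otimes>\<^bsub>T\<^esub> p = a" "p \<otimes>\<^bsub>T\<^esub> a = a"
        using inj[OF closed] a(1) pT(1) by blast+
      then have "a = p" using p(2) a(1) by (simp add: idempotents_def idem_le_def)
      then show ?thesis using a(2) by simp
    qed
    ultimately show ?thesis by blast
  qed
  ultimately show ?thesis using S unfolding completely_simple_def by (intro conjI allI impI)
qed

section \<open>The complete parametrization\<close>

context simplified_bijective_base begin

lemma rot_At:
  assumes "w \<in> Z" "g \<in> carrier G" "c \<in> orbits"
  shows "rot w (At g) c = (if c = orb w then g else id)"
proof -
  have "tr (zneg w) c = orb0 \<longleftrightarrow> c = orb w"
  proof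
    assume "tr (zneg w) c = orb0"
    then have "tr w (tr (zneg w) c) = tr w (orb zero)" by (simp add: orb0_eq)
    then show "c = orb w" using assms by (simp add: tr_tr tr_zero tr_orb)
  next
    assume "c = orb w"
    then show "tr (zneg w) c = orb0" using assms(1) by (simp add: tr_orb orb0_eq)
  qed
  moreover have "tr (zneg w) c \<in> orbits" using assms(1,3) tr_orbits by simp
  ultimately show ?thesis using assms At_Gfib[OF assms(2)] by (simp add: rot_apply At_apply)
qed

text \<open>Compactness gives an element with the required displacement. If it is a shift, composing it with
  an element that preserves the fibres and is not a shift moves it out of the group of shifts.\<close>

lemma translation_in_E:
  assumes w: "w \<in> Z"
  shows "\<exists>\<psi>\<in>carrier Gfib. Psi g0 \<psi> w Plus \<in> E"
proof -
  let ?e = "Psi g0 \<one>\<^bsub>Gfib\<^esub> zero Plus"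
  have e: "?e \<in> E" "?e \<notin> shift_maps \<theta>"
    using unit_in_E[OF g0_in_I] Psi_not_shift[OF g0_in_I adic.one_closed Gfib.one_closed] by blast+
  obtain f where f: "f \<in> E" "\<forall>x\<in>X. \<pi> (f x) = \<pi> x \<boxplus> w" using ellis_translation_exists[OF w] by blast
  have "\<exists>h\<in>E. h \<notin> shift_maps \<theta> \<and> (\<forall>x\<in>X. \<pi> (h x) = \<pi> x \<boxplus> w)"
  proof (cases "f \<in> shift_maps \<theta>")
    case True
    then obtain k where k: "f = restrict (shift k) X" unfolding shift_maps_def by blast
    have ex: "?e x \<in> X" "\<pi> (?e x) = \<pi> x" if "x \<in> X" for x
      using Psi_point(1,2)[OF g0_in_I adic.one_closed that] factor_map_adic[OF that] by simp_all
    have "compose X f ?e \<notin> shift_maps \<theta>"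
    proof
      assume "compose X f ?e \<in> shift_maps \<theta>"
      then obtain j where j: "compose X f ?e = restrict (shift j) X" unfolding shift_maps_def by blast
      have "?e x = shift (j - k) x" if x: "x \<in> X" for x
      proof -
        have "shift k (?e x) = shift j x"
          using fun_cong[OF j, of x] x ex(1)[OF x] by (simp add: compose_def k)
        then have "shift (- k) (shift k (?e x)) = shift (- k) (shift j x)" by simp
        then show ?thesis by (simp add: shift_shift)
      qed
      then have "?e = restrict (shift (j - k)) X" by (auto simp: Psi_def)
      then show False using e(2) unfolding shift_maps_def by blast
    qed
    moreover have "\<pi> (compose X f ?e x) = \<pi> x \<boxplus> w" if x: "x \<in> X" for x
      using f(2) ex[OF x] x by (simp add: compose_def)
    ultimately show ?thesis using ellis_compose[OF f(1) e(1)] by blast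
  qed (use f in blast)
  then obtain h where h: "h \<in> E" "h \<notin> shift_maps \<theta>" "\<forall>x\<in>X. \<pi> (h x) = \<pi> x \<boxplus> w" by blast
  obtain i \<psi> s where P: "i \<in> I" "\<psi> \<in> carrier Gfib" "h = Psi i \<psi> w s"
    using ellis_is_Psi[OF h(1,2) w h(3)] by blast
  have "compose X ?e h = Psi g0 \<psi> w s"
    unfolding P(3) using Psi_mult_trivial[OF g0_in_I P(1) adic.one_closed w Gfib.one_closed P(2) sand_Plus] P(2) w
    by (simp add: rot_zero)
  moreover have "compose X (Psi g0 \<psi> w s) ?e = Psi g0 \<psi> w Plus"
    using Psi_mult_trivial[OF g0_in_I g0_in_I w adic.one_closed P(2) Gfib.one_closed sand_base] P(2) w
    by (simp add: rot_one)
  ultimately have "Psi g0 \<psi> w Plus = compose X (compose X ?e h) ?e" by simp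
  moreover have "compose X (compose X ?e h) ?e \<in> E"
    using ellis_compose[OF ellis_compose[OF e(1) h(1)] e(1)] .
  ultimately show ?thesis using P(2) by (intro bexI[of _ \<psi>]) (simp_all only:)
qed

text \<open>Conjugation by an element that translates by \<open>w\<close> carries the values over the orbit of \<open>0\<close> to
  the orbit of \<open>w\<close>.\<close>

lemma rot_At_in_H:
  assumes At_H: "\<And>g. g \<in> carrier G \<Longrightarrow> At g \<in> H" and w: "w \<in> Z" and g: "g \<in> carrier G"
  shows "rot w (At g) \<in> H"
proof -
  obtain \<psi> where psi: "\<psi> \<in> carrier Gfib" "Psi g0 \<psi> w Plus \<in> E" using translation_in_E[OF w] by blast
  obtain \<xi> where xi: "\<xi> \<in> carrier Gfib" "Psi g0 \<xi> (zneg w) Plus \<in> E"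
    using translation_in_E[of "zneg w"] w by auto
  have rxi: "rot w \<xi> \<in> carrier Gfib" using rot_closed[OF w xi(1)] .
  have conj: "\<psi> \<otimes>\<^bsub>Gfib\<^esub> rot w (At h) \<otimes>\<^bsub>Gfib\<^esub> rot w \<xi> \<in> H" if h: "h \<in> carrier G" for h
  proof -
    have Ah: "At h \<in> carrier Gfib" "rot w (At h) \<in> carrier Gfib"
      using At_Gfib[OF h] rot_closed[OF w] by blast+
    have "Psi g0 (At h) zero Plus \<in> E" using Psi_in_E[OF g0_in_I At_H[OF h]] .
    then have "compose X (compose X (Psi g0 \<psi> w Plus) (Psi g0 (At h) zero Plus)) (Psi g0 \<xi> (zneg w) Plus) \<in> E"
      using psi(2) xi(2) by (intro ellis_compose)
    also have "compose X (Psi g0 \<psi> w Plus) (Psi g0 (At h) zero Plus)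
        = Psi g0 (\<psi> \<otimes>\<^bsub>Gfib\<^esub> rot w (At h)) w Plus"
      using Psi_mult_trivial[OF g0_in_I g0_in_I w adic.one_closed psi(1) Ah(1) sand_Plus] w by simp
    also have "compose X (Psi g0 (\<psi> \<otimes>\<^bsub>Gfib\<^esub> rot w (At h)) w Plus) (Psi g0 \<xi> (zneg w) Plus)
        = Psi g0 (\<psi> \<otimes>\<^bsub>Gfib\<^esub> rot w (At h) \<otimes>\<^bsub>Gfib\<^esub> rot w \<xi>) zero Plus"
      using Psi_mult_trivial[OF g0_in_I g0_in_I w _ _ xi(1) sand_Plus, of "zneg w" "\<psi> \<otimes>\<^bsub>Gfib\<^esub> rot w (At h)"]
        psi(1) Ah(2) w by simp
    finally have "Psi g0 (\<psi> \<otimes>\<^bsub>Gfib\<^esub> rot w (At h) \<otimes>\<^bsub>Gfib\<^esub> rot w \<xi>) zero Plus \<in> E" .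
    then show ?thesis
      using Ah(2) psi(1) rxi by (intro H_if[OF g0_in_I, of _ Plus] Gfib.m_closed)
  qed
  let ?c = "orb w"
  have c: "?c \<in> orbits" using w by simp
  note pc = Gfib_apply[OF psi(1) c]
  have bij: "bij (\<psi> ?c)" using G_bij[OF pc] .
  \<comment> \<open>Conjugation by \<open>\<psi>\<close> turns \<open>h\<close> at the orbit of \<open>w\<close> into \<open>g\<close>.\<close>
  define h where "h = finv (\<psi> ?c) \<circ> g \<circ> \<psi> ?c"
  have h: "h \<in> carrier G" unfolding h_def using G_comp G_inv_closed g pc by blast
  note Ah = rot_closed[OF w At_Gfib[OF h]]
  have "\<psi> \<otimes>\<^bsub>Gfib\<^esub> rot w (At id) \<otimes>\<^bsub>Gfib\<^esub> rot w \<xi> = \<psi> \<otimes>\<^bsub>Gfib\<^esub> rot w \<xi>"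
    using psi(1) w by (simp add: At_id rot_one)
  then have "\<psi> \<otimes>\<^bsub>Gfib\<^esub> rot w \<xi> \<in> H" using conj[OF G_id] by simp
  then have "\<psi> \<otimes>\<^bsub>Gfib\<^esub> rot w (At h) \<otimes>\<^bsub>Gfib\<^esub> rot w \<xi> \<otimes>\<^bsub>Gfib\<^esub> inv\<^bsub>Gfib\<^esub> (\<psi> \<otimes>\<^bsub>Gfib\<^esub> rot w \<xi>) \<in> H"
    using H_mult[OF conj[OF h] H_inv] by blast
  moreover have "\<psi> \<otimes>\<^bsub>Gfib\<^esub> rot w (At h) \<otimes>\<^bsub>Gfib\<^esub> rot w \<xi> \<otimes>\<^bsub>Gfib\<^esub> inv\<^bsub>Gfib\<^esub> (\<psi> \<otimes>\<^bsub>Gfib\<^esub> rot w \<xi>)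
      = \<psi> \<otimes>\<^bsub>Gfib\<^esub> rot w (At h) \<otimes>\<^bsub>Gfib\<^esub> inv\<^bsub>Gfib\<^esub> \<psi>"
  proof -
    have "rot w \<xi> \<otimes>\<^bsub>Gfib\<^esub> inv\<^bsub>Gfib\<^esub> (\<psi> \<otimes>\<^bsub>Gfib\<^esub> rot w \<xi>) = inv\<^bsub>Gfib\<^esub> \<psi>"
      using psi(1) rxi by (simp add: Gfib.inv_mult_group flip: Gfib.m_assoc)
    then show ?thesis using psi(1) rxi Ah by (simp add: Gfib.m_assoc)
  qed
  moreover have "\<psi> \<otimes>\<^bsub>Gfib\<^esub> rot w (At h) \<otimes>\<^bsub>Gfib\<^esub> inv\<^bsub>Gfib\<^esub> \<psi> = rot w (At g)"
  proof -
    have "\<psi> \<otimes>\<^bsub>Gfib\<^esub> rot w (At h) = rot w (At g) \<otimes>\<^bsub>Gfib\<^esub> \<psi>"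
    proof (rule Gfib_eqI)
      fix d assume d: "d \<in> orbits"
      have "\<psi> ?c \<circ> h = g \<circ> \<psi> ?c"
        unfolding h_def using bij by (simp add: fun_eq_iff bij_is_surj surj_f_inv_f)
      then show "(\<psi> \<otimes>\<^bsub>Gfib\<^esub> rot w (At h)) d = (rot w (At g) \<otimes>\<^bsub>Gfib\<^esub> \<psi>) d"
        using d psi(1) Ah rot_closed[OF w At_Gfib[OF g]] rot_At[OF w h d] rot_At[OF w g d]
        by (simp add: Gfib_mult)
    qed (use psi(1) Ah rot_closed[OF w At_Gfib[OF g]] in simp_all)
    then show ?thesis using psi(1) rot_closed[OF w At_Gfib[OF g]] by (simp add: Gfib.m_assoc)
  qed
  ultimately show ?thesis by simp
qed

text \<open>Finite products give the functions that are trivial on all but finitely many orbits. An element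
  of the Ellis semigroup is tested on finitely many points at a time, hence on finitely many
  orbits.\<close>

lemma H_full:
  assumes At_H: "\<And>g. g \<in> carrier G \<Longrightarrow> At g \<in> H" and psi: "\<psi> \<in> carrier Gfib"
  shows "\<psi> \<in> H"
proof -
  define cut where "cut K = (\<lambda>c\<in>orbits. if c \<in> K then \<psi> c else id)" for K
  have cut_Gfib: "cut K \<in> carrier Gfib" for K
    using Gfib_apply[OF psi] G_id by (auto simp: Gfib_carrier cut_def)
  have fin: "cut K \<in> H" if "finite K" "K \<subseteq> orbits" for K
    using that
  proof (induction K rule: finite_induct)
    case empty
    have "cut {} = \<one>\<^bsub>Gfib\<^esub>" 
      by (rule Gfib_eqI[OF cut_Gfib Gfib.one_closed]) (simp add: cut_def Gfib_one)
    then show ?case using one_in_H by (simp only:)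
  next
    case (insert c K)
    then have c: "c \<in> orbits" by simp
    note r = rep[OF c]
    have g: "\<psi> c \<in> carrier G" using Gfib_apply[OF psi c] .
    have A: "rot (rep c) (At (\<psi> c)) \<in> H" using rot_At_in_H[OF At_H r(1) g] by blast
    have "cut (insert c K) = rot (rep c) (At (\<psi> c)) \<otimes>\<^bsub>Gfib\<^esub> cut K"
    proof (rule Gfib_eqI)
      fix d assume d: "d \<in> orbits"
      show "cut (insert c K) d = (rot (rep c) (At (\<psi> c)) \<otimes>\<^bsub>Gfib\<^esub> cut K) d"
        using d insert.hyps(2) r(2) rot_At[OF r(1) g d]
        by (simp only: Gfib_mult[OF H_Gfib[OF A] cut_Gfib d]) (auto simp: cut_def)
    next
      show "rot (rep c) (At (\<psi> c)) \<otimes>\<^bsub>Gfib\<^esub> cut K \<in> carrier Gfib"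
        using H_Gfib[OF A] cut_Gfib by (rule Gfib.m_closed)
    qed (rule cut_Gfib)
    moreover have "cut K \<in> H" using insert by simp
    ultimately show ?case using H_mult[OF A] by (simp only:)
  qed
  have "Psi i \<psi> zero Plus \<in> E" if i: "i \<in> I" for i
  proof (rule ellis_closed)
    show "Psi i \<psi> zero Plus \<in> X \<rightarrow>\<^sub>E X" using Psi_PiE[OF i adic.one_closed] .
    fix F assume F: "finite F" "F \<subseteq> X"
    let ?K = "(\<lambda>x. orb (\<pi> x)) ` F"
    have "?K \<subseteq> orbits" using F(2) factor_map_adic by auto
    then have "Psi i (cut ?K) zero Plus \<in> E" using fin[of ?K] F(1) Psi_in_E[OF i] by blast
    moreover have "Psi i (cut ?K) zero Plus x = Psi i \<psi> zero Plus x" if x: "x \<in> F" for x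
    proof -
      have "\<pi> x \<in> Z" "x \<in> X" using x F(2) factor_map_adic by auto
      then show ?thesis using x by (simp add: Psi_apply cut_def)
    qed
    ultimately show "\<exists>g\<in>E. \<forall>x\<in>F. g x = Psi i \<psi> zero Plus x" by blast
  qed
  then show ?thesis using psi by (simp add: H_def)
qed

lemma Psi_full:
  assumes At_H: "\<And>g. g \<in> carrier G \<Longrightarrow> At g \<in> H"
    and i: "i \<in> I" and psi: "\<psi> \<in> carrier Gfib" and w: "w \<in> Z"
  shows "Psi i \<psi> w s \<in> E"
proof -
  obtain \<xi> where xi: "\<xi> \<in> carrier Gfib" "Psi g0 \<xi> w Plus \<in> E" using translation_in_E[OF w] by blast
  let ?q = "\<psi> \<otimes>\<^bsub>Gfib\<^esub> inv\<^bsub>Gfib\<^esub> \<xi>"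
  have q: "?q \<in> carrier Gfib" using psi xi(1) by simp
  have "Psi i ?q zero Plus \<in> E" using Psi_in_E[OF i H_full[OF At_H q]] by blast
  moreover have "Psi g0 \<one>\<^bsub>Gfib\<^esub> zero s \<in> E" using Psi_in_E[OF g0_in_I one_in_H] .
  ultimately have "compose X (compose X (Psi i ?q zero Plus) (Psi g0 \<xi> w Plus)) (Psi g0 \<one>\<^bsub>Gfib\<^esub> zero s) \<in> E"
    using xi(2) by (intro ellis_compose)
  also have "compose X (Psi i ?q zero Plus) (Psi g0 \<xi> w Plus) = Psi i \<psi> w Plus"
    using Psi_mult_trivial[OF i g0_in_I adic.one_closed w q xi(1) sand_Plus] psi xi(1) w
    by (simp add: rot_zero Gfib.m_assoc)
  also have "compose X (Psi i \<psi> w Plus) (Psi g0 \<one>\<^bsub>Gfib\<^esub> zero s) = Psi i \<psi> w s"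
    using Psi_mult_trivial[OF i g0_in_I w adic.one_closed psi Gfib.one_closed sand_Plus] psi w
    by (simp add: rot_one)
  finally show ?thesis .
qed

lemma ellis_minus_shifts:
  assumes At_H: "\<And>g. g \<in> carrier G \<Longrightarrow> At g \<in> H"
  shows "E - shift_maps \<theta> = {Psi i \<psi> w s | i \<psi> w s. i \<in> I \<and> \<psi> \<in> carrier Gfib \<and> w \<in> Z}"
proof (rule equalityI; rule subsetI)
  fix f assume f: "f \<in> E - shift_maps \<theta>"
  then obtain w where w: "w \<in> Z" "\<forall>x\<in>X. \<pi> (f x) = \<pi> x \<boxplus> w" using ellis_translation by blast
  then show "f \<in> {Psi i \<psi> w s | i \<psi> w s. i \<in> I \<and> \<psi> \<in> carrier Gfib \<and> w \<in> Z}"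
    using ellis_is_Psi[OF _ _ w] f by blast
next
  fix f assume "f \<in> {Psi i \<psi> w s | i \<psi> w s. i \<in> I \<and> \<psi> \<in> carrier Gfib \<and> w \<in> Z}"
  then obtain i \<psi> w s where P: "f = Psi i \<psi> w s" "i \<in> I" "\<psi> \<in> carrier Gfib" "w \<in> Z" by blast
  show "f \<in> E - shift_maps \<theta>"
    unfolding P(1) using Psi_full[OF At_H P(2-4)] Psi_not_shift[OF P(2,4,3)] by blast
qed

lemma id_shift: "(\<lambda>x\<in>X. x) \<in> shift_maps \<theta>"
proof -
  have "(\<lambda>x\<in>X. x) = restrict (shift 0) X" by auto
  then show ?thesis unfolding shift_maps_def by blast
qed

lemma ellis_fib_full:
  assumes At_H: "\<And>g. g \<in> carrier G \<Longrightarrow> At g \<in> H"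
  shows "ellis_fib \<theta> l = insert (\<lambda>x\<in>X. x) {Psi i \<psi> zero s | i \<psi> s. i \<in> I \<and> \<psi> \<in> carrier Gfib}"
proof -
  have "\<psi> \<in> H \<longleftrightarrow> \<psi> \<in> carrier Gfib" for \<psi> using H_full[OF At_H] H_Gfib by blast
  then show ?thesis unfolding ellis_fib_eq by simp
qed

lemma ellis_fib_minus_id:
  assumes At_H: "\<And>g. g \<in> carrier G \<Longrightarrow> At g \<in> H"
  shows "ellis_fib \<theta> l - {\<lambda>x\<in>X. x} = {Psi i \<psi> zero s | i \<psi> s. i \<in> I \<and> \<psi> \<in> carrier Gfib}"
proof -
  have "(\<lambda>x\<in>X. x) \<noteq> Psi i \<psi> zero s" if "i \<in> I" "\<psi> \<in> carrier Gfib" for i \<psi> s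
    using Psi_not_shift[OF that(1) adic.one_closed that(2), of s] id_shift by (intro notI) simp
  then have nin: "(\<lambda>x\<in>X. x) \<notin> {Psi i \<psi> zero s | i \<psi> s. i \<in> I \<and> \<psi> \<in> carrier Gfib}" by blast
  have eq: "ellis_fib \<theta> l = insert (\<lambda>x\<in>X. x) {Psi i \<psi> zero s | i \<psi> s. i \<in> I \<and> \<psi> \<in> carrier Gfib}"
    by (rule ellis_fib_full) (rule At_H)
  show ?thesis unfolding eq using nin by (rule Diff_insert_absorb)
qed

lemma Hausdorff_self_map_topology: "Hausdorff_space (self_map_topology \<theta>)"
  unfolding self_map_topology_def space_topology_def
  by (simp add: Hausdorff_space_product_topology Hausdorff_space_subtopology)

text \<open>A continuous bijection from a compact space onto a Hausdorff space is a homeomorphism.\<close>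

lemma top_isomorphic_by_maps:
  assumes closed: "\<And>a b. a \<in> carrier R \<Longrightarrow> b \<in> carrier R \<Longrightarrow> a \<otimes>\<^bsub>R\<^esub> b \<in> carrier R"
    and hom: "\<And>a b. a \<in> carrier R \<Longrightarrow> b \<in> carrier R \<Longrightarrow> Phi (a \<otimes>\<^bsub>R\<^esub> b) = compose X (Phi a) (Phi b)"
    and image: "Phi ` carrier R = S" and maps: "S \<subseteq> X \<rightarrow>\<^sub>E X"
    and inj: "inj_on Phi (carrier R)"
    and top: "topspace TT = carrier R" "compact_space TT"
    and cont: "\<And>x. x \<in> X \<Longrightarrow> continuous_map TT (space_topology \<theta>) (\<lambda>a. Phi a x)"
  shows "semigroup_top_isomorphic (map_semigroup X S) (subtopology (self_map_topology \<theta>) S) R TT"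
proof -
  let ?ST = "subtopology (self_map_topology \<theta>) S"
  have in_S: "Phi a \<in> S" if "a \<in> carrier R" for a using image that by blast
  have S_top: "topspace ?ST = S"
    using maps by (auto simp: self_map_topology_def topspace_space_topology)
  have "continuous_map TT (self_map_topology \<theta>) Phi"
    unfolding self_map_topology_def continuous_map_componentwise top(1)
    using cont in_S maps by (auto simp: PiE_def)
  then have "continuous_map TT ?ST Phi"
    using in_S top(1) by (intro continuous_map_into_subtopology) auto
  then have "homeomorphic_map TT ?ST Phi"
    using top image inj S_top Hausdorff_space_subtopology[OF Hausdorff_self_map_topology]
    by (intro continuous_imp_homeomorphic_map) simp_all
  then obtain g where g: "homeomorphic_maps TT ?ST Phi g" unfolding homeomorphic_map_maps by blast
  then have inv: "\<And>a. a \<in> carrier R \<Longrightarrow> g (Phi a) = a" and home: "homeomorphic_map ?ST TT g"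
    using top(1) unfolding homeomorphic_maps_map by blast+
  show ?thesis
    unfolding semigroup_top_isomorphic_def
  proof (intro conjI exI[of _ g])
    show "is_semigroup (map_semigroup X S)"
      by (rule isomorphic_by_maps(1)[where T = R and Phi = Phi and g = g]; fact)
    show "is_semigroup R"
      by (rule isomorphic_by_maps(2)[where T = R and Phi = Phi and g = g and A = X and S = S]; fact)
    show "g \<in> iso (map_semigroup X S) R"
      by (rule isomorphic_by_maps(3)[where T = R and Phi = Phi and g = g]; fact)
    show "homeomorphic_map ?ST TT g" by (rule home)
  qed
qed

end

section \<open>Comparison with the models\<close>

context simplified_bijective_base begin

abbreviation RF where
  "RF \<equiv> rees_semigroup Gfib I {Plus, Minus} (\<lambda>s g. At (sand s g))"

lemma pm_in: "s \<in> {Plus, Minus}"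
  by (cases s) auto

lemma topspace_power: "topspace (power_topology \<theta> l K) = (\<Pi>\<^sub>E c\<in>K. carrier G)"
  by (simp add: power_topology_def)

lemma compact_power: "compact_space (power_topology \<theta> l K)"
  unfolding power_topology_def compact_space_product_topology
  using G_finite by (simp add: compact_space_discrete_topology)

lemma finite_I: "finite I"
  by (rule finite_subset[of _ UNIV]) auto

lemma RF_closed: "a \<in> carrier RF \<Longrightarrow> b \<in> carrier RF \<Longrightarrow> a \<otimes>\<^bsub>RF\<^esub> b \<in> carrier RF"
  using At_Gfib[OF sand_in_G] by (auto simp: rees_semigroup_simps At_id)

abbreviation Phi0 where "Phi0 \<equiv> \<lambda>(i, \<psi>, s). Psi i \<psi> zero s"

lemma Phi0_hom: "a \<in> carrier RF \<Longrightarrow> b \<in> carrier RF \<Longrightarrow> Phi0 (a \<otimes>\<^bsub>RF\<^esub> b) = compose X (Phi0 a) (Phi0 b)"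
  using Psi_mult_fib by (auto simp: rees_semigroup_simps)

lemma Phi0_inj: "inj_on Phi0 (carrier RF)"
proof (rule inj_onI)
  fix a b assume ab: "a \<in> carrier RF" "b \<in> carrier RF" "Phi0 a = Phi0 b"
  obtain i \<psi> s j \<xi> t where e: "a = (i, \<psi>, s)" "b = (j, \<xi>, t)" by (metis surj_pair)
  then show "a = b"
    using ab Psi_inj[of i j zero zero \<psi> \<xi> s t] by (simp add: rees_semigroup_simps)
qed

lemma Phi0_image: "Phi0 ` carrier RF = {Psi i \<psi> zero s | i \<psi> s. i \<in> I \<and> \<psi> \<in> carrier Gfib}"
  using pm_in by (force simp: rees_semigroup_simps)

text \<open>The value at a point depends only on \<open>i\<close>, on \<open>s\<close> and on the value of \<open>\<psi>\<close> at one orbit, all of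
  which are discrete.\<close>

lemma Phi0_continuous:
  assumes x: "x \<in> X"
  shows "continuous_map (rees_topology (power_topology \<theta> l orbits) I {Plus, Minus})
    (space_topology \<theta>) (\<lambda>a. Phi0 a x)"
proof -
  let ?TF = "rees_topology (power_topology \<theta> l orbits) I {Plus, Minus}"
  let ?c = "orb (\<pi> x)"
  have z: "\<pi> x \<in> Z" using x by (rule factor_map_adic)
  have c: "?c \<in> orbits" using z by simp
  have "continuous_map (power_topology \<theta> l orbits) (discrete_topology (carrier G)) (\<lambda>\<psi>. \<psi> ?c)"
    unfolding power_topology_def using continuous_map_product_projection[OF c] .
  then have "continuous_map ?TF (discrete_topology (carrier G)) ((\<lambda>\<psi>. \<psi> ?c) \<circ> (fst \<circ> snd))"
    unfolding rees_topology_def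
    by (intro continuous_map_compose[OF continuous_map_compose[OF continuous_map_snd continuous_map_fst]])
  moreover have "continuous_map ?TF (discrete_topology I) fst"
    unfolding rees_topology_def by (rule continuous_map_fst)
  moreover have "continuous_map ?TF (discrete_topology {Plus, Minus}) (snd \<circ> snd)"
    unfolding rees_topology_def by (rule continuous_map_compose[OF continuous_map_snd continuous_map_snd])
  ultimately have 1: "continuous_map ?TF (discrete_topology (I \<times> carrier G \<times> {Plus, Minus}))
      (\<lambda>a. (fst a, ((\<lambda>\<psi>. \<psi> ?c) \<circ> (fst \<circ> snd)) a, (snd \<circ> snd) a))"
    unfolding prod_topology_discrete_topology by (intro continuous_map_pairedI)
  have 2: "continuous_map (discrete_topology (I \<times> carrier G \<times> {Plus, Minus})) (space_topology \<theta>)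
      (\<lambda>(i, g, s). point i (\<pi> x) (g (coord s x)))"
    using point(1)[OF _ z] by (auto simp: topspace_space_topology)
  have "(\<lambda>a. Phi0 a x) = (\<lambda>(i, g, s). point i (\<pi> x) (g (coord s x))) \<circ>
      (\<lambda>a. (fst a, ((\<lambda>\<psi>. \<psi> ?c) \<circ> (fst \<circ> snd)) a, (snd \<circ> snd) a))"
    using z by (auto simp: Psi_apply[OF x] fun_eq_iff)
  then show ?thesis using continuous_map_compose[OF 1 2] by simp
qed

lemma fib_rees_top_isomorphic:
  assumes At_H: "\<And>g. g \<in> carrier G \<Longrightarrow> At g \<in> H"
  shows "semigroup_top_isomorphic
       (map_semigroup X (ellis_fib \<theta> l - {\<lambda>x\<in>X. x}))
       (subtopology (self_map_topology \<theta>) (ellis_fib \<theta> l - {\<lambda>x\<in>X. x})) RF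
       (rees_topology (power_topology \<theta> l orbits) I {Plus, Minus})"
proof (rule top_isomorphic_by_maps[where Phi = Phi0])
  have eq: "ellis_fib \<theta> l - {\<lambda>x\<in>X. x} = {Psi i \<psi> zero s | i \<psi> s. i \<in> I \<and> \<psi> \<in> carrier Gfib}"
    by (rule ellis_fib_minus_id) (rule At_H)
  show "Phi0 ` carrier RF = ellis_fib \<theta> l - {\<lambda>x\<in>X. x}" unfolding eq by (rule Phi0_image)
  show "ellis_fib \<theta> l - {\<lambda>x\<in>X. x} \<subseteq> X \<rightarrow>\<^sub>E X" unfolding eq using Psi_PiE[OF _ adic.one_closed] by blast
  show "topspace (rees_topology (power_topology \<theta> l orbits) I {Plus, Minus}) = carrier RF"
    by (simp add: rees_topology_def rees_semigroup_simps topspace_power Gfib_carrier)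
  show "compact_space (rees_topology (power_topology \<theta> l orbits) I {Plus, Minus})"
    unfolding rees_topology_def compact_space_prod_topology
    using compact_power finite_I by (simp add: compact_space_discrete_topology)
qed (fact RF_closed Phi0_hom Phi0_inj Phi0_continuous)+

lemma fib_completely_simple:
  assumes At_H: "\<And>g. g \<in> carrier G \<Longrightarrow> At g \<in> H"
  shows "completely_simple (map_semigroup X (ellis_fib \<theta> l - {\<lambda>x\<in>X. x}))"
proof -
  let ?S = "ellis_fib \<theta> l - {\<lambda>x\<in>X. x}"
  have eq: "?S = {Psi i \<psi> zero s | i \<psi> s. i \<in> I \<and> \<psi> \<in> carrier Gfib}"
    by (rule ellis_fib_minus_id) (rule At_H)
  have image: "Phi0 ` carrier RF = ?S" unfolding eq by (rule Phi0_image)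
  have maps: "?S \<subseteq> X \<rightarrow>\<^sub>E X" unfolding eq using Psi_PiE[OF _ adic.one_closed] by blast
  have inv: "inv_into (carrier RF) Phi0 (Phi0 a) = a" if "a \<in> carrier RF" for a
    using Phi0_inj that by (rule inv_into_f_f)
  have "Phi0 \<in> iso RF (map_semigroup X ?S)"
    by (rule isomorphic_by_maps(4)[where g = "inv_into (carrier RF) Phi0"])
      (fact RF_closed Phi0_hom image maps inv)+
  moreover have "is_semigroup (map_semigroup X ?S)"
    by (rule isomorphic_by_maps(1)[where T = RF and Phi = Phi0 and g = "inv_into (carrier RF) Phi0"])
      (fact RF_closed Phi0_hom image maps inv)+
  moreover have "completely_simple RF"
    using At_Gfib[OF sand_in_G] struct_I_nonempty
    by (intro completely_simple_rees Gfib_group) auto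
  ultimately show ?thesis by (rule completely_simple_iso)
qed

abbreviation RS where
  "RS \<equiv> rees_semigroup (semidirect_product Gfib (adic_group l) rot) I {Plus, Minus}
    (\<lambda>s g. (At (sand s g), zero))"

abbreviation Phi where "Phi \<equiv> \<lambda>(i, (\<psi>, w), s). Psi i \<psi> w s"

lemma ellis_isomorphic:
  assumes At_H: "\<And>g. g \<in> carrier G \<Longrightarrow> At g \<in> H"
  shows "semigroup_isomorphic (map_semigroup X (E - shift_maps \<theta>)) RS"
proof -
  have eq: "E - shift_maps \<theta> = {Psi i \<psi> w s | i \<psi> w s. i \<in> I \<and> \<psi> \<in> carrier Gfib \<and> w \<in> Z}"
    by (rule ellis_minus_shifts) (rule At_H)
  have RS: "carrier RS = I \<times> (carrier Gfib \<times> Z) \<times> {Plus, Minus}"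
    by (simp add: rees_semigroup_simps semidirect_product_simps)
  have mult: "(i, (\<psi>, w), s) \<otimes>\<^bsub>RS\<^esub> (j, (\<xi>, v), t)
      = (i, (\<psi> \<otimes>\<^bsub>Gfib\<^esub> rot w (At (sand s j)) \<otimes>\<^bsub>Gfib\<^esub> rot w \<xi>, w \<boxplus> v), t)" if "w \<in> Z" for i \<psi> w s j \<xi> v t
    using that by (simp add: rees_semigroup_simps semidirect_product_simps)
  have closed: "a \<otimes>\<^bsub>RS\<^esub> b \<in> carrier RS" if "a \<in> carrier RS" "b \<in> carrier RS" for a b
  proof -
    obtain i \<psi> w s j \<xi> v t where e: "a = (i, (\<psi>, w), s)" "b = (j, (\<xi>, v), t)" by (metis surj_pair)
    show ?thesis
      using that At_Gfib[OF sand_in_G, of j s] rot_closed unfolding e RS by (simp add: mult)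
  qed
  have hom: "Phi (a \<otimes>\<^bsub>RS\<^esub> b) = compose X (Phi a) (Phi b)" if "a \<in> carrier RS" "b \<in> carrier RS" for a b
  proof -
    obtain i \<psi> w s j \<xi> v t where e: "a = (i, (\<psi>, w), s)" "b = (j, (\<xi>, v), t)" by (metis surj_pair)
    show ?thesis using that unfolding e RS by (simp add: mult Psi_mult)
  qed
  have inj: "inj_on Phi (carrier RS)"
  proof (rule inj_onI)
    fix a b assume ab: "a \<in> carrier RS" "b \<in> carrier RS" "Phi a = Phi b"
    obtain i \<psi> w s j \<xi> v t where e: "a = (i, (\<psi>, w), s)" "b = (j, (\<xi>, v), t)" by (metis surj_pair)
    show "a = b" using ab Psi_inj[of i j w v \<psi> \<xi> s t] unfolding e RS by simp
  qed
  have image: "Phi ` carrier RS = E - shift_maps \<theta>"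
    unfolding eq RS using pm_in by force
  have maps: "E - shift_maps \<theta> \<subseteq> X \<rightarrow>\<^sub>E X" unfolding eq using Psi_PiE by blast
  have inv: "inv_into (carrier RS) Phi (Phi a) = a" if "a \<in> carrier RS" for a
    using inj that by (rule inv_into_f_f)
  let ?g = "inv_into (carrier RS) Phi" and ?S = "E - shift_maps \<theta>"
  have "is_semigroup (map_semigroup X ?S)"
    by (rule isomorphic_by_maps(1)[where T = RS and Phi = Phi and g = ?g]) (fact closed hom image maps inv)+
  moreover have "is_semigroup RS"
    by (rule isomorphic_by_maps(2)[where Phi = Phi and g = ?g and A = X and S = ?S]) (fact closed hom image maps inv)+
  moreover have "?g \<in> iso (map_semigroup X ?S) RS"
    by (rule isomorphic_by_maps(3)[where Phi = Phi]) (fact closed hom image maps inv)+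
  ultimately show ?thesis unfolding semigroup_isomorphic_def by blast
qed

abbreviation regular where "regular \<equiv> orbits - {orb0}"
abbreviation P where "P \<equiv> power_group \<theta> l regular"
abbreviation Id0 where "Id0 \<equiv> \<lambda>x\<in>F0. x"

lemma P_carrier: "carrier P = (\<Pi>\<^sub>E c\<in>regular. carrier G)"
  by (simp add: power_group_def)

lemma P_apply: "F \<in> carrier P \<Longrightarrow> c \<in> regular \<Longrightarrow> F c \<in> carrier G"
  unfolding P_carrier by (rule PiE_mem)

lemma P_mult: "F \<in> carrier P \<Longrightarrow> F' \<in> carrier P \<Longrightarrow> c \<in> regular \<Longrightarrow> (F \<otimes>\<^bsub>P\<^esub> F') c = F c \<circ> F' c"
  using P_apply[of F c] P_apply[of F' c] by (simp add: power_group_def)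

lemma P_group: "group P"
  unfolding power_group_def by (intro product_group) (rule G_group)

sublocale P: group P by (rule P_group)

lemma P_one: "c \<in> regular \<Longrightarrow> \<one>\<^bsub>P\<^esub> c = id"
  by (simp add: power_group_def)

definition glue :: "('a \<Rightarrow> 'a) \<Rightarrow> ((nat \<Rightarrow> int) set \<Rightarrow> 'a \<Rightarrow> 'a) \<Rightarrow> (nat \<Rightarrow> int) set \<Rightarrow> 'a \<Rightarrow> 'a" where
  "glue g F = (\<lambda>c\<in>orbits. if c = orb0 then g else F c)"

lemma glue_Gfib: "g \<in> carrier G \<Longrightarrow> F \<in> carrier P \<Longrightarrow> glue g F \<in> carrier Gfib"
  using P_apply[of F] by (auto simp: glue_def Gfib_carrier)

lemma glue_apply: "c \<in> orbits \<Longrightarrow> glue g F c = (if c = orb0 then g else F c)"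
  by (simp add: glue_def)

lemma glue_inj:
  assumes "F \<in> carrier P" "F' \<in> carrier P" "glue g F = glue g' F'"
  shows "g = g' \<and> F = F'"
proof
  show "g = g'" using fun_cong[OF assms(3), of orb0] by (simp add: glue_apply)
  show "F = F'"
  proof (rule PiE_ext[OF assms(1,2)[unfolded P_carrier]])
    fix c assume "c \<in> regular"
    then show "F c = F' c" using fun_cong[OF assms(3), of c] by (simp add: glue_apply)
  qed
qed

text \<open>The extension to the whole space, by commutation with the shift and by the coordinates over
  the regular orbits, of a map of the fibre over \<open>0\<close>.\<close>

definition Theta :: "((int \<Rightarrow> 'a) \<Rightarrow> int \<Rightarrow> 'a) \<times> ((nat \<Rightarrow> int) set \<Rightarrow> 'a \<Rightarrow> 'a) \<Rightarrow> (int \<Rightarrow> 'a) \<Rightarrow> int \<Rightarrow> 'a" where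
  "Theta a = (\<lambda>x\<in>X. if orb (\<pi> x) = orb0
     then shift (idx (\<pi> x)) (fst a (shift (- idx (\<pi> x)) x))
     else point g0 (\<pi> x) (snd a (orb (\<pi> x)) (coord Plus x)))"

lemma over_orb0:
  assumes "x \<in> X" "orb (\<pi> x) = orb0"
  shows "shift (- idx (\<pi> x)) x \<in> F0" "\<pi> x = emb (idx (\<pi> x))"
proof -
  have "\<pi> x \<in> Z" using assms(1) by (rule factor_map_adic)
  then show pi: "\<pi> x = emb (idx (\<pi> x))" using idx[of "\<pi> x"] assms(2) by (simp add: rep_orb0 emb_adic)
  have "\<pi> (shift (- idx (\<pi> x)) x) = emb (idx (\<pi> x)) \<boxplus> emb (- idx (\<pi> x))"
    using factor_map_shift[OF assms(1), of "- idx (\<pi> x)"] pi by simp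
  also have "\<dots> = zero" by (simp add: emb_0 flip: emb_add)
  finally show "shift (- idx (\<pi> x)) x \<in> F0" using shift_in_X[OF assms(1)] by (simp add: F0_iff)
qed

text \<open>The map \<^term>\<open>mu i g s\<close> uses the same coordinates over \<open>0\<close> as \<^term>\<open>Psi\<close>, and coordinates are
  invariant under the shift. Over a regular orbit the side and the element of \<open>I\<close> can be exchanged
  freely.\<close>

lemma Theta_mu:
  assumes i: "i \<in> I"
  shows "Theta (mu i g s, F) = Psi i (glue g F) zero s"
proof
  fix x
  show "Theta (mu i g s, F) x = Psi i (glue g F) zero s x"
  proof (cases "x \<in> X")
    case True
    then have z: "\<pi> x \<in> Z" by (rule factor_map_adic)
    have R: "Psi i (glue g F) zero s x = point i (\<pi> x) (glue g F (orb (\<pi> x)) (coord s x))"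
      using True z by (simp add: Psi_apply)
    show ?thesis
    proof (cases "orb (\<pi> x) = orb0")
      case o: True
      note y = over_orb0[OF True o]
      let ?k = "idx (\<pi> x)"
      have "mu i g s (shift (- ?k) x) = point i zero (g (coord s x))"
        using y(1) coord_shift[OF True, of s "- ?k"] by (simp add: mu_def)
      then have "Theta (mu i g s, F) x = point i (zero \<boxplus> emb ?k) (g (coord s x))"
        using True o point_shift[OF i adic.one_closed, of ?k] by (simp add: Theta_def)
      also have "zero \<boxplus> emb ?k = emb ?k" using emb_adic by simp
      also have "emb ?k = \<pi> x" using y(2) by (rule sym)
      finally show ?thesis unfolding R o by (simp add: glue_apply)
    next
      case o: False
      have "Theta (mu i g s, F) x = point g0 (\<pi> x) (F (orb (\<pi> x)) (coord Plus x))"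
        using True o by (simp add: Theta_def)
      also have "\<dots> = point i (\<pi> x) (F (orb (\<pi> x)) (coord s x))"
        using point_regular[OF o, of g0] coord_regular[OF o, of Plus s] by simp
      finally show ?thesis unfolding R using o z by (simp add: glue_apply)
    qed
  qed (simp add: Theta_def Psi_def)
qed

lemma Theta_Id: "Theta (Id0, \<one>\<^bsub>P\<^esub>) = (\<lambda>x\<in>X. x)"
proof
  fix x
  show "Theta (Id0, \<one>\<^bsub>P\<^esub>) x = (\<lambda>x\<in>X. x) x"
  proof (cases "x \<in> X")
    case True
    then have z: "\<pi> x \<in> Z" by (rule factor_map_adic)
    show ?thesis
    proof (cases "orb (\<pi> x) = orb0")
      case o: True
      then show ?thesis using True over_orb0(1)[OF True o] by (simp add: Theta_def shift_shift)
    next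
      case o: False
      have "x = point g0 (\<pi> x) (coord Plus x)"
        using True o by (intro point_eqI[OF g0_in_I]) (simp_all add: coord_Plus)
      moreover have "\<one>\<^bsub>P\<^esub> (orb (\<pi> x)) = id" using o z by (intro P_one) simp
      ultimately show ?thesis using True o by (simp add: Theta_def)
    qed
  qed (simp add: Theta_def)
qed

abbreviation FM where "FM \<equiv> fib_model \<theta> l"

lemma FM_carrier: "carrier FM = M \<times> carrier P \<union> {(Id0, \<one>\<^bsub>P\<^esub>)}"
  by (simp add: fib_model_def Let_def struct_semigroup_simps)

lemma FM_mult: "(m, F) \<otimes>\<^bsub>FM\<^esub> (m', F') = (compose F0 m m', F \<otimes>\<^bsub>P\<^esub> F')"
  by (simp add: fib_model_def Let_def struct_semigroup_simps)

lemma FM_cases: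
  assumes "a \<in> carrier FM"
  obtains "a = (Id0, \<one>\<^bsub>P\<^esub>)"
    | i g s F where "a = (mu i g s, F)" "i \<in> I" "g \<in> carrier G" "F \<in> carrier P"
  using assms unfolding FM_carrier by blast

lemma FM_mu: "i \<in> I \<Longrightarrow> g \<in> carrier G \<Longrightarrow> F \<in> carrier P \<Longrightarrow> (mu i g s, F) \<in> carrier FM"
  unfolding FM_carrier by blast

lemma FM_Id: "(Id0, \<one>\<^bsub>P\<^esub>) \<in> carrier FM"
  unfolding FM_carrier by blast

lemma FM_unit:
  assumes "a \<in> carrier FM"
  shows "(Id0, \<one>\<^bsub>P\<^esub>) \<otimes>\<^bsub>FM\<^esub> a = a" "a \<otimes>\<^bsub>FM\<^esub> (Id0, \<one>\<^bsub>P\<^esub>) = a"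
proof -
  have "fst a \<in> extensional F0 \<and> fst a \<in> F0 \<rightarrow> F0 \<and> snd a \<in> carrier P"
    using assms by (rule FM_cases) (use mu_ext in auto)
  then have "compose F0 Id0 (fst a) = fst a" "compose F0 (fst a) Id0 = fst a"
    "\<one>\<^bsub>P\<^esub> \<otimes>\<^bsub>P\<^esub> snd a = snd a" "snd a \<otimes>\<^bsub>P\<^esub> \<one>\<^bsub>P\<^esub> = snd a"
    using compose_id[of "fst a"] by simp_all
  then show "(Id0, \<one>\<^bsub>P\<^esub>) \<otimes>\<^bsub>FM\<^esub> a = a" "a \<otimes>\<^bsub>FM\<^esub> (Id0, \<one>\<^bsub>P\<^esub>) = a"
    by (cases a; simp only: FM_mult fst_conv snd_conv)+
qed

lemma FM_mult_mu: "j \<in> I \<Longrightarrow> (mu i g s, F) \<otimes>\<^bsub>FM\<^esub> (mu j h t, F') = (mu i (g \<circ> sand s j \<circ> h) t, F \<otimes>\<^bsub>P\<^esub> F')"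
  by (simp only: FM_mult mu_mult)

lemma FM_closed:
  assumes a: "a \<in> carrier FM" and b: "b \<in> carrier FM"
  shows "a \<otimes>\<^bsub>FM\<^esub> b \<in> carrier FM"
proof (rule FM_cases[OF a])
  assume "a = (Id0, \<one>\<^bsub>P\<^esub>)"
  then show ?thesis using FM_unit(1)[OF b] b by (simp only:)
next
  fix i g s F assume A: "a = (mu i g s, F)" "i \<in> I" "g \<in> carrier G" "F \<in> carrier P"
  show ?thesis
  proof (rule FM_cases[OF b])
    assume "b = (Id0, \<one>\<^bsub>P\<^esub>)"
    then show ?thesis using FM_unit(2)[OF a] a by (simp only:)
  next
    fix j h t F' assume B: "b = (mu j h t, F')" "j \<in> I" "h \<in> carrier G" "F' \<in> carrier P"
    have "g \<circ> sand s j \<circ> h \<in> carrier G" using A B sand_in_G G_comp by blast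
    then show ?thesis
      unfolding A(1) B(1) FM_mult_mu[OF B(2)] using FM_mu[OF A(2)] P.m_closed[OF A(4) B(4)] by blast
  qed
qed

lemma Theta_PiE: assumes "a \<in> carrier FM" shows "Theta a \<in> X \<rightarrow>\<^sub>E X"
proof (rule FM_cases[OF assms])
  assume "a = (Id0, \<one>\<^bsub>P\<^esub>)"
  then show ?thesis by (simp add: Theta_Id)
next
  fix i g s F assume A: "a = (mu i g s, F)" "i \<in> I"
  show ?thesis unfolding A(1) Theta_mu[OF A(2)] using Psi_PiE[OF A(2) adic.one_closed] .
qed

lemma Theta_hom:
  assumes a: "a \<in> carrier FM" and b: "b \<in> carrier FM"
  shows "Theta (a \<otimes>\<^bsub>FM\<^esub> b) = compose X (Theta a) (Theta b)"
proof (rule FM_cases[OF a])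
  assume A: "a = (Id0, \<one>\<^bsub>P\<^esub>)"
  have "compose X (\<lambda>x\<in>X. x) (Theta b) = Theta b"
    using Theta_PiE[OF b] by (auto simp: compose_def PiE_iff extensional_def fun_eq_iff)
  then show ?thesis using FM_unit(1)[OF b] A by (simp only: Theta_Id)
next
  fix i g s F assume A: "a = (mu i g s, F)" "i \<in> I" "g \<in> carrier G" "F \<in> carrier P"
  show ?thesis
  proof (rule FM_cases[OF b])
    assume B: "b = (Id0, \<one>\<^bsub>P\<^esub>)"
    have "compose X (Theta a) (\<lambda>x\<in>X. x) = Theta a"
      using Theta_PiE[OF a] by (auto simp: compose_def PiE_iff extensional_def fun_eq_iff)
    then show ?thesis using FM_unit(2)[OF a] B by (simp only: Theta_Id)
  next
    fix j h t F' assume B: "b = (mu j h t, F')" "j \<in> I" "h \<in> carrier G" "F' \<in> carrier P"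
    have S: "At (sand s j) \<in> carrier Gfib" using At_Gfib[OF sand_in_G[OF B(2)]] .
    note gl = glue_Gfib[OF A(3,4)] glue_Gfib[OF B(3,4)]
    have gsh: "g \<circ> sand s j \<circ> h \<in> carrier G" using A B sand_in_G G_comp by blast
    have "glue (g \<circ> sand s j \<circ> h) (F \<otimes>\<^bsub>P\<^esub> F') = glue g F \<otimes>\<^bsub>Gfib\<^esub> At (sand s j) \<otimes>\<^bsub>Gfib\<^esub> glue h F'"
    proof (rule Gfib_eqI)
      fix c assume c: "c \<in> orbits"
      show "glue (g \<circ> sand s j \<circ> h) (F \<otimes>\<^bsub>P\<^esub> F') c
          = (glue g F \<otimes>\<^bsub>Gfib\<^esub> At (sand s j) \<otimes>\<^bsub>Gfib\<^esub> glue h F') c"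
        unfolding Gfib_mult[OF Gfib.m_closed[OF gl(1) S] gl(2) c] Gfib_mult[OF gl(1) S c]
        using c P_mult[OF A(4) B(4), of c] by (simp add: glue_apply At_apply)
    next
      show "glue (g \<circ> sand s j \<circ> h) (F \<otimes>\<^bsub>P\<^esub> F') \<in> carrier Gfib"
        using glue_Gfib[OF gsh P.m_closed[OF A(4) B(4)]] .
    qed (intro Gfib.m_closed gl S)
    then show ?thesis
      unfolding A(1) B(1) FM_mult_mu[OF B(2)] Theta_mu[OF A(2)] Theta_mu[OF B(2)]
      using Psi_mult_fib[OF A(2) B(2) gl] by (simp only:)
  qed
qed

lemma Psi_not_id: assumes "i \<in> I" "\<psi> \<in> carrier Gfib" shows "Psi i \<psi> zero s \<noteq> (\<lambda>x\<in>X. x)"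
  using Psi_not_shift[OF assms(1) adic.one_closed assms(2), of s] id_shift by auto

lemma Theta_inj: "inj_on Theta (carrier FM)"
proof (rule inj_onI)
  fix a b assume a: "a \<in> carrier FM" and b: "b \<in> carrier FM" and eq: "Theta a = Theta b"
  show "a = b"
  proof (rule FM_cases[OF a])
    assume A: "a = (Id0, \<one>\<^bsub>P\<^esub>)"
    show ?thesis
    proof (rule FM_cases[OF b])
      fix j h t F' assume B: "b = (mu j h t, F')" "j \<in> I" "h \<in> carrier G" "F' \<in> carrier P"
      show ?thesis
        using eq Psi_not_id[OF B(2) glue_Gfib[OF B(3,4)], of t]
        unfolding A B(1) Theta_Id Theta_mu[OF B(2)] by metis
    qed (simp only: A)
  next
    fix i g s F assume A: "a = (mu i g s, F)" "i \<in> I" "g \<in> carrier G" "F \<in> carrier P"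
    show ?thesis
    proof (rule FM_cases[OF b])
      assume B: "b = (Id0, \<one>\<^bsub>P\<^esub>)"
      show ?thesis
        using eq Psi_not_id[OF A(2) glue_Gfib[OF A(3,4)], of s]
        unfolding B A(1) Theta_Id Theta_mu[OF A(2)] by metis
    next
      fix j h t F' assume B: "b = (mu j h t, F')" "j \<in> I" "h \<in> carrier G" "F' \<in> carrier P"
      have "i = j \<and> glue g F = glue h F' \<and> zero = zero \<and> s = t"
        using eq unfolding A(1) B(1) Theta_mu[OF A(2)] Theta_mu[OF B(2)]
        by (rule Psi_inj[OF A(2) B(2) adic.one_closed adic.one_closed glue_Gfib[OF A(3,4)] glue_Gfib[OF B(3,4)]])
      then show ?thesis using glue_inj[OF A(4) B(4), of g h] unfolding A(1) B(1) by blast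
    qed
  qed
qed

lemma Theta_image:
  assumes At_H: "\<And>g. g \<in> carrier G \<Longrightarrow> At g \<in> H"
  shows "Theta ` carrier FM = ellis_fib \<theta> l"
proof -
  have eq: "ellis_fib \<theta> l = insert (\<lambda>x\<in>X. x) {Psi i \<psi> zero s | i \<psi> s. i \<in> I \<and> \<psi> \<in> carrier Gfib}"
    by (rule ellis_fib_full) (rule At_H)
  show ?thesis unfolding eq
  proof (rule equalityI; rule subsetI)
    fix f assume "f \<in> Theta ` carrier FM"
    then obtain a where a: "a \<in> carrier FM" "f = Theta a" by blast
    show "f \<in> insert (\<lambda>x\<in>X. x) {Psi i \<psi> zero s | i \<psi> s. i \<in> I \<and> \<psi> \<in> carrier Gfib}"
    proof (rule FM_cases[OF a(1)])
      assume "a = (Id0, \<one>\<^bsub>P\<^esub>)"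
      then have "f = (\<lambda>x\<in>X. x)" using a(2) by (simp only: Theta_Id)
      then show ?thesis by blast
    next
      fix i g s F assume A: "a = (mu i g s, F)" "i \<in> I" "g \<in> carrier G" "F \<in> carrier P"
      show ?thesis unfolding a(2) A(1) Theta_mu[OF A(2)] using A(2) glue_Gfib[OF A(3,4)] by blast
    qed
  next
    fix f assume "f \<in> insert (\<lambda>x\<in>X. x) {Psi i \<psi> zero s | i \<psi> s. i \<in> I \<and> \<psi> \<in> carrier Gfib}"
    then consider "f = (\<lambda>x\<in>X. x)" | i \<psi> s where "f = Psi i \<psi> zero s" "i \<in> I" "\<psi> \<in> carrier Gfib" by blast
    then show "f \<in> Theta ` carrier FM"
    proof cases
      case 1
      show ?thesis unfolding 1 Theta_Id[symmetric] using FM_Id by (rule imageI)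
    next
      case 2
      let ?F = "restrict \<psi> regular"
      have F: "?F \<in> carrier P" using Gfib_apply[OF 2(3)] by (auto simp: P_carrier)
      have g: "\<psi> orb0 \<in> carrier G" using Gfib_apply[OF 2(3)] by simp
      have "glue (\<psi> orb0) ?F = \<psi>"
        by (rule Gfib_eqI[OF glue_Gfib[OF g F] 2(3)]) (simp add: glue_apply)
      then have "f = Theta (mu i (\<psi> orb0) s, ?F)" unfolding 2(1) Theta_mu[OF 2(2)] by (simp only:)
      then show ?thesis using FM_mu[OF 2(2) g F] by blast
    qed
  qed
qed

abbreviation TM where "TM \<equiv> fib_model_topology \<theta> l"

abbreviation big where "big \<equiv> prod_topology (discrete_topology (M \<union> {Id0})) (power_topology \<theta> l regular)"

lemma TM_eq: "TM = subtopology big (carrier FM)"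
  by (simp add: fib_model_topology_def struct_semigroup_simps)

lemma FM_sub: "carrier FM \<subseteq> (M \<union> {Id0}) \<times> carrier P"
  unfolding FM_carrier using P.one_closed by blast

lemma topspace_big: "topspace big = (M \<union> {Id0}) \<times> carrier P"
  by (simp only: topspace_prod_topology topspace_discrete_topology topspace_power P_carrier)

lemma TM_topspace: "topspace TM = carrier FM"
  unfolding TM_eq topspace_subtopology topspace_big using FM_sub by blast

lemma TM_compact: "compact_space TM"
  unfolding TM_eq
proof (rule compact_space_subtopology)
  have "M \<subseteq> (\<lambda>(i, g, s). mu i g s) ` (I \<times> carrier G \<times> {Plus, Minus})" using pm_in by force
  moreover have "finite ((\<lambda>(i, g, s). mu i g s) ` (I \<times> carrier G \<times> {Plus, Minus}))"
    using finite_I G_finite by simp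
  ultimately have "finite M" by (rule finite_subset)
  then have "compactin (discrete_topology (M \<union> {Id0})) M" unfolding compactin_discrete_topology by blast
  moreover have "compactin (power_topology \<theta> l regular) (carrier P)"
    using compact_power[of regular] unfolding compact_space_def topspace_power P_carrier .
  ultimately have "compactin big (M \<times> carrier P)" unfolding compactin_Times by blast
  moreover have "compactin big {(Id0, \<one>\<^bsub>P\<^esub>)}"
    unfolding compactin_sing topspace_big using P.one_closed by blast
  ultimately show "compactin big (carrier FM)" unfolding FM_carrier by (rule compactin_Un)
qed

lemma Theta_continuous:
  assumes x: "x \<in> X"
  shows "continuous_map TM (space_topology \<theta>) (\<lambda>a. Theta a x)"
proof -
  have z: "\<pi> x \<in> Z" using x by (rule factor_map_adic)
  have "continuous_map big (space_topology \<theta>) (\<lambda>a. Theta a x)"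
  proof (cases "orb (\<pi> x) = orb0")
    case True
    let ?k = "idx (\<pi> x)"
    have "m (shift (- ?k) x) \<in> X" if m: "m \<in> M \<union> {Id0}" for m
    proof -
      have "m \<in> F0 \<rightarrow> F0" using m mu_ext by auto
      then show ?thesis using over_orb0(1)[OF x True] F0_iff by blast
    qed
    then have "continuous_map (discrete_topology (M \<union> {Id0})) (space_topology \<theta>) (\<lambda>m. shift ?k (m (shift (- ?k) x)))"
      unfolding continuous_map_from_discrete_topology topspace_space_topology
      using shift_in_X by blast
    from continuous_map_compose[OF continuous_map_fst this]
    show ?thesis using x True by (simp add: Theta_def comp_def)
  next
    case False
    let ?c = "orb (\<pi> x)"
    have c: "?c \<in> regular" using False z by simp
    have 1: "continuous_map (power_topology \<theta> l regular) (discrete_topology (carrier G)) (\<lambda>F. F ?c)"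
      unfolding power_topology_def using continuous_map_product_projection[OF c] .
    have 2: "continuous_map (discrete_topology (carrier G)) (space_topology \<theta>) (\<lambda>g. point g0 (\<pi> x) (g (coord Plus x)))"
      unfolding continuous_map_from_discrete_topology topspace_space_topology
      using point(1)[OF g0_in_I z] by blast
    from continuous_map_compose[OF continuous_map_compose[OF continuous_map_snd 1] 2]
    show ?thesis using x False by (simp add: Theta_def comp_def)
  qed
  then show ?thesis unfolding TM_eq by (rule continuous_map_from_subtopology)
qed

lemma fib_model_top_isomorphic:
  assumes At_H: "\<And>g. g \<in> carrier G \<Longrightarrow> At g \<in> H"
  shows "semigroup_top_isomorphic (map_semigroup X (ellis_fib \<theta> l))
    (subtopology (self_map_topology \<theta>) (ellis_fib \<theta> l)) FM TM"
proof (rule top_isomorphic_by_maps[where Phi = Theta])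
  show image: "Theta ` carrier FM = ellis_fib \<theta> l" by (rule Theta_image) (rule At_H)
  show "ellis_fib \<theta> l \<subseteq> X \<rightarrow>\<^sub>E X" unfolding image[symmetric] using Theta_PiE by blast
qed (fact FM_closed Theta_hom Theta_inj TM_topspace TM_compact Theta_continuous)+

end

theorem theorem4p12:
  fixes \<theta> :: "'a::finite \<Rightarrow> 'a list" and l :: nat and g0 :: "'a \<Rightarrow> 'a"
  assumes "substitution \<theta> l"
    and "primitive_subst \<theta>"
    and "aperiodic_subst \<theta>"
    and "bijective_subst \<theta> l"
    and "simplified_subst \<theta> l"
    and "generated_by_idempotents (struct_semigroup \<theta> l)"
    and "g0 \<in> struct_I \<theta> l"
  defines "X \<equiv> subst_space \<theta>"
    and "Gfib \<equiv> power_group \<theta> l (adic_orbits l)"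
  shows
    "semigroup_top_isomorphic
       (map_semigroup X (ellis_fib \<theta> l))
       (subtopology (self_map_topology \<theta>) (ellis_fib \<theta> l))
       (fib_model \<theta> l)
       (fib_model_topology \<theta> l)
     \<and> completely_simple (map_semigroup X (ellis_fib \<theta> l - {\<lambda>x\<in>X. x}))
     \<and> semigroup_top_isomorphic
       (map_semigroup X (ellis_fib \<theta> l - {\<lambda>x\<in>X. x}))
       (subtopology (self_map_topology \<theta>) (ellis_fib \<theta> l - {\<lambda>x\<in>X. x}))
       (rees_semigroup Gfib (struct_I \<theta> l) {Plus, Minus}
          (\<lambda>s g. at_zero_orbit \<theta> l (sandwich \<theta> l g0 s g)))
       (rees_topology (power_topology \<theta> l (adic_orbits l)) (struct_I \<theta> l) {Plus, Minus})
     \<and> (\<exists>\<phi>. \<phi> \<in> hom (adic_group l) (AutoGroup Gfib) \<and>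
          semigroup_isomorphic
            (map_semigroup X (ellis \<theta> - shift_maps \<theta>))
            (rees_semigroup (semidirect_product Gfib (adic_group l) \<phi>)
               (struct_I \<theta> l) {Plus, Minus}
               (\<lambda>s g. (at_zero_orbit \<theta> l (sandwich \<theta> l g0 s g), \<one>\<^bsub>adic_group l\<^esub>))))"
proof -
  interpret simplified_bijective_base \<theta> l g0
    by unfold_locales (fact assms)+
  have At_H: "At g \<in> H" if "g \<in> carrier G" for g
    using At_in_H_if_generated[OF assms(6) that] .
  show ?thesis
    unfolding X_def Gfib_def
  proof (intro conjI exI[of _ rot])
  qed (rule rot_hom fib_model_top_isomorphic fib_completely_simple fib_rees_top_isomorphic ellis_isomorphic At_H | assumption)+
qed

end
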